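(* The problem Trivially Perfect Editing admits a kernel with $O(k^3)$ vertices. That is, there is an algorithm that, given an instance $(G,k)$ of Trivially Perfect Editing, runs in time polynomial in $|V(G)|$ and $k$ and outputs an instance $(G',k')$ of Trivially Perfect Editing such that $(G',k')$ is a yes-instance if and only if $(G,k)$ is a yes-instance, $|V(G')| = O(k^3)$, and $k' \le g(k)$ for some computable function $g$.
   Context: All graphs are finite, simple and undirected. A graph is trivially perfect if it contains neither $P_4$ (the path on 4 vertices) nor $C_4$ (the cycle on 4 vertices) as an induced subgraph. Trivially Perfect Editing: given a graph $G=(V,E)$ and an integer $k\in\mathbb{N}$, decide whether there is a set $F$ of unordered pairs of distinct vertices of $V$ with $|F|\le k$ such that $H=(V,E\triangle F)$ is trivially perfect, where $E\triangle F=(E\setminus F)\cup(F\setminus E)$. Such an $F$ is a $k$-edition of $G$; $(G,k)$ is a yes-instance if a $k$-edition exists. *)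

theory Defs
  imports Complex_Main "HOL-Library.Landau_Symbols" "HOL-Computational_Algebra.Polynomial"
begin

section \<open>Graphs and Trivially Perfect Editing\<close>

datatype 'a ugraph = UGraph (verts: "'a set") (edges: "'a set set")

definition vertex_pairs :: "'a set \<Rightarrow> 'a set set" where
  "vertex_pairs V = {e. e \<subseteq> V \<and> card e = 2}"

definition simple_graph :: "'a ugraph \<Rightarrow> bool" where
  "simple_graph G \<longleftrightarrow> finite (verts G) \<and> edges G \<subseteq> vertex_pairs (verts G)"

definition induced_subgraph :: "'a ugraph \<Rightarrow> 'a set \<Rightarrow> 'a ugraph" where
  "induced_subgraph G S = UGraph S {e \<in> edges G. e \<subseteq> S}"

definition isomorphic :: "'a ugraph \<Rightarrow> 'b ugraph \<Rightarrow> bool" where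
  "isomorphic G H \<longleftrightarrow>
     (\<exists>f. bij_betw f (verts G) (verts H) \<and>
          (\<forall>u\<in>verts G. \<forall>v\<in>verts G. {u, v} \<in> edges G \<longleftrightarrow> {f u, f v} \<in> edges H))"

definition contains_induced :: "'a ugraph \<Rightarrow> 'b ugraph \<Rightarrow> bool" where
  "contains_induced G H \<longleftrightarrow> (\<exists>S \<subseteq> verts G. isomorphic (induced_subgraph G S) H)"

definition P4 :: "nat ugraph" where
  "P4 = UGraph {0, 1, 2, 3} {{0, 1}, {1, 2}, {2, 3}}"

definition C4 :: "nat ugraph" where
  "C4 = UGraph {0, 1, 2, 3} {{0, 1}, {1, 2}, {2, 3}, {3, 0}}"

definition trivially_perfect :: "'a ugraph \<Rightarrow> bool" where
  "trivially_perfect G \<longleftrightarrow> \<not> contains_induced G P4 \<and> \<not> contains_induced G C4"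

definition edit :: "'a ugraph \<Rightarrow> 'a set set \<Rightarrow> 'a ugraph" where
  "edit G F = UGraph (verts G) ((edges G - F) \<union> (F - edges G))"

definition is_edition :: "'a ugraph \<Rightarrow> nat \<Rightarrow> 'a set set \<Rightarrow> bool" where
  "is_edition G k F \<longleftrightarrow>
     F \<subseteq> vertex_pairs (verts G) \<and> card F \<le> k \<and> trivially_perfect (edit G F)"

definition yes_instance :: "'a ugraph \<Rightarrow> nat \<Rightarrow> bool" where
  "yes_instance G k \<longleftrightarrow> (\<exists>F. is_edition G k F)"


section \<open>Model of computation\<close>

text \<open>
  Algorithms are programs of a unit-cost random access machine, presented as a structured
  language: registers and random-access memory hold natural numbers of unbounded size, and the
  only arithmetic is addition and truncated subtraction. The registers and the memory regions
  (two-dimensional arrays) carry names; a program mentions only finitely many of them, and array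
  indices may be computed. Every assignment and every test costs one step; as the expressions
  occurring in a fixed program have bounded size, charging for their operations
  would change the running time only by a constant factor. There is deliberately no multiplication:
  the bit length of all stored numbers and addresses then grows by at most a constant per step,
  so that running times are polynomially related to those of Turing machines.
\<close>

type_synonym vname = string

record state =
  reg :: "vname \<Rightarrow> nat"
  arr :: "vname \<Rightarrow> nat \<Rightarrow> nat \<Rightarrow> nat"

datatype aexp =
    Const nat
  | Var vname
  | Read vname aexp aexp
  | Add aexp aexp
  | Sub aexp aexp

datatype bexp =
    Lt aexp aexp
  | Eq aexp aexp
  | Neg bexp
  | Conj bexp bexp

datatype com =
    Skip
  | Assign vname aexp
  | Store vname aexp aexp aexp
  | Seq com com
  | Cond bexp com com
  | While bexp com

primrec aval :: "aexp \<Rightarrow> state \<Rightarrow> nat" where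
  "aval (Const c) s = c"
| "aval (Var x) s = reg s x"
| "aval (Read A a b) s = arr s A (aval a s) (aval b s)"
| "aval (Add a b) s = aval a s + aval b s"
| "aval (Sub a b) s = aval a s - aval b s"

primrec bval :: "bexp \<Rightarrow> state \<Rightarrow> bool" where
  "bval (Lt a b) s \<longleftrightarrow> aval a s < aval b s"
| "bval (Eq a b) s \<longleftrightarrow> aval a s = aval b s"
| "bval (Neg b) s \<longleftrightarrow> \<not> bval b s"
| "bval (Conj b c) s \<longleftrightarrow> bval b s \<and> bval c s"

definition set_reg :: "vname \<Rightarrow> nat \<Rightarrow> state \<Rightarrow> state" where
  "set_reg x v s = s\<lparr>reg := (reg s)(x := v)\<rparr>"

definition set_arr :: "vname \<Rightarrow> nat \<Rightarrow> nat \<Rightarrow> nat \<Rightarrow> state \<Rightarrow> state" where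
  "set_arr A i j v s = s\<lparr>arr := (arr s)(A := (arr s A)(i := (arr s A i)(j := v)))\<rparr>"

text \<open>\<open>exec c s t s'\<close>: started in \<open>s\<close>, the program \<open>c\<close> halts after exactly \<open>t\<close> steps in \<open>s'\<close>.\<close>

inductive exec :: "com \<Rightarrow> state \<Rightarrow> nat \<Rightarrow> state \<Rightarrow> bool" where
  exec_Skip: "exec Skip s 1 s"
| exec_Assign: "exec (Assign x a) s 1 (set_reg x (aval a s) s)"
| exec_Store: "exec (Store A a b e) s 1 (set_arr A (aval a s) (aval b s) (aval e s) s)"
| exec_Seq: "exec c s t s' \<Longrightarrow> exec d s' u s'' \<Longrightarrow> exec (Seq c d) s (t + u) s''"
| exec_CondTrue: "bval b s \<Longrightarrow> exec c s t s' \<Longrightarrow> exec (Cond b c d) s (t + 1) s'"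
| exec_CondFalse: "\<not> bval b s \<Longrightarrow> exec d s t s' \<Longrightarrow> exec (Cond b c d) s (t + 1) s'"
| exec_WhileFalse: "\<not> bval b s \<Longrightarrow> exec (While b c) s 1 s"
| exec_WhileTrue:
    "bval b s \<Longrightarrow> exec c s t s' \<Longrightarrow> exec (While b c) s' u s'' \<Longrightarrow>
     exec (While b c) s (t + u + 1) s''"

inductive_cases exec_SkipE: "exec Skip s t s'"
inductive_cases exec_AssignE: "exec (Assign x a) s t s'"
inductive_cases exec_StoreE: "exec (Store A a b e) s t s'"
inductive_cases exec_SeqE: "exec (Seq c d) s t s'"
inductive_cases exec_CondE: "exec (Cond b c d) s t s'"
inductive_cases exec_WhileE: "exec (While b c) s t s'"

text \<open>A program has at most one halting run from each state, so the existence of a run with given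
  properties is a statement about the run.\<close>

lemma exec_deterministic:
  "exec c s t s' \<Longrightarrow> exec c s u s'' \<Longrightarrow> u = t \<and> s'' = s'"
proof (induction arbitrary: u s'' rule: exec.induct)
  case (exec_Seq c s t s' d v s1)
  from exec_Seq.prems obtain t1 r t2
    where u: "u = t1 + t2" "exec c s t1 r" "exec d r t2 s''"
    by (rule exec_SeqE)
  with exec_Seq.IH(1)[OF u(2)] exec_Seq.IH(2)[of t2 s''] show ?case by simp
next
  case (exec_CondTrue b s c t s' d)
  from exec_CondTrue.prems obtain t1 where u: "u = t1 + 1" "exec c s t1 s''"
    by (rule exec_CondE) (use exec_CondTrue.hyps in auto)
  with exec_CondTrue.IH[OF u(2)] show ?case by simp
next
  case (exec_CondFalse b s d t s' c)
  from exec_CondFalse.prems obtain t1 where u: "u = t1 + 1" "exec d s t1 s''"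
    by (rule exec_CondE) (use exec_CondFalse.hyps in auto)
  with exec_CondFalse.IH[OF u(2)] show ?case by simp
next
  case (exec_WhileFalse b s c)
  from exec_WhileFalse.prems show ?case
    by (rule exec_WhileE) (use exec_WhileFalse.hyps in auto)
next
  case (exec_WhileTrue b s c t s' v s1)
  from exec_WhileTrue.prems obtain t1 r t2
    where u: "u = t1 + t2 + 1" "exec c s t1 r" "exec (While b c) r t2 s''"
    by (rule exec_WhileE) (use exec_WhileTrue.hyps in auto)
  with exec_WhileTrue.IH(1)[OF u(2)] exec_WhileTrue.IH(2)[of t2 s''] show ?case by simp
qed (erule exec_SkipE exec_AssignE exec_StoreE, simp)+

definition blank :: state where
  "blank = \<lparr>reg = (\<lambda>_. 0), arr = (\<lambda>_ _ _. 0)\<rparr>"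

definition computable :: "(nat \<Rightarrow> nat) \<Rightarrow> bool" where
  "computable g \<longleftrightarrow>
     (\<exists>P. \<forall>x. \<exists>t s. exec P (set_reg ''x'' x blank) t s \<and> reg s ''y'' = g x)"


section \<open>Instances as machine states\<close>

text \<open>
  An instance \<open>(G, k)\<close> is presented by the number of vertices, \<open>k\<close> and the adjacency matrix
  of \<open>G\<close> with respect to an enumeration \<open>vs\<close> of its vertices. Vertices are natural numbers,
  so every finite graph is covered up to renaming, by one and the same program. An input contains
  nothing else; an output may leave scratch data elsewhere in memory.
\<close>

definition enumerates :: "nat list \<Rightarrow> nat ugraph \<Rightarrow> bool" where
  "enumerates vs G \<longleftrightarrow> distinct vs \<and> set vs = verts G"

definition input_state :: "nat list \<Rightarrow> nat ugraph \<Rightarrow> nat \<Rightarrow> state" where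
  "input_state vs G k =
     \<lparr>reg = (\<lambda>_. 0)(''n'' := length vs, ''k'' := k),
      arr = (\<lambda>_ _ _. 0)(''adj'' := (\<lambda>i j.
        if i < length vs \<and> j < length vs \<and> {vs ! i, vs ! j} \<in> edges G then 1 else 0))\<rparr>"

definition output_instance :: "state \<Rightarrow> nat ugraph \<Rightarrow> nat \<Rightarrow> bool" where
  "output_instance s G k \<longleftrightarrow>
     simple_graph G \<and> reg s ''k'' = k \<and>
     (\<exists>vs. enumerates vs G \<and> reg s ''n'' = length vs \<and>
        (\<forall>i<length vs. \<forall>j<length vs.
           arr s ''adj'' i j = (if {vs ! i, vs ! j} \<in> edges G then 1 else 0)))"

end

theory Submission imports Defs begin

text \<open>
  A graph is trivially perfect iff the closed neighbourhoods of any two adjacent vertices are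
  nested, so that its vertices form a forest in which adjacency is comparability. The kernel
  deletes one vertex at a time: a vertex with more than \<open>2 * k\<close> true twins; a vertex of a large
  trivially perfect module whose neighbourhood \<open>K\<close> has many pairwise nonadjacent common
  neighbours (which force \<open>K\<close> to become a clique); a shaft vertex in the middle of a long comb. In each case,
  at most \<open>2 * k\<close> vertices are touched by an edition of the smaller graph, hence an untouched
  witness exists, and a neighbourhood of the deleted vertex can be put back exactly as it was
  in the original graph without any cost.

  If no rule applies, take the forest of an edited graph. The sets of touched vertices below
  the vertices form a laminar family, so there are at most \<open>4 * k\<close> nonempty ones. For each of them, the vertices
  with this set form a chain of \<open>O(k)\<close> twin classes of size \<open>O(k)\<close>, and the untouched subtrees
  hanging off this chain have \<open>O(k\<^sup>2)\<close> vertices in total. This gives \<open>O(k\<^sup>3)\<close> vertices.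

  The rules are first-order definable with counting, and such formulas compile to nested
  bounded loops, which makes the running time polynomial.
\<close>

section \<open>Trivially perfect graphs as reflexive relations\<close>

type_synonym adjacency = "nat \<Rightarrow> nat \<Rightarrow> bool"

text \<open>With a reflexive \<open>A\<close> these are closed neighbourhoods, so a vertex is
  adjacent to every vertex that it is nested in. This makes \<open>nle\<close> usable as an ancestor
  order.\<close>

definition nle :: "nat set \<Rightarrow> adjacency \<Rightarrow> nat \<Rightarrow> nat \<Rightarrow> bool" where
  "nle V A u v \<longleftrightarrow> (\<forall>z\<in>V. A z u \<longrightarrow> A z v)"

definition rgraph :: "nat set \<Rightarrow> adjacency \<Rightarrow> bool" where
  "rgraph V A \<longleftrightarrow> finite V \<and> (\<forall>u\<in>V. A u u) \<and> (\<forall>u\<in>V. \<forall>v\<in>V. A u v \<longrightarrow> A v u)"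

definition nested :: "nat set \<Rightarrow> adjacency \<Rightarrow> bool" where
  "nested V A \<longleftrightarrow> (\<forall>u\<in>V. \<forall>v\<in>V. A u v \<longrightarrow> nle V A u v \<or> nle V A v u)"

text \<open>Unordered pairs, so that each edited pair counts once; no singletons occur when both
  relations are reflexive.\<close>

definition diffs :: "nat set \<Rightarrow> adjacency \<Rightarrow> adjacency \<Rightarrow> nat set set" where
  "diffs V A B = {e. \<exists>u\<in>V. \<exists>v\<in>V. e = {u, v} \<and> A u v \<noteq> B u v}"

text \<open>Asks for the edited graph instead of the set of edited pairs. Values of \<open>B\<close>
  outside \<open>V\<close> do not matter, so the same \<open>B\<close> serves every subset of
  \<open>V\<close>.\<close>

definition editable :: "nat set \<Rightarrow> adjacency \<Rightarrow> nat \<Rightarrow> bool" where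
  "editable V A k \<longleftrightarrow> (\<exists>B. rgraph V B \<and> nested V B \<and> card (diffs V A B) \<le> k)"

lemma rgraphD:
  assumes "rgraph V A"
  shows "finite V" "u \<in> V \<Longrightarrow> A u u" "u \<in> V \<Longrightarrow> v \<in> V \<Longrightarrow> A u v \<Longrightarrow> A v u"
  using assms unfolding rgraph_def by auto

lemma rgraph_commute: "rgraph V A \<Longrightarrow> u \<in> V \<Longrightarrow> v \<in> V \<Longrightarrow> A u v \<longleftrightarrow> A v u"
  by (auto simp: rgraph_def)

lemma nle_refl: "nle V A u u"
  by (simp add: nle_def)

lemma nle_trans: "nle V A u v \<Longrightarrow> nle V A v w \<Longrightarrow> nle V A u w"
  by (auto simp: nle_def)

lemma nleD: "nle V A u v \<Longrightarrow> z \<in> V \<Longrightarrow> A z u \<Longrightarrow> A z v"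
  by (auto simp: nle_def)

lemma nle_adj: "rgraph V A \<Longrightarrow> u \<in> V \<Longrightarrow> nle V A u v \<Longrightarrow> A u v"
  by (auto simp: nle_def rgraph_def)

text \<open>The form in which nestedness is mostly used: the neighbour \<open>x\<close> of
  \<open>u\<close> missed by \<open>v\<close> excludes one of the two inclusions, so the other one
  holds. It yields the edges that unaffected vertices force in an edited graph.\<close>

lemma nested_private:
  assumes "nested V A" "u \<in> V" "v \<in> V" "A u v" "x \<in> V" "A x u" "\<not> A x v" "z \<in> V" "A z v"
  shows "A z u"
  using assms unfolding nested_def nle_def by blast

lemma rgraph_mono: "rgraph V A \<Longrightarrow> U \<subseteq> V \<Longrightarrow> rgraph U A"
  unfolding rgraph_def by (meson finite_subset subsetD)

lemma finite_diffs: "finite V \<Longrightarrow> finite (diffs V A B)"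
  by (rule finite_subset[of _ "Pow V"]) (auto simp: diffs_def)

definition affected :: "nat set \<Rightarrow> adjacency \<Rightarrow> adjacency \<Rightarrow> nat set" where
  "affected V A B = {u \<in> V. \<exists>w\<in>V. A u w \<noteq> B u w}"

lemma affectedD: "u \<notin> affected V A B \<Longrightarrow> u \<in> V \<Longrightarrow> w \<in> V \<Longrightarrow> A u w \<longleftrightarrow> B u w"
  by (auto simp: affected_def)

lemma finite_affected: "finite V \<Longrightarrow> finite (affected V A B)"
  by (simp add: affected_def)

lemma card_affected:
  assumes "finite V" "card (diffs V A B) \<le> k"
  shows "card (affected V A B) \<le> 2 * k"
proof -
  have "affected V A B \<subseteq> \<Union>(diffs V A B)"
    by (auto simp: affected_def diffs_def)
  moreover have "finite (\<Union>(diffs V A B))"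
    by (rule finite_subset[OF _ assms(1)]) (auto simp: diffs_def)
  ultimately have "card (affected V A B) \<le> card (\<Union>(diffs V A B))"
    by (rule card_mono[rotated])
  also have "\<dots> \<le> sum card (diffs V A B)"
    by (rule card_Union_le_sum_card)
  also have "\<dots> \<le> (\<Sum>e\<in>diffs V A B. 2)"
    by (rule sum_mono) (auto simp: diffs_def card_insert_if split: if_splits)
  also have "\<dots> \<le> 2 * k" using assms(2) by simp
  finally show ?thesis .
qed

lemma editable_inj_image:
  assumes f: "bij_betw f V W" and fin: "finite V"
    and AB: "\<And>u v. u \<in> V \<Longrightarrow> v \<in> V \<Longrightarrow> A u v \<longleftrightarrow> B (f u) (f v)"
    and ed: "editable W B k"
  shows "editable V A k"
proof -
  obtain B' where B': "rgraph W B'" "nested W B'" "card (diffs W B B') \<le> k"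
    using ed by (auto simp: editable_def)
  define A' where "A' u v = B' (f u) (f v)" for u v
  have W: "W = f ` V" and inj: "inj_on f V" using f by (auto simp: bij_betw_def)
  have "rgraph V A'" using B'(1) fin by (auto simp: rgraph_def A'_def W)
  moreover have "nested V A'" using B'(2) by (auto simp: nested_def nle_def A'_def W)
  moreover have "card (diffs V A A') \<le> k"
  proof -
    have "(`) f ` diffs V A A' \<subseteq> diffs W B B'"
    proof
      fix e assume "e \<in> (`) f ` diffs V A A'"
      then obtain u v where "u \<in> V" "v \<in> V" "e = {f u, f v}" "A u v \<noteq> A' u v"
        by (auto simp: diffs_def)
      then show "e \<in> diffs W B B'"
        unfolding diffs_def W by (auto simp: A'_def AB)
    qed
    moreover have "inj_on ((`) f) (diffs V A A')"
      by (rule inj_on_subset[OF inj_on_image_Pow[OF inj]]) (auto simp: diffs_def)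
    moreover have "finite W" using fin W by simp
    ultimately have "card (diffs V A A') \<le> card (diffs W B B')"
      by (metis card_inj_on_le finite_diffs)
    then show ?thesis using B'(3) by simp
  qed
  ultimately show ?thesis by (auto simp: editable_def)
qed

text \<open>The machine works on indices below \<open>n\<close>, and a deletion may rename the last
  of them, so solvability has to survive bijections.\<close>

lemma editable_cong_bij:
  assumes f: "bij_betw f V W" and fin: "finite V"
    and AB: "\<And>u v. u \<in> V \<Longrightarrow> v \<in> V \<Longrightarrow> A u v \<longleftrightarrow> B (f u) (f v)"
  shows "editable V A k \<longleftrightarrow> editable W B k"
proof
  assume "editable W B k"
  then show "editable V A k" by (rule editable_inj_image[of f V W, OF f fin, rotated]) (rule AB)
next
  assume ed: "editable V A k"
  have g: "bij_betw (the_inv_into V f) W V" by (rule bij_betw_the_inv_into[OF f])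
  have fW: "finite W" using f fin bij_betw_finite by blast
  have "B u v \<longleftrightarrow> A (the_inv_into V f u) (the_inv_into V f v)" if "u \<in> W" "v \<in> W" for u v
  proof -
    have "the_inv_into V f u \<in> V" "the_inv_into V f v \<in> V"
      using g that by (auto simp: bij_betw_def)
    moreover have "f (the_inv_into V f u) = u" "f (the_inv_into V f v) = v"
      using f that f_the_inv_into_f_bij_betw by fastforce+
    ultimately show ?thesis by (simp add: AB)
  qed
  then show "editable W B k" by (intro editable_inj_image[of _ W V, OF g fW _ ed]) blast
qed

lemma editable_mono:
  assumes "editable V A k" "U \<subseteq> V" "finite V"
  shows "editable U A k"
proof -
  obtain B where B: "rgraph V B" "nested V B" "card (diffs V A B) \<le> k"
    using assms(1) by (auto simp: editable_def)
  have "diffs U A B \<subseteq> diffs V A B" using assms(2) by (auto simp: diffs_def)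
  then have "card (diffs U A B) \<le> k"
    using B(3) card_mono[OF finite_diffs[OF assms(3)]] by (meson order_trans)
  moreover have "nested U B" using B(2) assms(2) unfolding nested_def nle_def by (meson subsetD)
  ultimately show ?thesis using rgraph_mono[OF B(1) assms(2)] by (auto simp: editable_def)
qed

section \<open>Reinserting a well-attached set\<close>

text \<open>Pairs that meet \<open>Z\<close> are reset to their original state and cost nothing.
  Edits of \<open>B\<close> at vertices of \<open>Z\<close> are discarded, hence nestedness must be
  established anew.\<close>

definition glue :: "nat set \<Rightarrow> adjacency \<Rightarrow> adjacency \<Rightarrow> nat \<Rightarrow> nat \<Rightarrow> bool" where
  "glue Z A B u v = (if u \<in> Z \<or> v \<in> Z then A u v else B u v)"

text \<open>\<open>T1\<close> lies above \<open>Z = Zc \<union> Zr\<close>, \<open>T2\<close> below \<open>Zc\<close> only, and \<open>T3\<close> is unrelated to \<open>Z\<close>.\<close>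

lemma nested_glue:
  fixes V T1 T2 T3 Zc Zr :: "nat set" and A B
  defines "Z \<equiv> Zc \<union> Zr"
  assumes A: "rgraph V A" and B: "rgraph (V - Z) B" "nested (V - Z) B"
    and V: "V = T1 \<union> T2 \<union> T3 \<union> Z"
    and disj: "T1 \<inter> Z = {}" "T2 \<inter> Z = {}" "T3 \<inter> Z = {}"
    and ZT1: "\<And>z u. z \<in> Z \<Longrightarrow> u \<in> T1 \<Longrightarrow> A z u"
    and ZcT2: "\<And>z u. z \<in> Zc \<Longrightarrow> u \<in> T2 \<Longrightarrow> A z u"
    and ZrT2: "\<And>z u. z \<in> Zr \<Longrightarrow> u \<in> T2 \<Longrightarrow> \<not> A z u"
    and ZT3: "\<And>z u. z \<in> Z \<Longrightarrow> u \<in> T3 \<Longrightarrow> \<not> A z u"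
    and nestZ: "nested Z A"
    and Zc: "\<And>c d. c \<in> Zc \<Longrightarrow> d \<in> Zc \<Longrightarrow> A c d"
    and Zcr: "\<And>c r. c \<in> Zc \<Longrightarrow> r \<in> Zr \<Longrightarrow> A c r \<Longrightarrow> nle Z A r c"
    and cl: "\<And>u v. u \<in> T1 \<Longrightarrow> v \<in> T1 \<Longrightarrow> B u v"
    and T12: "\<And>u v. u \<in> T1 \<Longrightarrow> v \<in> T2 \<Longrightarrow> B u v"
    and T23: "\<And>u v. u \<in> T2 \<Longrightarrow> v \<in> T3 \<Longrightarrow> \<not> B u v"
    and T13: "\<And>u v. u \<in> T1 \<Longrightarrow> v \<in> T3 \<Longrightarrow> B u v \<Longrightarrow> nle (V - Z) B v u"
  shows "nested V (glue Z A B)"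
proof -
  let ?G = "glue Z A B"
  have symA: "A v u" if "A u v" "u \<in> V" "v \<in> V" for u v
    using A that by (auto simp: rgraph_def)
  have symB: "B v u" if "B u v" "u \<in> V - Z" "v \<in> V - Z" for u v
    using B(1) that by (auto simp: rgraph_def)
  have ZV: "Z \<subseteq> V" "Zc \<subseteq> Z" "Zr \<subseteq> Z" using V by (auto simp: Z_def)
  have TV: "T1 \<subseteq> V - Z" "T2 \<subseteq> V - Z" "T3 \<subseteq> V - Z" using V disj by auto
  have T23': "\<not> B v u" if "u \<in> T2" "v \<in> T3" for u v
    using T23[OF that] symB that TV by blast
  \<comment> \<open>An adjacent pair with an end in \<open>Z\<close>: the layers containing the two
    ends decide which neighbourhood is the larger one, or \<open>nestZ\<close> decides inside
    \<open>Z\<close>.\<close>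
  have one: "nle V ?G u v \<or> nle V ?G v u" if uv: "u \<in> Z" "v \<in> V" "A u v" for u v
  proof (cases "v \<in> Z")
    case vZ: True
    show ?thesis
    proof (cases "u \<in> Zr \<longleftrightarrow> v \<in> Zr")
      case same: True
      have out: "?G z u \<longleftrightarrow> ?G z v" if z: "z \<in> V" "z \<notin> Z" for z
      proof -
        have "z \<in> T1 \<or> z \<in> T2 \<or> z \<in> T3" using V z by auto
        then have "A u z \<longleftrightarrow> A v z"
          using ZT1 ZT3 ZcT2 ZrT2 same uv vZ unfolding Z_def by blast
        then show ?thesis
          using uv vZ z symA ZV unfolding glue_def by (meson subsetD)
      qed
      from nestZ uv(1,3) vZ have "nle Z A u v \<or> nle Z A v u" by (auto simp: nested_def)
      then show ?thesis
      proof
        assume n: "nle Z A u v"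
        have "nle V ?G u v" unfolding nle_def
        proof (intro ballI impI)
          fix z assume z: "z \<in> V" "?G z u"
          show "?G z v"
          proof (cases "z \<in> Z")
            case True then show ?thesis using z n by (auto simp: glue_def nle_def)
          next
            case False then show ?thesis using out z by blast
          qed
        qed
        then show ?thesis ..
      next
        assume n: "nle Z A v u"
        have "nle V ?G v u" unfolding nle_def
        proof (intro ballI impI)
          fix z assume z: "z \<in> V" "?G z v"
          show "?G z u"
          proof (cases "z \<in> Z")
            case True then show ?thesis using z n by (auto simp: glue_def nle_def)
          next
            case False then show ?thesis using out z by blast
          qed
        qed
        then show ?thesis ..
      qed
    next
      case diff: False
      \<comment> \<open>\<open>Zc\<close> plays the role of a chain and \<open>Zr\<close> of what
        branches off it: a neighbour of \<open>r\<close> outside \<open>Z\<close> must lie in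
        \<open>T1\<close>, and \<open>c\<close> is adjacent to all of \<open>T1\<close>.\<close>
      have key: "nle V ?G r c" if cr: "c \<in> Zc" "r \<in> Zr" "A c r" for c r
        unfolding nle_def
      proof (intro ballI impI)
        fix z assume z: "z \<in> V" "?G z r"
        have crZ: "c \<in> Z" "r \<in> Z" using cr by (auto simp: Z_def)
        have Azr: "A z r" using z crZ by (auto simp: glue_def)
        show "?G z c"
        proof (cases "z \<in> Z")
          case True then show ?thesis
            using nleD[OF Zcr[OF cr]] Azr by (auto simp: glue_def)
        next
          case False
          have "A r z" using Azr symA z crZ ZV by blast
          then have "z \<in> T1" using V False z(1) ZrT2[OF cr(2)] ZT3[OF crZ(2)] by auto
          then have "A c z" using ZT1 crZ by blast
          then have "A z c" using symA z crZ ZV by blast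
          then show ?thesis using crZ by (simp add: glue_def)
        qed
      qed
      show ?thesis
      proof (cases "u \<in> Zr")
        case True
        then have "v \<in> Zc" using diff vZ by (auto simp: Z_def)
        moreover have "A v u" using symA uv ZV by blast
        ultimately show ?thesis using key True by blast
      next
        case False
        then have "u \<in> Zc" "v \<in> Zr" using diff uv by (auto simp: Z_def)
        then show ?thesis using key uv by blast
      qed
    qed
  next
    case vZ: False
    then have "v \<in> T1 \<or> v \<in> T2" using V uv(2) ZT3[OF uv(1)] uv(3) by auto
    then show ?thesis
    proof
      assume v1: "v \<in> T1"
      have "nle V ?G u v" unfolding nle_def
      proof (intro ballI impI)
        fix z assume z: "z \<in> V" "?G z u"
        have Azu: "A z u" using z uv by (auto simp: glue_def)
        show "?G z v"
        proof (cases "z \<in> Z")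
          case True then show ?thesis using ZT1 v1 by (auto simp: glue_def)
        next
          case False
          have "A u z" using Azu symA z uv ZV by blast
          then have "z \<in> T1 \<or> z \<in> T2" using V False z(1) ZT3[OF uv(1)] by auto
          then have "B z v" using cl T12 v1 symB TV by blast
          then show ?thesis using False vZ by (simp add: glue_def)
        qed
      qed
      then show ?thesis ..
    next
      assume v2: "v \<in> T2"
      then have uc: "u \<in> Zc" using ZrT2 uv by (auto simp: Z_def)
      have "nle V ?G v u" unfolding nle_def
      proof (intro ballI impI)
        fix z assume z: "z \<in> V" "?G z v"
        show "?G z u"
        proof (cases "z \<in> Z")
          case True
          then have "A z v" using z by (auto simp: glue_def)
          then have "z \<in> Zc" using ZrT2 v2 True by (auto simp: Z_def)
          then have "A z u" using Zc uc by blast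
          then show ?thesis using True by (simp add: glue_def)
        next
          case False
          then have Bzv: "B z v" using z vZ by (auto simp: glue_def)
          then have "z \<notin> T3" using T23' v2 by blast
          then have "z \<in> T1 \<or> z \<in> T2" using V False z(1) by auto
          then have "A u z" using ZT1 ZcT2 uc ZV by blast
          then have "A z u" using symA z uv ZV by blast
          then show ?thesis using uv by (simp add: glue_def)
        qed
      qed
      then show ?thesis ..
    qed
  qed
  \<comment> \<open>For vertices outside \<open>Z\<close>, a nesting in \<open>B\<close> survives
    once their neighbours in \<open>Z\<close> are nested the same way.\<close>
  have two: "nle V ?G v u" if t: "u \<in> V - Z" "v \<in> V - Z" "nle (V - Z) B v u"
     "\<And>z. z \<in> Z \<Longrightarrow> A z v \<Longrightarrow> A z u" for u v
    using t unfolding nle_def glue_def by auto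
  show ?thesis unfolding nested_def
  proof (intro ballI impI)
    fix u v assume uv: "u \<in> V" "v \<in> V" "?G u v"
    show "nle V ?G u v \<or> nle V ?G v u"
    proof (cases "u \<in> Z \<or> v \<in> Z")
      case True
      then have "A u v" using uv by (simp add: glue_def)
      then show ?thesis using one[of u v] one[of v u] uv symA True by blast
    next
      case False
      then have Buv: "B u v" "u \<in> V - Z" "v \<in> V - Z" using uv by (auto simp: glue_def)
      then have cmp: "nle (V - Z) B u v \<or> nle (V - Z) B v u" using B(2) by (auto simp: nested_def)
      have Bvu: "B v u" using symB Buv by blast
      \<comment> \<open>Outside \<open>Z\<close>, the neighbours of a vertex of \<open>T2\<close>
        lie in \<open>T1\<close> or \<open>T2\<close>, and vertices of \<open>T1\<close> are
        adjacent to both layers.\<close>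
      have n12: "nle (V - Z) B t s" if "s \<in> T1" "t \<in> T2" for s t
        unfolding nle_def
      proof (intro ballI impI)
        fix z assume "z \<in> V - Z" "B z t"
        then have "z \<in> T1 \<or> z \<in> T2" using V T23'[OF that(2)] by auto
        then show "B z s" using cl T12 symB that TV by blast
      qed
      have "u \<in> T1 \<or> u \<in> T2 \<or> u \<in> T3" "v \<in> T1 \<or> v \<in> T2 \<or> v \<in> T3" using V Buv by auto
      then consider "u \<in> T1" "v \<in> T1" | "u \<in> T2" "v \<in> T2" | "u \<in> T3" "v \<in> T3"
        | "u \<in> T1" "v \<in> T2" | "u \<in> T2" "v \<in> T1" | "u \<in> T1" "v \<in> T3" | "u \<in> T3" "v \<in> T1"
        | "u \<in> T2" "v \<in> T3" | "u \<in> T3" "v \<in> T2" by blast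
      then show ?thesis
      proof cases
        case 1 then show ?thesis using cmp two Buv ZT1 by blast
      next
        case 2
        have "A z u \<longleftrightarrow> A z v" if "z \<in> Z" for z
          using 2 that ZcT2 ZrT2 by (auto simp: Z_def)
        then show ?thesis using cmp two Buv by blast
      next
        case 3 then show ?thesis using cmp two Buv ZT3 by blast
      next
        case 4 then show ?thesis using n12 two Buv ZT1 by blast
      next
        case 5 then show ?thesis using n12 two Buv ZT1 by blast
      next
        case 6 then show ?thesis using T13[OF 6 Buv(1)] two Buv ZT3 by blast
      next
        case 7 then show ?thesis using T13[OF 7(2,1) Bvu] two Buv ZT3 by blast
      next
        case 8 then show ?thesis using T23 Buv by blast
      next
        case 9 then show ?thesis using T23' Buv by blast
      qed
    qed
  qed
qed

text \<open>Deviations of the glued graph from \<open>A\<close> avoid \<open>Z\<close> and in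
  particular \<open>v\<close>, so each of them was already paid for by \<open>B\<close> on
  \<open>V - {v}\<close>.\<close>

lemma editable_glue:
  assumes A: "rgraph V A" and B: "rgraph (V - {v}) B" "card (diffs (V - {v}) A B) \<le> k"
    and v: "v \<in> Z" "Z \<subseteq> V" and nest: "nested V (glue Z A B)"
  shows "editable V A k"
proof -
  have fin: "finite V" using A by (simp add: rgraph_def)
  have "rgraph V (glue Z A B)"
    using A B(1) v by (auto simp: rgraph_def glue_def)
  moreover have "diffs V A (glue Z A B) \<subseteq> diffs (V - {v}) A B"
  proof
    fix e assume "e \<in> diffs V A (glue Z A B)"
    then obtain a b where ab: "a \<in> V" "b \<in> V" "e = {a, b}" "A a b \<noteq> glue Z A B a b"
      by (auto simp: diffs_def)
    then have "a \<notin> Z" "b \<notin> Z" "A a b \<noteq> B a b" by (auto simp: glue_def split: if_splits)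
    then show "e \<in> diffs (V - {v}) A B" using ab v unfolding diffs_def by auto
  qed
  then have "card (diffs V A (glue Z A B)) \<le> k"
    using B(2) card_mono[OF finite_diffs[of "V - {v}"]] fin by (meson finite_Diff order_trans)
  ultimately show ?thesis using nest by (auto simp: editable_def)
qed


lemma ex_unaffected:
  assumes "card X \<le> m" "m < card W" "finite X"
  shows "\<exists>w\<in>W. w \<notin> X"
proof (rule ccontr)
  assume "\<not> ?thesis"
  then have "W \<subseteq> X" by blast
  then have "card W \<le> card X" using assms(3) card_mono by blast
  then show False using assms by linarith
qed

section \<open>Deletion rules\<close>

definition twin :: "nat set \<Rightarrow> adjacency \<Rightarrow> nat \<Rightarrow> nat \<Rightarrow> bool" where
  "twin V A u v \<longleftrightarrow> nle V A u v \<and> nle V A v u"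

definition rule_twin :: "nat set \<Rightarrow> adjacency \<Rightarrow> nat \<Rightarrow> nat \<Rightarrow> bool" where
  "rule_twin V A k v \<longleftrightarrow> 2 * k + 1 \<le> card {u \<in> V. u \<noteq> v \<and> twin V A u v}"

text \<open>For nonadjacent \<open>x\<close> and \<open>w\<close> this describes the neighbourhood
  \<open>K\<close> of a module. Two parameters thus stand for a whole vertex set, which keeps the
  rule first-order; \<open>x\<close> and \<open>w\<close> themselves fall outside \<open>K\<close>,
  being nonadjacent.\<close>

definition common :: "adjacency \<Rightarrow> nat \<Rightarrow> nat \<Rightarrow> nat \<Rightarrow> bool" where
  "common A x w z \<longleftrightarrow> A z x \<and> A z w"

definition full :: "nat set \<Rightarrow> adjacency \<Rightarrow> nat \<Rightarrow> nat \<Rightarrow> nat \<Rightarrow> bool" where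
  "full V A x w y \<longleftrightarrow> \<not> common A x w y \<and> (\<forall>z\<in>V. common A x w z \<longrightarrow> A z y)"

text \<open>A connected trivially perfect graph has a universal vertex \<open>u\<close>, so its vertex set can be
  recovered from \<open>u\<close> alone, without computing connected components.\<close>

definition comp_root :: "nat set \<Rightarrow> adjacency \<Rightarrow> nat \<Rightarrow> nat \<Rightarrow> nat \<Rightarrow> bool" where
  "comp_root V A x w u \<longleftrightarrow>
     (\<forall>z\<in>V. A z u \<and> \<not> common A x w z \<longrightarrow>
        full V A x w z \<and> (\<forall>y\<in>V. A y z \<and> \<not> common A x w y \<longrightarrow> A y u)) \<and>
     (\<forall>z\<in>V. \<forall>y\<in>V. A z u \<and> \<not> common A x w z \<and> A y u \<and> \<not> common A x w y \<and> A z y \<longrightarrow>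
        nle V A z y \<or> nle V A y z)"

text \<open>On reflexive graphs: the union of those components of the graph minus \<open>K\<close>
  that are trivially perfect and completely joined to \<open>K\<close>.\<close>

definition in_module :: "nat set \<Rightarrow> adjacency \<Rightarrow> nat \<Rightarrow> nat \<Rightarrow> nat \<Rightarrow> bool" where
  "in_module V A x w y \<longleftrightarrow> \<not> common A x w y \<and> (\<exists>u\<in>V. comp_root V A x w u \<and> A y u)"

definition simplicial :: "nat set \<Rightarrow> adjacency \<Rightarrow> nat \<Rightarrow> nat \<Rightarrow> nat \<Rightarrow> bool" where
  "simplicial V A x w r \<longleftrightarrow> full V A x w r \<and>
     (\<forall>z\<in>V. \<forall>y\<in>V. full V A x w z \<and> full V A x w y \<and> A z r \<and> A y r \<longrightarrow> A z y)"

text \<open>Adjacency is an equivalence on the simplicial vertices. Keeping the least vertex of each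
  class makes the size of a largest independent set among them definable by counting.\<close>

definition first_simplicial :: "nat set \<Rightarrow> adjacency \<Rightarrow> nat \<Rightarrow> nat \<Rightarrow> nat \<Rightarrow> bool" where
  "first_simplicial V A x w r \<longleftrightarrow> simplicial V A x w r \<and>
     (\<forall>y\<in>V. y < r \<and> A y r \<longrightarrow> \<not> simplicial V A x w y)"

text \<open>Of \<open>2 * k + 2\<close> module vertices, one other than \<open>v\<close> stays
  unaffected; \<open>2 * k + 3\<close> independent vertices leave two unaffected ones besides
  \<open>v\<close>. The independent vertices may lie outside the module, as they only have to be
  full; \<open>Teeth_card\<close> relies on that.\<close>

definition rule_module :: "nat set \<Rightarrow> adjacency \<Rightarrow> nat \<Rightarrow> nat \<Rightarrow> bool" where
  "rule_module V A k v \<longleftrightarrow> (\<exists>x\<in>V. \<exists>w\<in>V. \<not> A x w \<and> in_module V A x w v \<and>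
     2 * k + 2 \<le> card {y \<in> V. in_module V A x w y} \<and>
     2 * k + 3 \<le> card {r \<in> V. first_simplicial V A x w r})"

definition tooth :: "adjacency \<Rightarrow> nat \<Rightarrow> nat \<Rightarrow> nat \<Rightarrow> bool" where
  "tooth A p q r \<longleftrightarrow> A r p \<and> \<not> A r q"

text \<open>Every neighbour of \<open>p\<close> that is not one of \<open>q\<close> is a tooth, so
  under the two nestings the last conjunct says that \<open>c\<close> is not a twin of
  \<open>p\<close>.\<close>

definition shaft :: "nat set \<Rightarrow> adjacency \<Rightarrow> nat \<Rightarrow> nat \<Rightarrow> nat \<Rightarrow> bool" where
  "shaft V A p q c \<longleftrightarrow> nle V A q c \<and> nle V A c p \<and> (\<exists>r\<in>V. tooth A p q r \<and> \<not> A r c)"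

text \<open>What the original graph shows of a path from \<open>q\<close> up to \<open>p\<close> in
  a forest with subtrees hanging off it: the path is a chain, any other neighbour of
  \<open>q\<close> is above all teeth or apart from all of them, teeth stay below \<open>p\<close>,
  and adjacent teeth are attached at the same place.\<close>

definition comb :: "nat set \<Rightarrow> adjacency \<Rightarrow> nat \<Rightarrow> nat \<Rightarrow> bool" where
  "comb V A p q \<longleftrightarrow> nle V A q p \<and>
     (\<forall>c\<in>V. \<forall>d\<in>V. shaft V A p q c \<and> shaft V A p q d \<longrightarrow> nle V A c d \<or> nle V A d c) \<and>
     (\<forall>y\<in>V. A y q \<and> \<not> shaft V A p q y \<longrightarrow>
        (\<forall>r\<in>V. tooth A p q r \<longrightarrow> A r y) \<or> (\<forall>r\<in>V. tooth A p q r \<longrightarrow> \<not> A r y)) \<and>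
     (\<forall>r\<in>V. tooth A p q r \<longrightarrow> nle V A r p) \<and>
     (\<forall>r\<in>V. \<forall>s\<in>V. tooth A p q r \<and> tooth A p q s \<and> A r s \<longrightarrow>
        (nle V A r s \<or> nle V A s r) \<and> (\<forall>c\<in>V. shaft V A p q c \<longrightarrow> A r c \<longrightarrow> A s c))"

text \<open>Makes \<open>rule_comb\<close> count twin classes: twins at one level of the shaft would
  see the same teeth and supply no new ones.\<close>

definition first_twin :: "nat set \<Rightarrow> adjacency \<Rightarrow> nat \<Rightarrow> bool" where
  "first_twin V A c \<longleftrightarrow> (\<forall>d\<in>V. d < c \<longrightarrow> \<not> twin V A d c)"

text \<open>More is required above \<open>v\<close> than below: when up to \<open>2 * k\<close>
  classes are lost to affected vertices, \<open>2 * k + 1\<close> must remain, so that one of them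
  sees more than \<open>2 * k\<close> teeth not seen by \<open>v\<close> and hence an unaffected
  one. Below \<open>v\<close> a single unaffected vertex is enough.\<close>

definition rule_comb :: "nat set \<Rightarrow> adjacency \<Rightarrow> nat \<Rightarrow> nat \<Rightarrow> bool" where
  "rule_comb V A k v \<longleftrightarrow> (\<exists>p\<in>V. \<exists>q\<in>V. comb V A p q \<and> shaft V A p q v \<and>
     4 * k + 1 \<le> card {c \<in> V. shaft V A p q c \<and> first_twin V A c \<and> nle V A v c \<and> \<not> nle V A c v} \<and>
     2 * k + 1 \<le> card {c \<in> V. shaft V A p q c \<and> first_twin V A c \<and> nle V A c v \<and> \<not> nle V A v c})"

definition deletable :: "nat set \<Rightarrow> adjacency \<Rightarrow> nat \<Rightarrow> nat \<Rightarrow> bool" where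
  "deletable V A k v \<longleftrightarrow> rule_twin V A k v \<or> rule_module V A k v \<or> rule_comb V A k v"

section \<open>Safety of the three deletion rules\<close>

lemma rule_twin_safe:
  assumes A: "rgraph V A" and v: "v \<in> V" and rule: "rule_twin V A k v"
    and B: "rgraph (V - {v}) B" "nested (V - {v}) B" "card (diffs (V - {v}) A B) \<le> k"
  shows "editable V A k"
proof -
  let ?X = "affected (V - {v}) A B"
  have fin: "finite (V - {v})" using A by (simp add: rgraph_def)
  have "card ?X \<le> 2 * k" by (rule card_affected[OF fin B(3)])
  then obtain t where t: "t \<in> V" "t \<noteq> v" "twin V A t v" "t \<notin> ?X"
    using ex_unaffected[of ?X "2*k" "{u \<in> V. u \<noteq> v \<and> twin V A u v}"] rule
      finite_affected[OF fin] by (auto simp: rule_twin_def)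
  have Bt: "A t u \<longleftrightarrow> B t u" if "u \<in> V" "u \<noteq> v" for u
    using affectedD[OF t(4)] t that by blast
  have Av: "A u v \<longleftrightarrow> A u t" if "u \<in> V" for u
    using t(3) that by (auto simp: twin_def nle_def)
  have symA: "A a b \<longleftrightarrow> A b a" if "a \<in> V" "b \<in> V" for a b
    using A that by (auto simp: rgraph_def)
  have symB: "B a b \<longleftrightarrow> B b a" if "a \<in> V - {v}" "b \<in> V - {v}" for a b
    using B(1) that by (auto simp: rgraph_def)
  have vu: "A v u \<longleftrightarrow> B t u" if "u \<in> V" "u \<noteq> v" for u
    using Bt[OF that] Av symA that v t by metis
  \<comment> \<open>In the forest of the edited graph, these are the vertices weakly above the
    unaffected twin \<open>t\<close>, strictly below it, and incomparable to it.\<close>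
  define T1 where "T1 = {u \<in> V - {v}. B t u \<and> nle (V - {v}) B t u}"
  define T2 where "T2 = {u \<in> V - {v}. B t u \<and> \<not> nle (V - {v}) B t u}"
  define T3 where "T3 = {u \<in> V - {v}. \<not> B t u}"
  have tt: "t \<in> V - {v}" using t by simp
  have "nested V (glue ({v} \<union> {}) A B)"
  proof (rule nested_glue[of V A "{v}" "{}" B T1 T2 T3])
    show "V = T1 \<union> T2 \<union> T3 \<union> ({v} \<union> {})" using v by (auto simp: T1_def T2_def T3_def)
    show "B u w" if "u \<in> T1" "w \<in> T1" for u w
      using that nleD[of "V - {v}" B t u w] symB tt unfolding T1_def by blast
    show "B u w" if "u \<in> T1" "w \<in> T2" for u w
      using that nleD[of "V - {v}" B t u w] symB tt unfolding T1_def T2_def by blast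
    show "\<not> B u w" if "u \<in> T2" "w \<in> T3" for u w
    proof
      assume "B u w"
      have "nle (V - {v}) B u t"
        using that B(2) tt unfolding nested_def T2_def by blast
      then have "B w t" using \<open>B u w\<close> that symB nleD unfolding T2_def T3_def by blast
      then show False using that tt symB unfolding T3_def by blast
    qed
    show "nle (V - ({v}  \<union> {})) B w u" if "u \<in> T1" "w \<in> T3" "B u w" for u w
      unfolding nle_def
    proof (intro ballI impI)
      fix z assume z: "z \<in> V - ({v} \<union> {})" "B z w"
      then show "B z u"
        using nested_private[OF B(2), of u w t z] that tt symB unfolding T1_def T3_def by blast
    qed
    show "nested ({v} \<union> {}) A" by (auto simp: nested_def nle_def)
  qed (use A B v vu in \<open>auto simp: T1_def T2_def T3_def rgraphD\<close>)
  then show ?thesis using editable_glue[OF A B(1,3), of "{v}"] v by simp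
qed


text \<open>The whole module is reset, not just \<open>v\<close>, since \<open>B\<close> may have
  edited its inside. Two facts about \<open>B\<close> outside it suffice, both from unaffected
  witnesses: \<open>K\<close> is a clique, due to \<open>a\<close> and \<open>b\<close>; and a
  vertex outside the module and \<open>K\<close> that is adjacent to some \<open>u\<close> in
  \<open>K\<close> is nested in \<open>u\<close>, due to \<open>r\<close>.\<close>

lemma rule_module_safe:
  assumes A: "rgraph V A" and v: "v \<in> V" and rule: "rule_module V A k v"
    and B: "rgraph (V - {v}) B" "nested (V - {v}) B" "card (diffs (V - {v}) A B) \<le> k"
  shows "editable V A k"
proof -
  let ?X = "affected (V - {v}) A B"
  have fin: "finite (V - {v})" "finite V" using A by (auto simp: rgraph_def)
  have X: "card ?X \<le> 2 * k" "finite ?X"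
    by (rule card_affected[OF fin(1) B(3)], rule finite_affected[OF fin(1)])
  have symA: "A a b \<longleftrightarrow> A b a" if "a \<in> V" "b \<in> V" for a b
    using A that by (auto simp: rgraph_def)
  have symB: "B a b \<longleftrightarrow> B b a" if "a \<in> V - {v}" "b \<in> V - {v}" for a b
    using B(1) that by (auto simp: rgraph_def)
  from rule obtain x w where xw: "x \<in> V" "w \<in> V" "\<not> A x w" and vM: "in_module V A x w v"
    and cM: "2 * k + 2 \<le> card {y \<in> V. in_module V A x w y}"
    and cL: "2 * k + 3 \<le> card {r \<in> V. first_simplicial V A x w r}"
    by (auto simp: rule_module_def)
  define K where "K = {z \<in> V. common A x w z}"
  define M where "M = {y \<in> V. in_module V A x w y}"
  define L where "L = {r \<in> V. first_simplicial V A x w r}"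
  have finML: "finite M" "finite L" using fin by (auto simp: M_def L_def)
  have MK: "M \<inter> K = {}" by (auto simp: M_def K_def in_module_def)
  have vM': "v \<in> M" using v vM by (simp add: M_def)
  have nbM: "z \<in> K \<or> z \<in> M" if "y \<in> M" "z \<in> V" "A y z" for y z
  proof -
    from that obtain u where u: "u \<in> V" "comp_root V A x w u" "A y u" "\<not> common A x w y"
      by (auto simp: M_def in_module_def)
    show ?thesis
    proof (cases "common A x w z")
      case True then show ?thesis using that by (simp add: K_def)
    next
      case False
      moreover have "y \<in> V" using that by (simp add: M_def)
      ultimately have "A z u" using u that symA unfolding comp_root_def by blast
      then show ?thesis using u that False by (auto simp: M_def in_module_def)
    qed
  qed
  have fullM: "A z y" if "y \<in> M" "z \<in> K" for y z
  proof -
    from that obtain u where u: "u \<in> V" "comp_root V A x w u" "A y u" "\<not> common A x w y" "y \<in> V"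
      by (auto simp: M_def in_module_def)
    then have "full V A x w y" unfolding comp_root_def by blast
    then show ?thesis using that by (auto simp: full_def K_def)
  qed
  have nestM: "nested M A" unfolding nested_def
  proof (intro ballI impI)
    fix y z assume yz: "y \<in> M" "z \<in> M" "A y z"
    from yz obtain u where u: "u \<in> V" "comp_root V A x w u" "A y u" "\<not> common A x w y" "y \<in> V"
      "z \<in> V" "\<not> common A x w z"
      by (auto simp: M_def in_module_def)
    then have "A z u" using yz symA unfolding comp_root_def by blast
    then have "nle V A z y \<or> nle V A y z" using u yz symA unfolding comp_root_def by blast
    then show "nle M A y z \<or> nle M A z y" unfolding nle_def M_def by blast
  qed
  have "2 * k < card (M - {v})" using cM vM' finML by (simp add: M_def[symmetric])
  then obtain r where r: "r \<in> M" "r \<noteq> v" "r \<notin> ?X"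
    using ex_unaffected[OF X(1) _ X(2)] by blast
  have rV: "r \<in> V - {v}" using r by (auto simp: M_def)
  have Br: "A r u \<longleftrightarrow> B r u" if "u \<in> V" "u \<noteq> v" for u
    using affectedD[OF r(3) rV] that by blast
  have indL: "\<not> A a b" if "a \<in> L" "b \<in> L" "a \<noteq> b" for a b
    using that symA by (auto simp: L_def first_simplicial_def) (metis linorder_neqE_nat)
  have "2 * k + 3 \<le> card L" using cL by (simp add: L_def)
  then have "2 * k < card (L - {v})" using finML by (auto simp: card_Diff_singleton_if)
  then obtain a where a: "a \<in> L" "a \<noteq> v" "a \<notin> ?X"
    using ex_unaffected[OF X(1) _ X(2)] by blast
  have "2 * k < card (L - {v} - {a})"
    using \<open>2 * k + 3 \<le> card L\<close> finML by (auto simp: card_Diff_singleton_if)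
  then obtain b where b: "b \<in> L" "b \<noteq> v" "b \<noteq> a" "b \<notin> ?X"
    using ex_unaffected[OF X(1) _ X(2)] by blast
  have abV: "a \<in> V - {v}" "b \<in> V - {v}" using a b by (auto simp: L_def)
  have Ba: "A a u \<longleftrightarrow> B a u" if "u \<in> V" "u \<noteq> v" for u
    using affectedD[OF a(3) abV(1)] that by blast
  have Bb: "A b u \<longleftrightarrow> B b u" if "u \<in> V" "u \<noteq> v" for u
    using affectedD[OF b(4) abV(2)] that by blast
  have KL: "A z c" if "c \<in> L" "z \<in> K" for z c
    using that unfolding L_def K_def first_simplicial_def simplicial_def full_def by blast
  have KV: "K \<subseteq> V - {v}" using MK vM' by (auto simp: K_def)
  \<comment> \<open>Two nonadjacent vertices of \<open>K\<close> would form an induced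
    \<open>C4\<close> with \<open>a\<close> and \<open>b\<close>.\<close>
  have clK: "B u z" if uz: "u \<in> K" "z \<in> K" for u z
  proof -
    have adj: "B a y" "B b y" if "y \<in> K" for y
    proof -
      have y: "y \<in> V" "y \<noteq> v" using KV that by auto
      have "A a y" "A b y" using KL[OF a(1) that] KL[OF b(1) that] symA y abV by auto
      then show "B a y" "B b y" using Ba[OF y] Bb[OF y] by auto
    qed
    have "\<not> A a b" using indL[OF a(1) b(1)] b(3) by blast
    then have "B a u" "B b u" "B a z" "B b z" "\<not> B a b"
      using adj uz Ba[of b] abV by auto
    then show ?thesis
      using nested_private[OF B(2), of u a b z] symB uz KV abV by blast
  qed
  define T3 where "T3 = V - (K \<union> M)"
  have "nested V (glue ({} \<union> M) A B)"
  proof (rule nested_glue[of V A "{}" M B K "{}" T3])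
    show "V = K \<union> {} \<union> T3 \<union> ({} \<union> M)" by (auto simp: T3_def K_def M_def)
    have sub: "V - ({} \<union> M) \<subseteq> V - {v}" using vM' by blast
    show "rgraph (V - ({} \<union> M)) B" by (rule rgraph_mono[OF B(1) sub])
    show "nested (V - ({} \<union> M)) B"
      using B(2) sub unfolding nested_def nle_def by blast
    show "K \<inter> ({} \<union> M) = {}" using MK by blast
    show "A z u" if "z \<in> {} \<union> M" "u \<in> K" for z u
      using fullM[of z u] that symA KV by (auto simp: M_def)
    show "\<not> A z u" if "z \<in> {} \<union> M" "u \<in> T3" for z u
      using nbM that by (auto simp: T3_def)
    show "nle (V - ({} \<union> M)) B z u" if "u \<in> K" "z \<in> T3" "B u z" for u z
    proof -
      have zV: "z \<in> V - {v}" using that vM' by (auto simp: T3_def)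
      \<comment> \<open>\<open>r\<close> is adjacent to \<open>u\<close> but not to
        \<open>z\<close>, which fixes the direction of the nesting.\<close>
      have "B r u" using fullM[OF r(1) that(1)] Br KV that(1) rV symA by blast
      moreover have "\<not> B r z" using nbM[OF r(1), of z] that(2) Br zV by (auto simp: T3_def)
      ultimately have "nle (V - {v}) B z u"
        using B(2) that zV KV rV unfolding nested_def nle_def by blast
      then show ?thesis using sub by (auto simp: nle_def)
    qed
    show "nested ({} \<union> M) A" using nestM by simp
  qed (use A clK in \<open>auto simp: T3_def\<close>)
  then show ?thesis using editable_glue[OF A B(1,3) vM'] by (auto simp: M_def)
qed

text \<open>The largest of \<open>m\<close> distinct positive integers is at least \<open>m\<close>.
  This turns many strictly growing sets into one large set.\<close>

lemma card_le_Max_inj: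
  fixes f :: "nat \<Rightarrow> nat"
  assumes "finite U" "U \<noteq> {}" "inj_on f U" "\<And>u. u \<in> U \<Longrightarrow> 0 < f u"
  shows "\<exists>u\<in>U. card U \<le> f u"
proof -
  let ?m = "Max (f ` U)"
  have "f ` U \<subseteq> {1..?m}" using assms by (auto simp: Suc_leI)
  then have "card (f ` U) \<le> ?m" using card_mono[of "{1..?m}" "f ` U"] by simp
  then have "card U \<le> ?m" using assms(3) by (simp add: card_image)
  moreover have "?m \<in> f ` U" using assms by simp
  ultimately show ?thesis by auto
qed

text \<open>Three unaffected witnesses pin down the edited graph around \<open>v\<close>: shaft
  vertices \<open>a\<close> above and \<open>b\<close> below it, and a tooth \<open>r\<close> seen
  by \<open>a\<close> but not by \<open>v\<close>. The stretch of the shaft strictly between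
  \<open>b\<close> and \<open>a\<close>, with its teeth, is then reset to the original
  adjacencies.\<close>

lemma rule_comb_safe:
  assumes A: "rgraph V A" and v: "v \<in> V" and rule: "rule_comb V A k v"
    and B: "rgraph (V - {v}) B" "nested (V - {v}) B" "card (diffs (V - {v}) A B) \<le> k"
  shows "editable V A k"
proof -
  let ?X = "affected (V - {v}) A B"
  have fin: "finite (V - {v})" "finite V" using A by (auto simp: rgraph_def)
  have X: "card ?X \<le> 2 * k" "finite ?X"
    by (rule card_affected[OF fin(1) B(3)], rule finite_affected[OF fin(1)])
  have symA: "A a b \<longleftrightarrow> A b a" if "a \<in> V" "b \<in> V" for a b
    using A that by (auto simp: rgraph_def)
  have reflA: "A a a" if "a \<in> V" for a
    using A that by (auto simp: rgraph_def)
  have symB: "B a b \<longleftrightarrow> B b a" if "a \<in> V - {v}" "b \<in> V - {v}" for a b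
    using B(1) that by (auto simp: rgraph_def)
  from rule obtain p q where pq: "p \<in> V" "q \<in> V" "comb V A p q" and vS: "shaft V A p q v"
    and up: "4 * k + 1 \<le> card {c \<in> V. shaft V A p q c \<and> first_twin V A c \<and> nle V A v c \<and> \<not> nle V A c v}"
    and dn: "2 * k + 1 \<le> card {c \<in> V. shaft V A p q c \<and> first_twin V A c \<and> nle V A c v \<and> \<not> nle V A v c}"
    by (auto simp: rule_comb_def)
  define R where "R = {r \<in> V. tooth A p q r}"
  define C where "C = {c \<in> V. shaft V A p q c}"
  define U where "U = {c \<in> V. shaft V A p q c \<and> first_twin V A c \<and> nle V A v c \<and> \<not> nle V A c v}"
  from pq(3) have qp: "nle V A q p"
    and chain: "\<And>c d. c \<in> C \<Longrightarrow> d \<in> C \<Longrightarrow> nle V A c d \<or> nle V A d c"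
    and AY: "\<And>y. y \<in> V \<Longrightarrow> A y q \<Longrightarrow> y \<notin> C \<Longrightarrow> (\<forall>r\<in>R. A r y) \<or> (\<forall>r\<in>R. \<not> A r y)"
    and Rp: "\<And>r. r \<in> R \<Longrightarrow> nle V A r p"
    and RR: "\<And>r s. r \<in> R \<Longrightarrow> s \<in> R \<Longrightarrow> A r s \<Longrightarrow> nle V A r s \<or> nle V A s r"
    and RC: "\<And>r s c. r \<in> R \<Longrightarrow> s \<in> R \<Longrightarrow> A r s \<Longrightarrow> c \<in> C \<Longrightarrow> A r c \<Longrightarrow> A s c"
    unfolding comb_def R_def C_def by blast+
  have vC: "v \<in> C" using v vS by (simp add: C_def)
  have UC: "U \<subseteq> C" "finite U" using fin by (auto simp: U_def C_def)
  have CV: "C \<subseteq> V" and RV: "R \<subseteq> V" by (auto simp: C_def R_def)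
  have qC: "nle V A q c" "nle V A c p" if "c \<in> C" for c using that by (auto simp: C_def shaft_def)
  obtain b where b: "b \<in> C" "nle V A b v" "\<not> nle V A v b" "b \<notin> ?X"
    using ex_unaffected[OF X(1) _ X(2), of "{c \<in> V. shaft V A p q c \<and> first_twin V A c \<and> nle V A c v \<and> \<not> nle V A v c}"] dn
    by (auto simp: C_def)
  \<comment> \<open>Going up the shaft from \<open>v\<close>, these sets grow strictly from one twin
    class to the next, so their sizes over \<open>U\<close> are distinct and positive.\<close>
  define priv where "priv c = {r \<in> R. A r c \<and> \<not> A r v}" for c
  have finp: "finite (priv c)" for c
    by (rule finite_subset[OF _ fin(2)]) (use RV in \<open>auto simp: priv_def\<close>)
  have priv_ex: "\<exists>r. r \<in> priv c \<and> \<not> A r d" if cd: "c \<in> C" "d \<in> C" "nle V A v d" "\<not> nle V A c d" for c d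
  proof -
    from cd(4) obtain z where z: "z \<in> V" "A z c" "\<not> A z d" by (auto simp: nle_def)
    then have "\<not> A z v" using nleD[OF cd(3)] by blast
    moreover have "\<not> A z q" using nleD[OF qC(1)[OF cd(2)]] z by blast
    moreover have "A z p" using nleD[OF qC(2)[OF cd(1)]] z by blast
    ultimately show ?thesis using z by (auto simp: priv_def R_def tooth_def)
  qed
  have inj: "inj_on (\<lambda>c. card (priv c)) U"
  proof (rule inj_onI)
    have less: "card (priv c) < card (priv d)"
      if cd: "c \<in> U" "d \<in> U" "nle V A c d" "\<not> nle V A d c" for c d
    proof (rule psubset_card_mono[OF finp])
      have "priv c \<subseteq> priv d" using nleD[OF that(3)] RV by (auto simp: priv_def)
      moreover obtain r where "r \<in> priv d" "\<not> A r c"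
        using priv_ex[of d c] cd UC(1) unfolding U_def by blast
      ultimately show "priv c \<subset> priv d" by (auto simp: priv_def)
    qed
    fix c d assume cd: "c \<in> U" "d \<in> U" "card (priv c) = card (priv d)"
    then have "nle V A c d \<or> nle V A d c" using chain UC by blast
    then have "twin V A c d" using less cd unfolding twin_def by fastforce
    then have "twin V A d c" by (simp add: twin_def)
    then show "c = d" using cd \<open>twin V A c d\<close> unfolding U_def first_twin_def
      by (metis (mono_tags, lifting) linorder_neqE_nat mem_Collect_eq)
  qed
  have "4 * k + 1 \<le> card U" using up by (simp add: U_def)
  moreover have "card U \<le> card (U - ?X) + card ?X"
    using UC(2) X(2) by (metis card_Un_le Un_Diff_cancel2 card_mono finite_UnI order_trans sup_ge1)
  ultimately have cU: "2 * k + 1 \<le> card (U - ?X)" using X(1) by linarith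
  have "\<exists>a\<in>U - ?X. card (U - ?X) \<le> card (priv a)"
  proof (rule card_le_Max_inj)
    show "U - ?X \<noteq> {}" using cU by (metis add_is_0 card.empty le_zero_eq one_neq_zero)
    show "inj_on (\<lambda>c. card (priv c)) (U - ?X)" using inj by (rule inj_on_subset) blast
    show "0 < card (priv u)" if "u \<in> U - ?X" for u
    proof -
      have "u \<in> C" "\<not> nle V A u v" using that UC by (auto simp: U_def)
      then have "priv u \<noteq> {}" using priv_ex[of u v] vC nle_refl by blast
      then show ?thesis using finp by (simp add: card_gt_0_iff)
    qed
  qed (use UC in auto)
  \<comment> \<open>At least \<open>2 * k + 1\<close> distinct positive sizes occur, so one exceeds
    the number of affected vertices.\<close>
  then obtain a where a: "a \<in> U" "a \<notin> ?X" "2 * k < card (priv a)" using cU by auto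
  then obtain r where r: "r \<in> priv a" "r \<notin> ?X" using ex_unaffected[OF X(1) _ X(2)] by blast
  have aC: "a \<in> C" "nle V A v a" "\<not> nle V A a v" using a UC by (auto simp: U_def)
  have rR: "r \<in> R" "A r a" "\<not> A r v" using r by (auto simp: priv_def)
  have rb: "\<not> A r b" using rR nleD[OF b(2)] RV by blast
  have ab: "a \<noteq> v" "b \<noteq> v" "r \<noteq> v" using aC b rR reflA v nle_refl by metis+
  have abV: "a \<in> V - {v}" "b \<in> V - {v}" "r \<in> V - {v}" using aC b rR ab CV RV by auto
  have Ba: "A a u \<longleftrightarrow> B a u" and Bb: "A b u \<longleftrightarrow> B b u" and Br: "A r u \<longleftrightarrow> B r u"
    if "u \<in> V" "u \<noteq> v" for u
    using affectedD[OF a(2) abV(1)] affectedD[OF b(4) abV(2)] affectedD[OF r(2) abV(3)] that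
    by blast+
  \<comment> \<open>\<open>Zc\<close> is the open stretch of the shaft between \<open>b\<close> and
    \<open>a\<close>; \<open>Zr\<close> holds the teeth attached above \<open>b\<close> but not
    above \<open>a\<close>. \<open>T1\<close> lies above the stretch and \<open>T2\<close> below it;
    \<open>T3\<close> consists of the teeth attached above \<open>a\<close> and of everything not
    adjacent to \<open>p\<close>.\<close>
  define Zc where "Zc = {c \<in> C. nle V A c a \<and> \<not> nle V A a c \<and> nle V A b c \<and> \<not> nle V A c b}"
  define Zr where "Zr = {s \<in> R. A s a \<and> \<not> A s b}"
  define T1 where "T1 = {y \<in> V - C. A y q \<and> (\<forall>s\<in>R. A s y)} \<union> {c \<in> C. nle V A a c}"
  define T2 where "T2 = {y \<in> V - C. A y q \<and> (\<forall>s\<in>R. \<not> A s y)} \<union> {c \<in> C. nle V A c b} \<union> {s \<in> R. A s b}"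
  define T3 where "T3 = {s \<in> R. \<not> A s a} \<union> {y \<in> V. \<not> A y p}"
  let ?Z = "Zc \<union> Zr"
  have Rq: "\<not> A s q" "A s p" if "s \<in> R" for s using that by (auto simp: R_def tooth_def)
  have Cq: "A c q" if "c \<in> C" for c
    using nleD[OF qC(1)[OF that] pq(2) reflA] symA that CV pq by blast
  have ba: "nle V A b a" using b(2) aC(2) nle_trans by blast
  have RCdisj: "s \<notin> C" if "s \<in> R" for s using that Rq Cq by blast
  have V_eq: "V = T1 \<union> T2 \<union> T3 \<union> ?Z"
  proof
    show "V \<subseteq> T1 \<union> T2 \<union> T3 \<union> ?Z"
    proof
      fix y assume y: "y \<in> V"
      consider "\<not> A y p" | "y \<in> R" | "A y q" "y \<notin> C" | "y \<in> C"
        using y by (auto simp: R_def tooth_def)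
      then show "y \<in> T1 \<union> T2 \<union> T3 \<union> ?Z"
      proof cases
        case 1 then show ?thesis using y by (simp add: T3_def)
      next
        case 2 then show ?thesis by (auto simp: T3_def T2_def Zr_def)
      next
        case 3 then show ?thesis using AY[OF y] y by (auto simp: T1_def T2_def)
      next
        case 4 then show ?thesis using chain aC(1) b(1) unfolding T1_def T2_def Zc_def by blast
      qed
    qed
    show "T1 \<union> T2 \<union> T3 \<union> ?Z \<subseteq> V"
      using CV RV by (auto simp: T1_def T2_def T3_def Zc_def Zr_def)
  qed
  have Cp: "A c p" if "c \<in> C" for c
    using nle_adj[OF A _ qC(2)[OF that]] that CV by blast
  have d1: "T1 \<inter> ?Z = {}" using RCdisj by (auto simp: T1_def Zc_def Zr_def Rq)
  have d2: "T2 \<inter> ?Z = {}" using RCdisj by (auto simp: T2_def Zc_def Zr_def Rq)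
  have d3: "T3 \<inter> ?Z = {}" using RCdisj Rq Cp by (auto simp: T3_def Zc_def Zr_def)
  have Call: "A c y" if "c \<in> C" "y \<in> V" "A y q" for c y
    using nleD[OF qC(1)[OF that(1)] that(2,3)] symA that CV by blast
  have CC: "A c d" if "c \<in> C" "d \<in> C" for c d
    using Call[OF that(1)] that Cq CV by blast
  have below: "A s d" if "s \<in> V" "A s c" "nle V A c d" for s c d
    using nleD[OF that(3,1,2)] .
  have T1q: "A y q" "y \<in> V" if "y \<in> T1" for y using that Cq CV by (auto simp: T1_def)
  have T1R: "A s y" if "s \<in> R" "A s a" "y \<in> T1" for s y
    using that below RV unfolding T1_def by blast
  have vZ: "v \<in> Zc" using vC aC b by (simp add: Zc_def)
  have T2a: "A b y" if "y \<in> T2" for y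
    using that Call[OF b(1)] Cq CV RV symA b(1) unfolding T2_def by blast
  have T2V: "y \<in> V" "y \<noteq> v" if "y \<in> T2" for y using that V_eq d2 vZ by auto
  have T1V: "y \<in> V" "y \<noteq> v" if "y \<in> T1" for y using that V_eq d1 vZ by auto
  have T3V: "y \<in> V" "y \<noteq> v" if "y \<in> T3" for y using that V_eq d3 vZ by auto
  have aT2: "A a y" if "y \<in> T2" for y
    using T2a[OF that] below[OF _ _ ba] symA T2V that abV by blast
  have aT3: "\<not> A y a" if "y \<in> T3" for y
    using that below[OF _ _ qC(2)[OF aC(1)]] RV unfolding T3_def by blast
  have bT3: "\<not> A y b" if "y \<in> T3" for y
    using aT3[OF that] below[OF _ _ ba] T3V that by blast
  have Rnb: "z \<in> R \<or> A z q" if "s \<in> R" "A s z" "z \<in> V" for s z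
  proof -
    have "A z p" using nleD[OF Rp[OF that(1)]] that symA RV by blast
    then show ?thesis using that by (auto simp: R_def tooth_def)
  qed
  have ZrT2: "\<not> A z u" if z: "z \<in> Zr" and u: "u \<in> T2" for z u
  proof
    assume zu: "A z u"
    have zR: "z \<in> R" "\<not> A z b" using z by (auto simp: Zr_def)
    from u consider "u \<in> V - C" "A u q" "\<forall>s\<in>R. \<not> A s u" | "u \<in> C" "nle V A u b" | "u \<in> R" "A u b"
      by (auto simp: T2_def)
    then show False
    proof cases
      case 1 then show ?thesis using zR zu by blast
    next
      case 2 then show ?thesis using zR zu below RV by blast
    next
      case 3
      then have "A u z" using zu symA zR RV by blast
      then show ?thesis using RC[OF 3(1) zR(1) _ b(1) 3(2)] zR by blast
    qed
  qed
  have ZrT3: "\<not> A z u" if z: "z \<in> Zr" and u: "u \<in> T3" for z u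
  proof
    assume zu: "A z u"
    have zR: "z \<in> R" "A z a" using z by (auto simp: Zr_def)
    have uV: "u \<in> V" using T3V u by blast
    have "A u p" using nleD[OF Rp[OF zR(1)]] zu symA zR RV uV by blast
    then have "u \<in> R" "\<not> A u a" using u by (auto simp: T3_def)
    then show False using RC[OF zR(1) _ zu aC(1) zR(2)] by blast
  qed
  have ZcT3: "\<not> A z u" if z: "z \<in> Zc" and u: "u \<in> T3" for z u
  proof
    assume "A z u"
    then have "A u z" using symA z CV T3V[OF u] by (auto simp: Zc_def)
    then have "A u a" using below T3V[OF u] z by (auto simp: Zc_def)
    then show False using aT3 u by blast
  qed
  have sub: "V - ?Z \<subseteq> V - {v}" using vZ by blast
  have rT1: "B r u" "B b u" if "u \<in> T1" for u
    using T1R[OF rR(1,2) that] Call[OF b(1)] T1q[OF that] Br Bb T1V[OF that] by blast+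
  have nrb: "\<not> B r b" using Br abV rb by blast
  have rZr: "r \<in> Zr" using rR rb by (simp add: Zr_def)
  have nest: "nested V (glue ?Z A B)"
  proof (rule nested_glue[of V A Zc Zr B T1 T2 T3])
    show "rgraph (V - ?Z) B" by (rule rgraph_mono[OF B(1) sub])
    show "nested (V - ?Z) B"
      using B(2) sub unfolding nested_def nle_def by blast
    show "A z u" if "z \<in> ?Z" "u \<in> T1" for z u
      using that T1R Call T1q unfolding Zc_def Zr_def by blast
    show "A z u" if "z \<in> Zc" "u \<in> T2" for z u
    proof -
      have "A u b" using T2a[OF that(2)] symA T2V[OF that(2)] abV by blast
      then have "A u z" using below that T2V by (auto simp: Zc_def)
      then show ?thesis using symA T2V[OF that(2)] that CV by (auto simp: Zc_def)
    qed
    show "nested ?Z A" unfolding nested_def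
    proof (intro ballI impI)
      have ZV: "?Z \<subseteq> V" using V_eq by blast
      have m: "nle ?Z A x y" if "nle V A x y" for x y
        using that ZV unfolding nle_def by blast
      fix x y assume xy: "x \<in> ?Z" "y \<in> ?Z" "A x y"
      have cr: "nle V A s c" if "c \<in> C" "s \<in> R" "A s c" for c s
        unfolding nle_def
      proof (intro ballI impI)
        fix z assume z: "z \<in> V" "A z s"
        then have "A s z" using symA that RV by blast
        then have "z \<in> R \<or> A z q" using Rnb that z by blast
        then show "A z c"
          using RC[OF that(2) _ \<open>A s z\<close> that(1,3)] Call[OF that(1) z(1)] symA that CV z by blast
      qed
      consider "x \<in> C" "y \<in> C" | "x \<in> C" "y \<in> R" | "x \<in> R" "y \<in> C" | "x \<in> R" "y \<in> R"
        using xy by (auto simp: Zc_def Zr_def)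
      then show "nle ?Z A x y \<or> nle ?Z A y x"
      proof cases
        case 1 then show ?thesis using chain m by blast
      next
        case 2
        then have "A y x" using xy symA RV CV by blast
        then show ?thesis using cr 2 m by blast
      next
        case 3 then show ?thesis using cr xy m by blast
      next
        case 4 then show ?thesis using RR xy m by blast
      qed
    qed
    show "nle ?Z A s c" if c: "c \<in> Zc" and s: "s \<in> Zr" and cs: "A c s" for c s
      unfolding nle_def
    proof (intro ballI impI)
      have cC: "c \<in> C" and sR: "s \<in> R" using c s by (auto simp: Zc_def Zr_def)
      have sc: "A s c" using cs symA cC sR CV RV by blast
      fix z assume z: "z \<in> ?Z" "A z s"
      then have zV: "z \<in> V" using V_eq by blast
      then have sz: "A s z" using symA z sR RV by blast
      then have "z \<in> R \<or> A z q" using Rnb sR zV by blast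
      then show "A z c"
        using RC[OF sR _ sz cC sc] Call[OF cC zV] symA cC CV zV by blast
    qed
    \<comment> \<open>All of \<open>T1\<close> is adjacent to the nonadjacent vertices
      \<open>r\<close> and \<open>b\<close>; two nonadjacent vertices of \<open>T1\<close> would
      complete an induced \<open>C4\<close>.\<close>
    show "B u w" if "u \<in> T1" "w \<in> T1" for u w
      using nested_private[OF B(2), of u r b w] rT1[OF that(1)] rT1[OF that(2)] symB nrb
        T1V[OF that(1)] T1V[OF that(2)] abV by blast
    show "B u w" if "u \<in> T1" "w \<in> T2" for u w
    proof -
      have "B b w" using T2a[OF that(2)] Bb T2V[OF that(2)] by blast
      then show ?thesis
        using nested_private[OF B(2), of u b r w] rT1[OF that(1)] symB nrb
        T1V[OF that(1)] T2V[OF that(2)] abV by blast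
    qed
    show "\<not> B u w" if "u \<in> T2" "w \<in> T3" for u w
    proof
      assume "B u w"
      \<comment> \<open>\<open>r\<close> is a neighbour of \<open>a\<close> missed by
        \<open>u\<close>, so \<open>a\<close> inherits all neighbours of \<open>u\<close>, in
        particular \<open>w\<close>, which contradicts \<open>aT3\<close>.\<close>
      have "B a u" using aT2[OF that(1)] Ba T2V[OF that(1)] by blast
      moreover have "B r a" using rR Br abV by blast
      moreover have "\<not> B r u" using ZrT2[OF rZr that(1)] Br T2V[OF that(1)] by blast
      ultimately have "B w a"
        using nested_private[OF B(2), of a u r w] \<open>B u w\<close> symB T2V[OF that(1)] T3V[OF that(2)] abV
        by blast
      then show False using aT3[OF that(2)] Ba T3V[OF that(2)] symA symB abV by blast
    qed
    show "nle (V - ?Z) B w u" if "u \<in> T1" "w \<in> T3" "B u w" for u w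
    proof -
      have "\<not> B b w" using bT3[OF that(2)] Bb T3V[OF that(2)] symA abV by blast
      then have "nle (V - {v}) B w u"
        using rT1(2)[OF that(1)] B(2) that(3) T1V[OF that(1)] T3V[OF that(2)] abV
        unfolding nested_def nle_def by blast
      then show ?thesis using sub by (auto simp: nle_def)
    qed
    show "\<not> A z u" if "z \<in> ?Z" "u \<in> T3" for z u using ZrT3 ZcT3 that by blast
    show "A c d" if "c \<in> Zc" "d \<in> Zc" for c d using CC that by (auto simp: Zc_def)
  qed (use A V_eq d1 d2 d3 ZrT2 in auto)
  show ?thesis using editable_glue[OF A B(1,3) _ _ nest] vZ V_eq by blast
qed

theorem deletable_safe:
  assumes "rgraph V A" "v \<in> V" "deletable V A k v"
  shows "editable (V - {v}) A k \<longleftrightarrow> editable V A k"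
proof
  assume "editable (V - {v}) A k"
  then obtain B where "rgraph (V - {v}) B" "nested (V - {v}) B" "card (diffs (V - {v}) A B) \<le> k"
    by (auto simp: editable_def)
  then show "editable V A k"
    using assms rule_twin_safe rule_module_safe rule_comb_safe unfolding deletable_def by blast
next
  assume "editable V A k"
  then show "editable (V - {v}) A k"
    using editable_mono assms(1) by (auto simp: rgraph_def)
qed

section \<open>Size of irreducible yes-instances\<close>

text \<open>Induction on the ground set. Dropping \<open>x\<close> loses only the set
  \<open>{x}\<close> and those sets \<open>S\<close> for which \<open>S - {x}\<close> is in the
  family as well; laminarity permits at most one such \<open>S\<close> besides \<open>{x}\<close>.
  So each element accounts for at most two sets.\<close>

lemma card_laminar:
  fixes X :: "'a set"
  assumes "finite X" "\<F> \<subseteq> Pow X - {{}}"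
    and "\<And>S T. S \<in> \<F> \<Longrightarrow> T \<in> \<F> \<Longrightarrow> S \<inter> T = {} \<or> S \<subseteq> T \<or> T \<subseteq> S"
  shows "card \<F> \<le> 2 * card X"
  using assms
proof (induction X arbitrary: \<F> rule: finite_induct)
  case empty
  then have "\<F> = {}" by auto
  then show ?case by simp
next
  case (insert x X)
  have finF: "finite \<F>" using insert.hyps insert.prems(1) by (meson finite.insertI finite_Diff finite_Pow_iff finite_subset)
  define \<G> where "\<G> = (\<lambda>S. S - {x}) ` \<F> - {{}}"
  have "card \<G> \<le> 2 * card X"
  proof (rule insert.IH)
    show "\<G> \<subseteq> Pow X - {{}}" using insert.prems(1) by (auto simp: \<G>_def)
    show "S \<inter> T = {} \<or> S \<subseteq> T \<or> T \<subseteq> S" if ST: "S \<in> \<G>" "T \<in> \<G>" for S T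
    proof -
      obtain S' T' where "S' \<in> \<F>" "T' \<in> \<F>" "S = S' - {x}" "T = T' - {x}"
        using ST by (auto simp: \<G>_def)
      then show ?thesis using insert.prems(2)[of S' T'] by blast
    qed
  qed
  define \<H> where "\<H> = {S \<in> \<F>. x \<in> S \<and> (S = {x} \<or> S - {x} \<in> \<F>)}"
  have "card \<H> \<le> 2"
  proof -
    have "S = T" if "S \<in> \<H>" "T \<in> \<H>" "S \<noteq> {x}" "T \<noteq> {x}" for S T
    proof -
      have S: "S \<in> \<F>" "x \<in> S" "S - {x} \<in> \<F>" "S - {x} \<noteq> {}" using that insert.prems(1) by (auto simp: \<H>_def)
      have T: "T \<in> \<F>" "x \<in> T" "T - {x} \<in> \<F>" "T - {x} \<noteq> {}" using that insert.prems(1) by (auto simp: \<H>_def)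
      have "S \<subseteq> T \<or> T \<subseteq> S" using insert.prems(2)[OF S(1) T(1)] S(2) T(2) by blast
      then show ?thesis
      proof
        assume "S \<subseteq> T"
        then have "T - {x} \<subseteq> S" using insert.prems(2)[OF S(1) T(3)] S T by blast
        then show ?thesis using \<open>S \<subseteq> T\<close> S(2) by blast
      next
        assume "T \<subseteq> S"
        then have "S - {x} \<subseteq> T" using insert.prems(2)[OF T(1) S(3)] S T by blast
        then show ?thesis using \<open>T \<subseteq> S\<close> T(2) by blast
      qed
    qed
    then have "\<H> \<subseteq> {{x}} \<or> (\<exists>S. \<H> \<subseteq> {{x}, S})" by blast
    then show ?thesis
    proof
      assume "\<H> \<subseteq> {{x}}"
      then have "card \<H> \<le> card {{x}}" by (intro card_mono) auto
      then show ?thesis by simp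
    next
      assume "\<exists>S. \<H> \<subseteq> {{x}, S}"
      then obtain S where "\<H> \<subseteq> {{x}, S}" ..
      then have "card \<H> \<le> card {{x}, S}" by (intro card_mono) auto
      also have "\<dots> \<le> 2" by (simp add: card_insert_if)
      finally show ?thesis .
    qed
  qed
  moreover have "card (\<F> - \<H>) \<le> card \<G>"
  proof (rule card_inj_on_le[where f = "\<lambda>S. S - {x}"])
    show "inj_on (\<lambda>S. S - {x}) (\<F> - \<H>)"
    proof (rule inj_onI)
      fix S T assume ST: "S \<in> \<F> - \<H>" "T \<in> \<F> - \<H>" "S - {x} = T - {x}"
      show "S = T"
      proof (cases "x \<in> S \<longleftrightarrow> x \<in> T")
        case True then show ?thesis using ST(3) by blast
      next
        case False
        then have "S = insert x T \<and> x \<notin> T \<or> T = insert x S \<and> x \<notin> S" using ST(3) by blast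
        then have "S \<in> \<H> \<or> T \<in> \<H>" using ST(1,2) by (auto simp: \<H>_def)
        then show ?thesis using ST by blast
      qed
    qed
    show "(\<lambda>S. S - {x}) ` (\<F> - \<H>) \<subseteq> \<G>"
    proof
      fix T assume "T \<in> (\<lambda>S. S - {x}) ` (\<F> - \<H>)"
      then obtain S where S: "S \<in> \<F>" "S \<notin> \<H>" "T = S - {x}" by blast
      then have "S \<noteq> {}" using insert.prems(1) by blast
      then have "T \<noteq> {}" using S by (auto simp: \<H>_def)
      then show "T \<in> \<G>" using S by (auto simp: \<G>_def)
    qed
    show "finite \<G>" using finF by (simp add: \<G>_def)
  qed
  moreover have "card \<F> \<le> card (\<F> - \<H>) + card \<H>"
    using card_Un_le[of "\<F> - \<H>" \<H>] by (metis (no_types, lifting) Un_Diff_cancel2 \<H>_def mem_Collect_eq subsetI sup.order_iff sup_commute)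
  ultimately show ?case using \<open>card \<G> \<le> 2 * card X\<close> insert.hyps by simp
qed

lemma card_fibres_le:
  assumes "finite W" "\<And>w. w \<in> W \<Longrightarrow> card {u \<in> W. f u = f w} \<le> m"
  shows "card W \<le> card (f ` W) * m"
proof -
  have "W = (\<Union>y\<in>f ` W. {u \<in> W. f u = y})" by auto
  then have "card W \<le> (\<Sum>y\<in>f ` W. card {u \<in> W. f u = y})"
    using card_UN_le[of "f ` W" "\<lambda>y. {u \<in> W. f u = y}"] assms(1) by simp
  also have "\<dots> \<le> (\<Sum>y\<in>f ` W. m)" by (rule sum_mono) (use assms(2) in auto)
  finally show ?thesis by simp
qed

section \<open>The forest of an edited irreducible graph\<close>

locale irreducible_edition =
  fixes V :: "nat set" and A B :: adjacency and k :: nat and X :: "nat set"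
  assumes A: "rgraph V A" and B: "rgraph V B" and nestB: "nested V B"
    and X_def: "X = affected V A B" and card_X: "card X \<le> 2 * k"
    and irreducible: "\<And>v. v \<in> V \<Longrightarrow> \<not> deletable V A k v"
begin

text \<open>In the edited graph, adjacency is comparability in the forest order of closed
  neighbourhoods, with the roots on top.\<close>

abbreviation le :: "nat \<Rightarrow> nat \<Rightarrow> bool" where "le \<equiv> nle V B"

lemma fin: "finite V"
  by (rule rgraphD(1)[OF A])

lemma XV: "X \<subseteq> V"
  by (auto simp: X_def affected_def)

lemma finX: "finite X"
  by (rule finite_subset[OF XV fin])

lemma adj_iff: "u \<in> V \<Longrightarrow> v \<in> V \<Longrightarrow> B u v \<longleftrightarrow> le u v \<or> le v u"
  using nestB nle_adj[OF B, of u v] nle_adj[OF B, of v u] rgraph_commute[OF B, of u v]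
  unfolding nested_def by blast

lemma le_refl: "le u u" by (rule nle_refl)

lemma le_trans: "le u v \<Longrightarrow> le v w \<Longrightarrow> le u w" by (rule nle_trans)

lemma forest:
  assumes "x \<in> V" "u \<in> V" "v \<in> V" "le x u" "le x v"
  shows "le u v \<or> le v u"
proof -
  have "B u x" using assms adj_iff by blast
  then have "B u v" using nleD[OF assms(5)] assms by blast
  then show ?thesis using adj_iff assms by blast
qed

text \<open>A neighbour of \<open>v\<close> missed by \<open>u\<close> cannot lie above
  \<open>v\<close>, for then it would be above \<open>u\<close> as well. So every strict step
  upwards in the forest branches, which is why leaves control the number of twin classes.\<close>

lemma separation:
  assumes "u \<in> V" "v \<in> V" "le u v" "\<not> le v u"
  shows "\<exists>z\<in>V. le z v \<and> \<not> le z u \<and> \<not> le u z"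
proof -
  obtain z where z: "z \<in> V" "B z v" "\<not> B z u" using assms(4) by (auto simp: nle_def)
  then have "\<not> le z u" "\<not> le u z" using adj_iff assms by blast+
  moreover have "le z v" using z adj_iff assms calculation le_trans by blast
  ultimately show ?thesis using z by blast
qed

lemma unaffected: "u \<in> V - X \<Longrightarrow> w \<in> V \<Longrightarrow> A u w \<longleftrightarrow> le u w \<or> le w u"
  using affectedD[of u V A B w] adj_iff[of u w] unfolding X_def by blast

lemma unaffected': "u \<in> V - X \<Longrightarrow> w \<in> V \<Longrightarrow> A w u \<longleftrightarrow> le u w \<or> le w u"
  using unaffected[of u w] rgraph_commute[OF A, of u w] by blast

text \<open>Unaffected vertices have the same neighbourhood in both graphs, so their nestings carry
  over. For affected vertices they need not, which is what makes \<open>shaft_iff\<close>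
  delicate.\<close>

lemma nle_iff: "u \<in> V - X \<Longrightarrow> v \<in> V - X \<Longrightarrow> nle V A u v \<longleftrightarrow> le u v"
proof -
  assume uv: "u \<in> V - X" "v \<in> V - X"
  have "A z u \<longleftrightarrow> B z u" "A z v \<longleftrightarrow> B z v" if z: "z \<in> V" for z
    using unaffected'[OF uv(1) z] unaffected'[OF uv(2) z] adj_iff[OF z, of u] adj_iff[OF z, of v] uv
    by auto
  then show ?thesis by (simp add: nle_def)
qed

lemma twins_card:
  assumes "u \<in> V - X"
  shows "card {w \<in> V - X. le u w \<and> le w u} \<le> 2 * k + 1"
proof -
  have "\<not> rule_twin V A k u" using irreducible assms by (auto simp: deletable_def)
  then have c: "card {w \<in> V. w \<noteq> u \<and> twin V A w u} \<le> 2 * k" by (simp add: rule_twin_def)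
  have "{w \<in> V - X. le u w \<and> le w u} \<subseteq> insert u {w \<in> V. w \<noteq> u \<and> twin V A w u}"
    using nle_iff assms by (auto simp: twin_def)
  then have "card {w \<in> V - X. le u w \<and> le w u} \<le> card (insert u {w \<in> V. w \<noteq> u \<and> twin V A w u})"
    by (intro card_mono) (use fin in auto)
  also have "\<dots> \<le> 2 * k + 1" using c fin by (simp add: card_insert_if)
  finally show ?thesis .
qed

text \<open>Vertices with equal labels are twins in the edited graph and, being unaffected, also in
  \<open>A\<close>, where the twin rule caps every class.\<close>

lemma card_by_classes:
  assumes "W \<subseteq> V - X" "\<And>u w. u \<in> W \<Longrightarrow> w \<in> W \<Longrightarrow> f u = f w \<Longrightarrow> le u w"
  shows "card W \<le> card (f ` W) * (2 * k + 1)"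
proof (rule card_fibres_le)
  show "finite W" using assms(1) fin finite_subset by blast
  fix w assume w: "w \<in> W"
  have "{u \<in> W. f u = f w} \<subseteq> {u \<in> V - X. le w u \<and> le u w}"
  proof
    fix u assume "u \<in> {u \<in> W. f u = f w}"
    then show "u \<in> {u \<in> V - X. le w u \<and> le u w}"
      using assms(1) assms(2)[of u w] assms(2)[of w u] w by auto
  qed
  then have "card {u \<in> W. f u = f w} \<le> card {u \<in> V - X. le w u \<and> le u w}"
    by (rule card_mono[rotated]) (use fin in simp)
  also have "\<dots> \<le> 2 * k + 1" using twins_card w assms(1) by blast
  finally show "card {u \<in> W. f u = f w} \<le> 2 * k + 1" .
qed

lemma card_below_less:
  assumes "u \<in> V" "v \<in> V" "le u v" "\<not> le v u"
  shows "card {z \<in> V. le z u} < card {z \<in> V. le z v}"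
proof (rule psubset_card_mono)
  show "{z \<in> V. le z u} \<subset> {z \<in> V. le z v}"
    using assms le_trans le_refl by blast
qed (use fin in simp)

lemma ex_maximal:
  assumes "S \<subseteq> V" "S \<noteq> {}"
  shows "\<exists>m\<in>S. \<forall>z\<in>S. le m z \<longrightarrow> le z m"
proof -
  let ?h = "\<lambda>u. card {z \<in> V. le z u}"
  have fS: "finite (?h ` S)" using assms fin finite_subset by blast
  have "Max (?h ` S) \<in> ?h ` S" using fS assms(2) by (intro Max_in) auto
  then obtain m where m: "m \<in> S" "?h m = Max (?h ` S)" by auto
  have "le z m" if "z \<in> S" "le m z" for z
  proof (rule ccontr)
    assume "\<not> le z m"
    then have "?h m < ?h z" using card_below_less that m assms(1) by blast
    moreover have "?h z \<le> Max (?h ` S)" using fS that by simp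
    ultimately show False using m by simp
  qed
  then show ?thesis using m by blast
qed

lemma ex_minimal:
  assumes "S \<subseteq> V" "S \<noteq> {}"
  shows "\<exists>m\<in>S. \<forall>z\<in>S. le z m \<longrightarrow> le m z"
proof -
  let ?h = "\<lambda>u. card {z \<in> V. le z u}"
  have fS: "finite (?h ` S)" using assms fin finite_subset by blast
  have "Min (?h ` S) \<in> ?h ` S" using fS assms(2) by (intro Min_in) auto
  then obtain m where m: "m \<in> S" "?h m = Min (?h ` S)" by auto
  have "le m z" if "z \<in> S" "le z m" for z
  proof (rule ccontr)
    assume "\<not> le m z"
    then have "?h z < ?h m" using card_below_less that m assms(1) by blast
    moreover have "?h z \<ge> Min (?h ` S)" using fS that by simp
    ultimately show False using m by simp
  qed
  then show ?thesis using m by blast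
qed

text \<open>Each vertex is labelled by the chosen leaves below it. The labels are laminar and
  nonempty, so there are at most \<open>2 * card I\<close> of them, and by \<open>separation\<close>
  vertices with equal labels are twins.\<close>

lemma leaves:
  assumes W: "W \<subseteq> V - X" and down: "\<And>w y. w \<in> W \<Longrightarrow> y \<in> V \<Longrightarrow> le y w \<Longrightarrow> y \<in> W"
  shows "\<exists>I\<subseteq>W. (\<forall>r\<in>I. \<forall>y\<in>V. le y r \<longrightarrow> le r y) \<and> (\<forall>r\<in>I. \<forall>s\<in>I. le r s \<longrightarrow> r = s) \<and>
           card W \<le> 2 * card I * (2 * k + 1)"
proof -
  define mini where "mini r \<longleftrightarrow> (\<forall>y\<in>V. le y r \<longrightarrow> le r y)" for r
  define I where "I = {r \<in> W. mini r \<and> (\<forall>s\<in>W. s < r \<longrightarrow> \<not> (le r s \<and> le s r))}"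
  have IW: "I \<subseteq> W" by (auto simp: I_def)
  have finI: "finite I" by (rule finite_subset[OF _ fin]) (use IW W in blast)
  have anti: "r = s" if "r \<in> I" "s \<in> I" "le r s" for r s
  proof -
    have "r \<in> V" "s \<in> V" using that(1,2) IW W by blast+
    moreover have "mini s" using that(2) by (simp add: I_def)
    ultimately have "le s r" using that by (auto simp: mini_def)
    then show ?thesis using that unfolding I_def
      by (metis (mono_tags, lifting) linorder_neqE_nat mem_Collect_eq)
  qed
  have ex: "\<exists>r\<in>I. le r v" if v: "v \<in> W" for v
  proof -
    have "{y \<in> V. le y v} \<subseteq> V" "{y \<in> V. le y v} \<noteq> {}" using v W le_refl by auto
    then obtain m where m: "m \<in> V" "le m v" "\<And>z. z \<in> V \<Longrightarrow> le z v \<Longrightarrow> le z m \<Longrightarrow> le m z"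
      using ex_minimal[of "{y \<in> V. le y v}"] by auto
    have mW: "m \<in> W" using down[OF v m(1,2)] .
    have mm: "mini m" unfolding mini_def using m le_trans by blast
    define r where "r = (LEAST r. r \<in> W \<and> le r m \<and> le m r)"
    have "m \<in> W \<and> le m m \<and> le m m" using mW le_refl by blast
    then have r: "r \<in> W" "le r m" "le m r" unfolding r_def by (metis (mono_tags, lifting) LeastI)+
    have "mini r" unfolding mini_def
    proof (intro ballI impI)
      fix y assume "y \<in> V" "le y r"
      then have "le m y" using mm r le_trans unfolding mini_def by blast
      then show "le r y" using r le_trans by blast
    qed
    moreover have "\<not> (le r s \<and> le s r)" if "s \<in> W" "s < r" for s
    proof
      assume "le r s \<and> le s r"
      then have "s \<in> W \<and> le s m \<and> le m s" using that r le_trans by blast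
      then have "r \<le> s" unfolding r_def by (rule Least_le)
      then show False using that by simp
    qed
    ultimately have "r \<in> I" using r by (auto simp: I_def)
    then show ?thesis using r m le_trans by blast
  qed
  define f where "f v = {r \<in> I. le r v}" for v
  have fsub: "f u \<subseteq> f v" if "le u v" for u v using that le_trans by (auto simp: f_def)
  have cmp: "le u v \<or> le v u" if uv: "u \<in> W" "v \<in> W" "f u \<inter> f v \<noteq> {}" for u v
  proof -
    obtain r where "r \<in> I" "le r u" "le r v" using uv(3) by (auto simp: f_def)
    then show ?thesis using forest[of r u v] uv IW W by blast
  qed
  have "card W \<le> card (f ` W) * (2 * k + 1)"
  proof (rule card_by_classes[OF W])
    fix u w assume uw: "u \<in> W" "w \<in> W" "f u = f w"
    have ne: "f u \<noteq> {}" using ex uw by (auto simp: f_def)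
    show "le u w"
    proof (rule ccontr)
      assume n: "\<not> le u w"
      then have wu: "le w u" using cmp uw ne by blast
      obtain z where z: "z \<in> V" "le z u" "\<not> le z w" "\<not> le w z"
        using separation[of w u] wu n uw W by blast
      have "z \<in> W" using down uw z by blast
      then obtain r where r: "r \<in> I" "le r z" using ex by blast
      then have "r \<in> f w" using uw(3) z le_trans by (auto simp: f_def)
      then have "le r w" by (simp add: f_def)
      then show False using forest[of r z w] r z uw IW W by blast
    qed
  qed
  moreover have "card (f ` W) \<le> 2 * card I"
  proof (rule card_laminar[OF finI])
    show "f ` W \<subseteq> Pow I - {{}}" using ex by (auto simp: f_def)
    fix S T assume "S \<in> f ` W" "T \<in> f ` W"
    then show "S \<inter> T = {} \<or> S \<subseteq> T \<or> T \<subseteq> S" using cmp fsub by blast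
  qed
  ultimately have "card W \<le> 2 * card I * (2 * k + 1)"
    by (meson le_trans mult_le_mono1 order.trans)
  then show ?thesis using IW anti unfolding I_def mini_def by (intro exI[of _ I]) (auto simp: I_def mini_def)
qed

text \<open>A maximal vertex \<open>u\<close> of \<open>M\<close> above \<open>y\<close> serves as
  component root: whatever is adjacent to it within \<open>M\<close> lies below it. As
  \<open>M\<close> is unaffected, \<open>A\<close> shows the same.\<close>

lemma in_moduleI:
  assumes K: "\<And>z. z \<in> V \<Longrightarrow> common A x w z \<longleftrightarrow> z \<in> K" and M: "M \<subseteq> V - X" "M \<inter> K = {}"
    and nb: "\<And>z y. z \<in> M \<Longrightarrow> y \<in> V \<Longrightarrow> le z y \<or> le y z \<Longrightarrow> y \<in> M \<union> K"
    and KM: "\<And>z y. z \<in> M \<Longrightarrow> y \<in> K \<Longrightarrow> y \<in> V \<Longrightarrow> le z y \<or> le y z"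
    and y: "y \<in> M"
  shows "in_module V A x w y"
proof -
  have "{u \<in> M. le y u} \<subseteq> V" "{u \<in> M. le y u} \<noteq> {}" using M y le_refl by auto
  then obtain u where u: "u \<in> M" "le y u" "\<And>z. z \<in> M \<Longrightarrow> le y z \<Longrightarrow> le u z \<Longrightarrow> le z u"
    using ex_maximal[of "{u \<in> M. le y u}"] by blast
  have uV: "u \<in> V - X" using u M by blast
  have inM: "z \<in> M" "le z u" if "z \<in> V" "A z u" "\<not> common A x w z" for z
  proof -
    have c: "le u z \<or> le z u" using unaffected'[OF uV that(1)] that by blast
    show zM: "z \<in> M" using nb[OF u(1) that(1) c] K that by blast
    show "le z u" using c u zM le_trans by blast
  qed
  have "comp_root V A x w u" unfolding comp_root_def
  proof (intro conjI ballI impI)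
    fix z assume z: "z \<in> V" "A z u \<and> \<not> common A x w z"
    then have zM: "z \<in> M" "le z u" using inM by blast+
    then have zX: "z \<in> V - X" using M by blast
    show "full V A x w z" unfolding full_def
      using z K KM[OF zM(1)] unaffected'[OF zX] by blast
    fix t assume t: "t \<in> V" "A t z \<and> \<not> common A x w t"
    then have tz: "le t z \<or> le z t" using unaffected'[OF zX] by blast
    then have "le t u \<or> le u t" using zM le_trans forest[of z t u] t z uV by blast
    then show "A t u" using unaffected'[OF uV] t by blast
  next
    fix z t assume z: "z \<in> V" and t: "t \<in> V"
      and h: "A z u \<and> \<not> common A x w z \<and> A t u \<and> \<not> common A x w t \<and> A z t"
    then have "z \<in> M" "t \<in> M" using inM by blast+
    then have "z \<in> V - X" "t \<in> V - X" using M by blast+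
    then show "nle V A z t \<or> nle V A t z" using h nle_iff unaffected by blast
  qed
  moreover have "A y u" using unaffected uV u y M by blast
  moreover have "\<not> common A x w y" using K y M by blast
  ultimately show ?thesis using uV by (auto simp: in_module_def)
qed

text \<open>The module rule fails at \<open>v\<close>, so one of its two counts is small. The map
  \<open>g\<close> sends \<open>I\<close> injectively to the representatives counted there: two
  vertices with the same image would be adjacent through that simplicial vertex.\<close>

lemma module_bound:
  assumes xw: "x \<in> V" "w \<in> V" "\<not> A x w" and v: "v \<in> V" "in_module V A x w v"
    and I: "I \<subseteq> V" "\<And>r. r \<in> I \<Longrightarrow> simplicial V A x w r"
      "\<And>r s. r \<in> I \<Longrightarrow> s \<in> I \<Longrightarrow> A r s \<Longrightarrow> r = s"
  shows "card {y \<in> V. in_module V A x w y} \<le> 2 * k + 1 \<or> card I \<le> 2 * k + 2"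
proof -
  define g where "g r = Min {y \<in> V. simplicial V A x w y \<and> A y r}" for r
  have reflA: "A r r" if "r \<in> V" for r using rgraphD(2)[OF A that] .
  have symA: "A a b \<longleftrightarrow> A b a" if "a \<in> V" "b \<in> V" for a b
    using A that by (auto simp: rgraph_def)
  have simpl: "A a b" if "simplicial V A x w c" "simplicial V A x w a" "simplicial V A x w b"
    "A a c" "A b c" "a \<in> V" "b \<in> V" for a b c
    using that unfolding simplicial_def by blast
  have g: "g r \<in> V" "simplicial V A x w (g r)" "A (g r) r"
    "\<And>y. y \<in> V \<Longrightarrow> simplicial V A x w y \<Longrightarrow> A y r \<Longrightarrow> g r \<le> y" if r: "r \<in> I" for r
  proof -
    have f: "finite {y \<in> V. simplicial V A x w y \<and> A y r}" using fin by simp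
    have "r \<in> {y \<in> V. simplicial V A x w y \<and> A y r}" using r I reflA by blast
    then have "g r \<in> {y \<in> V. simplicial V A x w y \<and> A y r}"
      unfolding g_def using f by (intro Min_in) auto
    then show "g r \<in> V" "simplicial V A x w (g r)" "A (g r) r" by auto
    show "g r \<le> y" if "y \<in> V" "simplicial V A x w y" "A y r" for y
      unfolding g_def using f that by (intro Min_le) auto
  qed
  have "card I \<le> card {r \<in> V. first_simplicial V A x w r}"
  proof (rule card_inj_on_le[where f = g])
    show "inj_on g I"
    proof (rule inj_onI)
      fix r s assume rs: "r \<in> I" "s \<in> I" "g r = g s"
      have "A r (g r)" "A s (g r)" using g(1,3)[OF rs(1)] g(1,3)[OF rs(2)] rs symA I by auto
      then have "A r s" using simpl[OF g(2)[OF rs(1)] I(2)[OF rs(1)] I(2)[OF rs(2)]] rs I by blast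
      then show "r = s" using I(3) rs by blast
    qed
    show "g ` I \<subseteq> {r \<in> V. first_simplicial V A x w r}"
    proof
      fix t assume "t \<in> g ` I"
      then obtain r where r: "r \<in> I" "t = g r" by blast
      have "\<not> simplicial V A x w y" if y: "y \<in> V" "y < g r" "A y (g r)" for y
      proof
        assume s: "simplicial V A x w y"
        have "A r (g r)" using g(1,3)[OF r(1)] symA I r by blast
        then have "A y r" using simpl[OF g(2)[OF r(1)] s I(2)[OF r(1)]] y r I by blast
        then have "g r \<le> y" using g(4)[OF r(1)] y s by blast
        then show False using y by simp
      qed
      then show "t \<in> {r \<in> V. first_simplicial V A x w r}"
        using g[OF r(1)] r(2) by (auto simp: first_simplicial_def)
    qed
  qed (use fin in simp)
  moreover have "\<not> rule_module V A k v" using irreducible v by (auto simp: deletable_def)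
  then have "\<not> (2 * k + 2 \<le> card {y \<in> V. in_module V A x w y} \<and>
     2 * k + 3 \<le> card {r \<in> V. first_simplicial V A x w r})"
    using xw v unfolding rule_module_def by blast
  ultimately show ?thesis by linarith
qed

section \<open>Marked and unmarked vertices\<close>

text \<open>A vertex is marked if some affected vertex lies weakly below it. The chain \<open>C S\<close> consists of
  the unaffected vertices with the same affected vertices \<open>S\<close> below them; an unmarked vertex \<open>v\<close> hangs
  below the chain \<open>P v\<close> of its marked ancestors, and \<open>M Q\<close> is the module of all vertices that hang
  below \<open>Q\<close>.\<close>

definition D :: "nat \<Rightarrow> nat set" where "D v = {x \<in> X. le x v}"

definition P :: "nat \<Rightarrow> nat set" where "P v = {u \<in> V. le v u \<and> D u \<noteq> {}}"

definition M :: "nat set \<Rightarrow> nat set" where "M Q = {v \<in> V. D v = {} \<and> P v = Q}"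

definition C :: "nat set \<Rightarrow> nat set" where "C S = {v \<in> V - X. D v = S}"

lemma D_mono: "le u v \<Longrightarrow> D u \<subseteq> D v"
  unfolding D_def by (blast intro: le_trans)

lemma D_self: "x \<in> X \<Longrightarrow> x \<in> D x"
  by (simp add: D_def le_refl)

lemma D_subset: "D v \<subseteq> X" by (auto simp: D_def)

lemma unmarked_unaffected: "v \<in> V \<Longrightarrow> D v = {} \<Longrightarrow> v \<in> V - X"
  using D_self[of v] by blast

lemma card_D: "card (D ` V - {{}}) \<le> 4 * k"
proof -
  have "card (D ` V - {{}}) \<le> 2 * card X"
  proof (rule card_laminar[OF finX])
    show "D ` V - {{}} \<subseteq> Pow X - {{}}" using D_subset by auto
    fix S T assume "S \<in> D ` V - {{}}" "T \<in> D ` V - {{}}"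
    then obtain u v where uv: "u \<in> V" "v \<in> V" "S = D u" "T = D v" by auto
    show "S \<inter> T = {} \<or> S \<subseteq> T \<or> T \<subseteq> S"
    proof (cases "S \<inter> T = {}")
      case False
      then obtain x where "x \<in> X" "le x u" "le x v" using uv by (auto simp: D_def)
      then have "le u v \<or> le v u" using forest[of x u v] uv XV by blast
      then show ?thesis using D_mono uv by blast
    qed simp
  qed
  then show ?thesis using card_X by simp
qed

lemma chain_C:
  assumes "u \<in> V" "v \<in> V" "D u = D v" "D u \<noteq> {}"
  shows "le u v \<or> le v u"
proof -
  obtain x where "x \<in> X" "le x u" "le x v" using assms by (auto simp: D_def)
  then show ?thesis using forest[of x u v] assms XV by blast
qed

text \<open>A marked ancestor of \<open>y\<close> is comparable to \<open>v\<close> but cannot lie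
  below the unmarked \<open>v\<close>, hence it lies above.\<close>

lemma unmarked_down:
  assumes "v \<in> V" "D v = {}" "y \<in> V" "le y v"
  shows "D y = {}" "P y = P v"
proof -
  show "D y = {}" using D_mono[OF assms(4)] assms(2) by blast
  show "P y = P v"
  proof
    show "P v \<subseteq> P y" using le_trans assms by (auto simp: P_def)
    show "P y \<subseteq> P v"
    proof
      fix u assume u: "u \<in> P y"
      then have uV: "u \<in> V" "le y u" "D u \<noteq> {}" by (auto simp: P_def)
      have "\<not> le u v" using D_mono[of u v] uV assms(2) by blast
      then have "le v u" using forest[of y u v] uV assms by blast
      then show "u \<in> P v" using uV by (simp add: P_def)
    qed
  qed
qed

lemma M_unaffected: "M Q \<subseteq> V - X"
  unfolding M_def by (blast dest: unmarked_unaffected)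

lemma M_down: "v \<in> M Q \<Longrightarrow> y \<in> V \<Longrightarrow> le y v \<Longrightarrow> y \<in> M Q"
  using unmarked_down[of v y] unfolding M_def by blast

lemma M_neighbours:
  assumes "v \<in> M Q" "y \<in> V" "le v y \<or> le y v"
  shows "y \<in> M Q \<union> Q"
proof (cases "le y v")
  case True then show ?thesis using M_down assms by blast
next
  case False
  then have vy: "le v y" using assms by blast
  have v: "v \<in> V" "D v = {}" "P v = Q" using assms by (auto simp: M_def)
  show ?thesis
  proof (cases "D y = {}")
    case True
    then have "P v = P y" using unmarked_down[of y v] assms v vy by blast
    then show ?thesis using True v assms by (simp add: M_def)
  next
    case False
    then have "y \<in> P v" using vy assms by (simp add: P_def)
    then show ?thesis using v by simp
  qed
qed

lemma M_above: "v \<in> M Q \<Longrightarrow> y \<in> Q \<Longrightarrow> le v y"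
  by (auto simp: M_def P_def)

lemma M_disjoint: "M Q \<inter> Q = {}"
  by (auto simp: M_def P_def)

text \<open>The neighbours of a leaf are its twins and ancestors, which form a chain in the edited
  graph. Two of them can be nonadjacent in \<open>A\<close> only if both are affected, and
  \<open>adj\<close> excludes that.\<close>

lemma minimal_simplicial:
  assumes r: "r \<in> V - X" "\<And>y. y \<in> V \<Longrightarrow> le y r \<Longrightarrow> le r y" and f: "full V A x w r"
    and adj: "\<And>z y. z \<in> V \<Longrightarrow> y \<in> V \<Longrightarrow> le r z \<Longrightarrow> le r y \<Longrightarrow> \<not> common A x w z \<Longrightarrow>
       \<not> common A x w y \<Longrightarrow> le z y \<Longrightarrow> z \<notin> X \<or> y \<notin> X"
  shows "simplicial V A x w r"
  unfolding simplicial_def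
proof (intro conjI ballI impI)
  show "full V A x w r" by (rule f)
  fix z y assume zy: "z \<in> V" "y \<in> V" and h: "full V A x w z \<and> full V A x w y \<and> A z r \<and> A y r"
  have "le r z" "le r y" using unaffected'[OF r(1)] r(2) zy h by blast+
  moreover from this have cmp: "le z y \<or> le y z" using forest[of r z y] r zy by blast
  moreover have "\<not> common A x w z" "\<not> common A x w y" using h by (auto simp: full_def)
  ultimately have "z \<in> V - X \<or> y \<in> V - X" using adj zy by blast
  then show "A z y" using cmp unaffected unaffected' zy by blast
qed

text \<open>The module rule needs \<open>K\<close> as the common neighbourhood of two nonadjacent
  vertices. Vertices of \<open>M Q\<close> comparable to all others stand in the way; they form one
  twin class \<open>U\<close>, which is moved to \<open>K\<close>. Two incomparable vertices
  \<open>x\<close> and \<open>w\<close>, both maximal in the rest \<open>N\<close>, then have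
  exactly \<open>Q\<close> and \<open>U\<close> as common neighbours, and \<open>N\<close> is small
  or has few leaves.\<close>

lemma M_card: "card (M Q) \<le> (4 * k + 6) * (2 * k + 1)"
proof -
  define U where "U = {u \<in> M Q. \<forall>z\<in>M Q. le u z \<or> le z u}"
  define N where "N = M Q - U"
  have finM: "finite (M Q)" using fin by (simp add: M_def)
  have MV: "v \<in> V" if "v \<in> M Q" for v using that by (simp add: M_def)
  \<comment> \<open>A constant label suffices, as all of \<open>U\<close> is one twin class.\<close>
  have "card U \<le> card ((\<lambda>_. ()) ` U) * (2 * k + 1)"
  proof (rule card_by_classes)
    show "U \<subseteq> V - X" using M_unaffected by (auto simp: U_def)
    fix u w assume uw: "u \<in> U" "w \<in> U"
    have uwV: "u \<in> V" "w \<in> V" using uw MV by (auto simp: U_def)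
    have uwM: "u \<in> M Q" "w \<in> M Q" using uw by (auto simp: U_def)
    show "le u w"
    proof (rule ccontr)
      assume "\<not> le u w"
      moreover from this have "le w u" using uw by (auto simp: U_def)
      ultimately obtain z where z: "z \<in> V" "le z u" "\<not> le z w" "\<not> le w z"
        using separation[of w u] uwV by blast
      then have "z \<in> M Q" using M_down[OF uwM(1)] by blast
      then show False using z uw by (auto simp: U_def)
    qed
  qed
  also have "\<dots> \<le> 1 * (2 * k + 1)"
  proof (rule mult_le_mono1)
    have "card ((\<lambda>_. ()) ` U) \<le> card (UNIV :: unit set)" by (intro card_mono) auto
    then show "card ((\<lambda>_. ()) ` U) \<le> 1" by simp
  qed
  finally have cU: "card U \<le> 2 * k + 1" by simp
  have cM: "card (M Q) \<le> card U + card N"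
    using finM card_Diff_subset[of U "M Q"] by (auto simp: N_def U_def card_Diff_subset)
  show ?thesis
  proof (cases "N = {}")
    case True
    then have "card (M Q) \<le> 2 * k + 1" using cM cU by simp
    also have "\<dots> \<le> (4 * k + 6) * (2 * k + 1)" by simp
    finally show ?thesis .
  next
    case False
    have NV: "N \<subseteq> V" "N \<subseteq> M Q" "N \<subseteq> V - X" using MV M_unaffected by (auto simp: N_def)
    obtain x where x: "x \<in> N" "\<And>z. z \<in> N \<Longrightarrow> le x z \<Longrightarrow> le z x"
      using ex_maximal[OF NV(1) False] by blast
    obtain w0 where w0: "w0 \<in> M Q" "\<not> le x w0" "\<not> le w0 x"
      using x(1) by (auto simp: N_def U_def)
    have w0N: "w0 \<in> N" using w0 x(1) by (auto simp: N_def U_def)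
    have "{w \<in> N. le w0 w} \<subseteq> V" "{w \<in> N. le w0 w} \<noteq> {}" using NV w0N le_refl by auto
    then obtain w where w: "w \<in> N" "le w0 w" "\<And>z. z \<in> N \<Longrightarrow> le w0 z \<Longrightarrow> le w z \<Longrightarrow> le z w"
      using ex_maximal[of "{w \<in> N. le w0 w}"] by auto
    have wmax: "le z w" if "z \<in> N" "le w z" for z using w that le_trans by blast
    have xw: "\<not> le x w" "\<not> le w x"
      using w(1,2) w0 x(2)[of w] le_trans by blast+
    have xwV: "x \<in> V - X" "w \<in> V - X" using x w NV by auto
    have xwM: "x \<in> M Q" "w \<in> M Q" using x w NV by auto
    let ?K = "Q \<union> U"
    have QV: "q \<in> Q \<Longrightarrow> q \<in> V" for q using xwM by (auto simp: M_def P_def)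
    have UM: "le u z \<or> le z u" if "u \<in> U" "z \<in> M Q" for u z using that by (auto simp: U_def)
    have K: "common A x w z \<longleftrightarrow> z \<in> ?K" if z: "z \<in> V" for z
    proof
      assume "common A x w z"
      then have c: "le x z \<or> le z x" "le w z \<or> le z w"
        using unaffected' xwV z by (auto simp: common_def)
      show "z \<in> ?K"
      proof (rule ccontr)
        assume "z \<notin> ?K"
        then have zN: "z \<in> N" using M_neighbours[OF xwM(1) z c(1)] by (auto simp: N_def)
        then have "le z x" "le z w" using c x wmax by blast+
        then show False using forest[of z x w] xw xwV z by blast
      qed
    next
      assume "z \<in> ?K"
      then have "(le x z \<or> le z x) \<and> (le w z \<or> le z w)"
        using M_above xwM UM by blast
      then show "common A x w z"
        using unaffected' xwV z by (auto simp: common_def)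
    qed
    have Ndown: "y \<in> N" if "z \<in> N" "y \<in> V" "le y z" for z y
    proof (rule ccontr)
      assume "y \<notin> N"
      moreover have zM: "z \<in> M Q" using that NV by blast
      then have "y \<in> M Q" using M_down that by blast
      ultimately have yU: "y \<in> U" by (simp add: N_def)
      have "le z t \<or> le t z" if t: "t \<in> M Q" for t
      proof -
        have "le y t \<or> le t y" using UM[OF yU t] .
        then show ?thesis
          using forest[of y z t] le_trans[of t y z] \<open>le y z\<close> \<open>y \<in> V\<close> MV[OF zM] MV[OF t] by blast
      qed
      then have "z \<in> U" using zM by (auto simp: U_def)
      then show False using \<open>z \<in> N\<close> by (simp add: N_def)
    qed
    have inmod: "in_module V A x w y" if "y \<in> N" for y
    proof (rule in_moduleI[OF K NV(3) _ _ _ that])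
      show "N \<inter> ?K = {}" using M_disjoint by (auto simp: N_def)
      show "y \<in> N \<union> ?K" if "z \<in> N" "y \<in> V" "le z y \<or> le y z" for z y
        using M_neighbours[of z Q y] that NV by (auto simp: N_def)
      show "le z y \<or> le y z" if "z \<in> N" "y \<in> ?K" for z y
        using M_above UM that NV by blast
    qed
    have "\<exists>I\<subseteq>N. (\<forall>r\<in>I. \<forall>y\<in>V. le y r \<longrightarrow> le r y) \<and>
        (\<forall>r\<in>I. \<forall>s\<in>I. le r s \<longrightarrow> r = s) \<and> card N \<le> 2 * card I * (2 * k + 1)"
      by (rule leaves[OF NV(3)]) (rule Ndown)
    then obtain I where I': "I \<subseteq> N \<and> (\<forall>r\<in>I. \<forall>y\<in>V. le y r \<longrightarrow> le r y) \<and>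
        (\<forall>r\<in>I. \<forall>s\<in>I. le r s \<longrightarrow> r = s) \<and> card N \<le> 2 * card I * (2 * k + 1)"
      by (elim exE) simp
    then have I: "I \<subseteq> N" "\<And>r y. r \<in> I \<Longrightarrow> y \<in> V \<Longrightarrow> le y r \<Longrightarrow> le r y"
      "\<And>r s. r \<in> I \<Longrightarrow> s \<in> I \<Longrightarrow> le r s \<Longrightarrow> r = s" "card N \<le> 2 * card I * (2 * k + 1)"
      by simp_all
    have "card {y \<in> V. in_module V A x w y} \<le> 2 * k + 1 \<or> card I \<le> 2 * k + 2"
    proof (rule module_bound[where v = x])
      show "\<not> A x w" using unaffected xw xwV by blast
      show "in_module V A x w x" using inmod x by blast
      show "simplicial V A x w r" if r: "r \<in> I" for r
      proof (rule minimal_simplicial)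
        have rN: "r \<in> N" using r I by blast
        show rX: "r \<in> V - X" using rN NV by blast
        show "le r y" if "y \<in> V" "le y r" for y using I(2) r that by blast
        have rK: "r \<notin> ?K" using rN NV M_disjoint by (auto simp: N_def)
        show "full V A x w r" unfolding full_def
        proof (intro conjI ballI impI)
          show "\<not> common A x w r" using K rK rX by blast
          fix z assume z: "z \<in> V" "common A x w z"
          then have "le r z \<or> le z r" using K M_above UM rN NV by blast
          then show "A z r" using unaffected' rX z by blast
        qed
        fix z y assume h: "z \<in> V" "le r z" "\<not> common A x w z"
        then have "z \<in> M Q" using M_neighbours[of r Q z] rN NV K by blast
        then show "z \<notin> X \<or> y \<notin> X" using M_unaffected by blast
      qed
      show "r = s" if "r \<in> I" "s \<in> I" "A r s" for r s
      proof -
        have "r \<in> V - X" "s \<in> V" using that(1,2) I(1) NV by blast+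
        then have "le r s \<or> le s r" using unaffected[of r s] that(3) by blast
        then show ?thesis using I(3)[of r s] I(3)[of s r] that by blast
      qed
      show "I \<subseteq> V" using I(1) NV(1) by blast
    qed (use xwV in auto)
    then have "card N \<le> 2 * k + 1 \<or> card N \<le> 2 * (2 * k + 2) * (2 * k + 1)"
    proof
      assume "card {y \<in> V. in_module V A x w y} \<le> 2 * k + 1"
      moreover have "card N \<le> card {y \<in> V. in_module V A x w y}"
        by (rule card_mono) (use fin inmod NV in auto)
      ultimately show ?thesis by linarith
    next
      assume "card I \<le> 2 * k + 2"
      then have "2 * card I * (2 * k + 1) \<le> 2 * (2 * k + 2) * (2 * k + 1)" by (intro mult_le_mono) auto
      then show ?thesis using I(4) by linarith
    qed
    moreover have "2 * k + 1 \<le> 2 * (2 * k + 2) * (2 * k + 1)" by simp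
    ultimately have "card N \<le> 2 * (2 * k + 2) * (2 * k + 1)" by linarith
    then have "card (M Q) \<le> (2 * k + 1) + 2 * (2 * k + 2) * (2 * k + 1)" using cM cU by linarith
    also have "\<dots> \<le> (4 * k + 6) * (2 * k + 1)" by (simp add: algebra_simps)
    finally show ?thesis .
  qed
qed

section \<open>Long chains are combs\<close>

lemma C_D: "c \<in> C S \<Longrightarrow> c \<in> V - X \<and> D c = S"
  by (auto simp: C_def)

text \<open>An affected \<open>y\<close> with \<open>D y = S\<close> would belong to
  \<open>D q0\<close> and so lie below \<open>q0\<close>, although \<open>q\<close> does not. The
  spare chain vertex \<open>q0\<close> thus keeps affected vertices off the chain between
  \<open>q\<close> and \<open>p\<close>.\<close>

lemma between_C:
  assumes q: "q \<in> V" "D q = S" and p: "p \<in> V" "D p = S" and q0: "q0 \<in> V" "D q0 = S"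
    and lt: "\<not> le q q0" and y: "y \<in> V" "le q y" "le y p"
  shows "y \<in> C S"
proof -
  have "D y = S" using D_mono[OF y(2)] D_mono[OF y(3)] q p by blast
  moreover have "y \<notin> X"
  proof
    assume "y \<in> X"
    then have "y \<in> D q0" using D_self \<open>D y = S\<close> q0 by blast
    then show False using lt y le_trans by (auto simp: D_def)
  qed
  ultimately show ?thesis using y by (simp add: C_def)
qed

context
  fixes S p q q0
  assumes S: "S \<noteq> {}" and pC: "p \<in> C S" and qC: "q \<in> C S" and q0C: "q0 \<in> C S"
    and q0q: "le q0 q" and nqq0: "\<not> le q q0" and qp: "le q p" and npq: "\<not> le p q"
begin

lemma pqV: "p \<in> V - X" "q \<in> V - X" "q0 \<in> V - X" "D p = S" "D q = S" "D q0 = S"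
  using C_D pC qC q0C by auto

lemma tooth_iff:
  assumes "r \<in> V"
  shows "tooth A p q r \<longleftrightarrow> le r p \<and> \<not> le r q \<and> \<not> le q r"
  using unaffected'[OF pqV(1) assms] unaffected'[OF pqV(2) assms] le_trans qp
  unfolding tooth_def by blast

text \<open>The affected vertices below \<open>p\<close> are also below \<open>q\<close>, because
  both have the same set \<open>S\<close>; a tooth is incomparable to \<open>q\<close> and shares
  none of them.\<close>

lemma tooth_unmarked:
  assumes "r \<in> V" "tooth A p q r"
  shows "D r = {}"
proof (rule ccontr)
  assume "D r \<noteq> {}"
  then obtain x where x: "x \<in> X" "le x r" by (auto simp: D_def)
  have rt: "le r p" "\<not> le r q" "\<not> le q r" using assms tooth_iff by auto
  have "x \<in> D p" using x rt le_trans by (auto simp: D_def)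
  then have "le x q" using pqV by (auto simp: D_def)
  then show False using forest[of x r q] x XV assms pqV rt by blast
qed

lemma tooth_unaffected: "r \<in> V \<Longrightarrow> tooth A p q r \<Longrightarrow> r \<in> V - X"
  using tooth_unmarked unmarked_unaffected by blast

text \<open>From left to right, \<open>c\<close> may be affected, so its nestings in
  \<open>A\<close> say nothing directly about \<open>le\<close>. Only unaffected vertices below
  \<open>q\<close> can be used as witnesses (\<open>down\<close>). If \<open>c\<close> were strictly
  below \<open>q\<close>, then a vertex separating the two would be affected, hence below
  \<open>q0\<close>, and this would push \<open>c\<close> below \<open>q0\<close>; a vertex
  separating \<open>q0\<close> from \<open>q\<close> refutes that.\<close>

lemma shaft_iff:
  assumes c: "c \<in> V"
  shows "shaft V A p q c \<longleftrightarrow> c \<in> C S \<and> le q c \<and> le c p \<and> \<not> le p c"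
proof
  assume sh: "shaft V A p q c"
  then obtain r where r: "r \<in> V" "tooth A p q r" "\<not> A r c" by (auto simp: shaft_def)
  have nq: "nle V A q c" and np: "nle V A c p" using sh by (auto simp: shaft_def)
  have rt: "le r p" "\<not> le r q" "\<not> le q r" using r tooth_iff by auto
  have rc: "\<not> le r c" "\<not> le c r" using unaffected[OF tooth_unaffected[OF r(1,2)] c] r by auto
  have npc: "\<not> le p c" using rt rc le_trans by blast
  have "A c p" using nle_adj[OF A c np] .
  then have cp: "le c p" using unaffected'[OF pqV(1) c] npc by blast
  have "A q c" using nle_adj[OF A _ nq] pqV by blast
  then have cq: "le c q \<or> le q c" using unaffected[OF pqV(2) c] by blast
  have qc: "le q c"
  proof (rule ccontr)
    assume n: "\<not> le q c"
    then have cq: "le c q" using cq by blast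
    have down: "le z c \<or> le c z" if z: "z \<in> V - X" "le z q" for z
    proof -
      have "A z q" using unaffected[of z q] z pqV by blast
      then have "A z c" using nleD[OF nq] z by blast
      then show ?thesis using unaffected[of z c] z c by blast
    qed
    obtain z where z: "z \<in> V" "le z q" "\<not> le z c" "\<not> le c z"
      using separation[of c q] c cq n pqV by blast
    then have "z \<in> X" using down by blast
    then have "z \<in> D q" using z by (simp add: D_def)
    then have zq0: "le z q0" using pqV by (auto simp: D_def)
    have "le q0 c \<or> le c q0" using down[of q0] pqV q0q by blast
    then have cq0: "le c q0" using zq0 z le_trans by blast
    \<comment> \<open>\<open>t\<close> branches off between \<open>q0\<close> and \<open>q\<close>;
      it is unaffected, as all affected vertices below \<open>q\<close> are below
      \<open>q0\<close>.\<close>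
    obtain t where t: "t \<in> V" "le t q" "\<not> le t q0" "\<not> le q0 t"
      using separation[of q0 q] q0q nqq0 pqV by blast
    have "t \<notin> X"
    proof
      assume "t \<in> X"
      then have "t \<in> D q" using t by (simp add: D_def)
      then show False using t pqV by (auto simp: D_def)
    qed
    then have "le t c \<or> le c t" using down t by blast
    then show False using t cq0 le_trans[of t c q0] forest[of c t q0] c pqV by blast
  qed
  have "c \<in> C S"
    using between_C[of q S p q0 c] pqV nqq0 c qc cp by blast
  then show "c \<in> C S \<and> le q c \<and> le c p \<and> \<not> le p c" using qc cp npc by blast
next
  assume h: "c \<in> C S \<and> le q c \<and> le c p \<and> \<not> le p c"
  then have cX: "c \<in> V - X" using C_D by blast
  have "nle V A q c" "nle V A c p" using nle_iff[OF pqV(2) cX] nle_iff[OF cX pqV(1)] h by auto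
  moreover obtain r where r: "r \<in> V" "le r p" "\<not> le r c" "\<not> le c r"
    using separation[of c p] h c pqV by blast
  moreover have "\<not> le r q" using r h le_trans by blast
  moreover have "\<not> le q r" using r h forest[of q r c] pqV c by blast
  moreover have "\<not> A r c" using unaffected'[OF cX] r by blast
  ultimately show "shaft V A p q c" using tooth_iff unfolding shaft_def by blast
qed

lemma comb_chain: "comb V A p q"
  unfolding comb_def
proof (intro conjI ballI impI)
  show "nle V A q p" using nle_iff pqV qp by blast
  fix c d assume "c \<in> V" "d \<in> V" "shaft V A p q c \<and> shaft V A p q d"
  then have "c \<in> C S" "d \<in> C S" using shaft_iff by auto
  then show "nle V A c d \<or> nle V A d c"
    using C_D[of c S] C_D[of d S] chain_C[of c d] nle_iff[of c d] nle_iff[of d c] S by auto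
next
  fix y assume y: "y \<in> V" "A y q \<and> \<not> shaft V A p q y"
  then have cmp: "le q y \<or> le y q" using unaffected'[OF pqV(2)] by blast
  \<comment> \<open>Above \<open>p\<close> a vertex sees all teeth, below \<open>q\<close> it sees
    none, and in between \<open>between_C\<close> makes it a shaft vertex.\<close>
  consider "le p y" | "le y q" | "le q y" "\<not> le p y" using cmp by blast
  then show "(\<forall>r\<in>V. tooth A p q r \<longrightarrow> A r y) \<or> (\<forall>r\<in>V. tooth A p q r \<longrightarrow> \<not> A r y)"
  proof cases
    case 1
    have "A r y" if "r \<in> V" "tooth A p q r" for r
      using unaffected[OF tooth_unaffected[OF that] y(1)] tooth_iff[of r] that 1 le_trans by blast
    then show ?thesis by blast
  next
    case 2
    have "\<not> A r y" if r: "r \<in> V" "tooth A p q r" for r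
    proof
      assume "A r y"
      then have "le r y \<or> le y r" using unaffected[OF tooth_unaffected[OF r] y(1)] by blast
      then show False
        using tooth_iff[OF r(1)] r 2 le_trans[of r y q] forest[of y r q] y pqV by blast
    qed
    then show ?thesis by blast
  next
    case 3
    then have "le y p" using forest[of q y p] y pqV qp by blast
    then have "y \<in> C S" using between_C[of q S p q0 y] pqV nqq0 y 3 by blast
    then have "shaft V A p q y" using shaft_iff[OF y(1)] 3 \<open>le y p\<close> by blast
    then show ?thesis using y by blast
  qed
next
  fix r assume "r \<in> V" "tooth A p q r"
  then show "nle V A r p" using nle_iff[OF tooth_unaffected pqV(1), of r] tooth_iff by blast
next
  fix r s assume rs: "r \<in> V" "s \<in> V" "tooth A p q r \<and> tooth A p q s \<and> A r s"
  have rX: "r \<in> V - X" "s \<in> V - X" using tooth_unaffected rs by auto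
  then have cmp: "le r s \<or> le s r" using rs unaffected by blast
  then show "nle V A r s \<or> nle V A s r" using nle_iff rX by blast
  fix c assume c: "c \<in> V" "shaft V A p q c" "A r c"
  then have cC: "c \<in> V - X" "le q c" using shaft_iff C_D by blast+
  have "\<not> le q r" "\<not> le q s" using tooth_iff rs by auto
  then have "le r c" using unaffected[OF rX(1) c(1)] c(3) cC le_trans by blast
  then have "le s c \<or> le c s" using cmp le_trans[of s r c] forest[of r s c] rs c by blast
  then show "A s c" using unaffected[OF rX(2) c(1)] by blast
qed

end

definition Rep :: "nat set \<Rightarrow> nat set" where
  "Rep S = {c \<in> C S. \<forall>d\<in>C S. d < c \<longrightarrow> \<not> (le c d \<and> le d c)}"

lemma Rep_eq:
  assumes "c \<in> Rep S" "d \<in> Rep S" "le c d" "le d c"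
  shows "c = d"
  using assms unfolding Rep_def by (metis (mono_tags, lifting) linorder_neqE_nat mem_Collect_eq)

lemma Rep_ex:
  assumes "c \<in> C S"
  shows "\<exists>d\<in>Rep S. le c d \<and> le d c"
proof -
  define d where "d = (LEAST d. d \<in> C S \<and> le d c \<and> le c d)"
  have "c \<in> C S \<and> le c c \<and> le c c" using assms le_refl by blast
  then have d: "d \<in> C S" "le d c" "le c d" unfolding d_def by (metis (mono_tags, lifting) LeastI)+
  have "\<not> (le d e \<and> le e d)" if "e \<in> C S" "e < d" for e
  proof
    assume "le d e \<and> le e d"
    then have "e \<in> C S \<and> le e c \<and> le c e" using that d le_trans by blast
    then have "d \<le> e" unfolding d_def by (rule Least_le)
    then show False using that by simp
  qed
  then show ?thesis using d by (auto simp: Rep_def)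
qed

text \<open>With at least \<open>6 * k + 7\<close> classes, let \<open>q0\<close>, \<open>q\<close>,
  \<open>v\<close> and \<open>p\<close> have ranks \<open>0\<close>, \<open>1\<close>,
  \<open>2 * k + 3\<close> and \<open>m - 1\<close>. Ranks \<open>1\<close> to
  \<open>2 * k + 2\<close> are shaft classes below \<open>v\<close>, and at least
  \<open>4 * k + 2\<close> further ones lie strictly between \<open>v\<close> and \<open>p\<close>,
  so the comb rule would delete \<open>v\<close>.\<close>

lemma Rep_card:
  assumes S: "S \<noteq> {}"
  shows "card (Rep S) \<le> 6 * k + 6"
proof (rule ccontr)
  let ?R = "Rep S"
  define m where "m = card ?R"
  assume "\<not> ?thesis"
  then have m: "6 * k + 7 \<le> m" by (simp add: m_def)
  have RC: "?R \<subseteq> C S" by (auto simp: Rep_def)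
  have RV: "?R \<subseteq> V" using RC C_D by blast
  have finR: "finite ?R" by (rule finite_subset[OF RV fin])
  define rk where "rk c = card {d \<in> ?R. le d c \<and> d \<noteq> c}" for c
  have cmp: "le c d \<or> le d c" if "c \<in> ?R" "d \<in> ?R" for c d
    using chain_C[of c d] C_D[of c S] C_D[of d S] that RC S by auto
  have rk_less: "rk c < rk d" if cd: "c \<in> ?R" "d \<in> ?R" "le c d" "c \<noteq> d" for c d
    unfolding rk_def
  proof (rule psubset_card_mono)
    have "\<not> le d c" using Rep_eq cd by blast
    then have "{e \<in> ?R. le e c \<and> e \<noteq> c} \<subseteq> {e \<in> ?R. le e d \<and> e \<noteq> d}"
      using cd le_trans by blast
    moreover have "c \<in> {e \<in> ?R. le e d \<and> e \<noteq> d} - {e \<in> ?R. le e c \<and> e \<noteq> c}"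
      using cd by blast
    ultimately show "{e \<in> ?R. le e c \<and> e \<noteq> c} \<subset> {e \<in> ?R. le e d \<and> e \<noteq> d}" by blast
  qed (use finR in simp)
  have rk_m: "rk c < m" if "c \<in> ?R" for c
    unfolding rk_def m_def by (rule psubset_card_mono) (use that finR in auto)
  have inj: "inj_on rk ?R"
    using cmp rk_less by (metis inj_onI less_irrefl)
  have "rk ` ?R = {..<m}"
    by (rule card_subset_eq) (use rk_m inj in \<open>auto simp: card_image m_def\<close>)
  then have surj: "\<exists>c\<in>?R. rk c = i" if "i < m" for i using that by (metis imageE lessThan_iff)
  have le_rk: "le c d \<and> \<not> le d c" if cd: "c \<in> ?R" "d \<in> ?R" "rk c < rk d" for c d
  proof -
    have "\<not> le d c" using rk_less[of d c] cd by (metis less_asym less_irrefl)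
    then show ?thesis using cmp cd by blast
  qed
  have card_rk: "card {c \<in> ?R. rk c \<in> J} = card J" if J: "J \<subseteq> {..<m}" for J
  proof -
    have "rk ` {c \<in> ?R. rk c \<in> J} = J" using surj J by force
    moreover have "inj_on rk {c \<in> ?R. rk c \<in> J}" using inj by (rule inj_on_subset) blast
    ultimately show ?thesis using card_image by metis
  qed
  obtain q0 where q0: "q0 \<in> ?R" "rk q0 = 0" using surj[of 0] m by auto
  obtain q where q: "q \<in> ?R" "rk q = 1" using surj[of 1] m by auto
  obtain v where v: "v \<in> ?R" "rk v = 2 * k + 3" using surj[of "2 * k + 3"] m by auto
  obtain p where p: "p \<in> ?R" "rk p = m - 1" using surj[of "m - 1"] m by auto
  have rel: "le q0 q" "\<not> le q q0" "le q p" "\<not> le p q" using le_rk q0 q p m by auto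
  have inC: "p \<in> C S" "q \<in> C S" "q0 \<in> C S" using p q q0 RC by auto
  note sh = shaft_iff[OF S inC rel] and cb = comb_chain[OF S inC rel]
  have shR: "shaft V A p q c \<and> first_twin V A c" if c: "c \<in> ?R" "1 \<le> rk c" "rk c < m - 1" for c
  proof
    have "le q c"
    proof (cases "rk c = 1")
      case True
      then have "c = q" using inj c q by (auto simp: inj_on_def)
      then show ?thesis using le_refl by simp
    next
      case False then show ?thesis using le_rk[of q c] q c by auto
    qed
    moreover have "le c p \<and> \<not> le p c" using le_rk[of c p] p c by auto
    ultimately show s: "shaft V A p q c" using sh[of c] c RC RV by blast
    \<comment> \<open>A twin \<open>d\<close> in \<open>A\<close> might be affected a priori. Being
      nested like \<open>c\<close>, it is a shaft vertex too and hence lies in \<open>C S\<close>,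
      where both notions of twin agree.\<close>
    show "first_twin V A c" unfolding first_twin_def
    proof (intro ballI impI notI)
      fix d assume d: "d \<in> V" "d < c" "twin V A d c"
      obtain r where r: "r \<in> V" "tooth A p q r" "\<not> A r c" using s by (auto simp: shaft_def)
      have nl: "nle V A d c" "nle V A c d" using d by (auto simp: twin_def)
      have "nle V A q d" "nle V A d p" using s nl nle_trans unfolding shaft_def by blast+
      moreover have "\<not> A r d" using nleD[OF nl(1)] r by blast
      ultimately have "shaft V A p q d" using r unfolding shaft_def by blast
      then have dC: "d \<in> C S" using sh[OF d(1)] by blast
      have "le c d" "le d c" using nle_iff[of c d] nle_iff[of d c] nl C_D dC c RC by blast+
      then show False using c d dC by (auto simp: Rep_def)
    qed
  qed
  have vV: "v \<in> V" "v \<in> V - X" using v RC C_D by blast+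
  have nl: "nle V A c d \<longleftrightarrow> le c d" if "c \<in> ?R" "d \<in> ?R" for c d
    using nle_iff[of c d] that RC C_D by blast
  have "rule_comb V A k v" unfolding rule_comb_def
  proof (intro bexI conjI)
    show "comb V A p q" by (rule cb)
    show "shaft V A p q v" using shR[of v] v m by simp
    let ?up = "{c \<in> V. shaft V A p q c \<and> first_twin V A c \<and> nle V A v c \<and> \<not> nle V A c v}"
    let ?dn = "{c \<in> V. shaft V A p q c \<and> first_twin V A c \<and> nle V A c v \<and> \<not> nle V A v c}"
    have "{c \<in> ?R. rk c \<in> {2 * k + 4..<m - 1}} \<subseteq> ?up"
    proof
      fix c assume "c \<in> {c \<in> ?R. rk c \<in> {2 * k + 4..<m - 1}}"
      then have c: "c \<in> ?R" "2 * k + 4 \<le> rk c" "rk c < m - 1" by auto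
      have "le v c \<and> \<not> le c v" using le_rk[of v c] c v by simp
      then show "c \<in> ?up" using shR[of c] c nl v RV by auto
    qed
    then have "card {c \<in> ?R. rk c \<in> {2 * k + 4..<m - 1}} \<le> card ?up"
      by (rule card_mono[rotated]) (use fin in simp)
    moreover have "card {c \<in> ?R. rk c \<in> {2 * k + 4..<m - 1}} = card {2 * k + 4..<m - 1}"
      by (rule card_rk) auto
    ultimately show "4 * k + 1 \<le> card ?up" using m by simp
    have "{c \<in> ?R. rk c \<in> {1..<2 * k + 3}} \<subseteq> ?dn"
    proof
      fix c assume "c \<in> {c \<in> ?R. rk c \<in> {1..<2 * k + 3}}"
      then have c: "c \<in> ?R" "1 \<le> rk c" "rk c < 2 * k + 3" by auto
      have "le c v \<and> \<not> le v c" using le_rk[of c v] c v by simp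
      then show "c \<in> ?dn" using shR[of c] c nl v RV m by auto
    qed
    then have "card {c \<in> ?R. rk c \<in> {1..<2 * k + 3}} \<le> card ?dn"
      by (rule card_mono[rotated]) (use fin in simp)
    moreover have "card {c \<in> ?R. rk c \<in> {1..<2 * k + 3}} = card {1..<2 * k + 3}"
      by (rule card_rk) (use m in auto)
    ultimately show "2 * k + 1 \<le> card ?dn" by simp
  qed (use p q RV in auto)
  then show False using irreducible[OF vV(1)] by (simp add: deletable_def)
qed

lemma C_card:
  assumes "S \<noteq> {}"
  shows "card (C S) \<le> (6 * k + 6) * (2 * k + 1)"
proof -
  define f where "f c = (SOME d. d \<in> Rep S \<and> le c d \<and> le d c)" for c
  have f: "f c \<in> Rep S \<and> le c (f c) \<and> le (f c) c" if "c \<in> C S" for c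
    unfolding f_def by (rule someI_ex) (use Rep_ex[OF that] in blast)
  have "card (C S) \<le> card (f ` C S) * (2 * k + 1)"
  proof (rule card_by_classes)
    show "C S \<subseteq> V - X" using C_D by blast
    show "le u w" if "u \<in> C S" "w \<in> C S" "f u = f w" for u w
      using f[OF that(1)] f[OF that(2)] that(3) le_trans by metis
  qed
  moreover have "card (f ` C S) \<le> card (Rep S)"
  proof (rule card_mono)
    show "finite (Rep S)" by (rule finite_subset[OF _ fin]) (auto simp: Rep_def C_def)
    show "f ` C S \<subseteq> Rep S" using f by blast
  qed
  then have "card (f ` C S) * (2 * k + 1) \<le> (6 * k + 6) * (2 * k + 1)"
    using Rep_card[OF assms] by (intro mult_le_mono1) linarith
  ultimately show ?thesis by linarith
qed

section \<open>Subtrees hanging off a chain\<close>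

text \<open>The unmarked vertices that branch off the chain \<open>C S\<close> above its lowest vertex.\<close>

definition Teeth :: "nat set \<Rightarrow> nat set" where
  "Teeth S = {v \<in> V. D v = {} \<and> (\<exists>u\<in>C S. \<exists>u'\<in>C S. le v u \<and> \<not> le v u')}"

text \<open>\<open>u'\<close> is a chain vertex below the attachment point of \<open>v\<close>. A
  marked ancestor \<open>y\<close> up to \<open>u\<close> shares an affected vertex with
  \<open>u'\<close> and so lies above it; this squeezes \<open>D y\<close> to \<open>S\<close>. If
  \<open>y\<close> were affected, it would be in \<open>D u'\<close> and put \<open>v\<close> below
  \<open>u'\<close>.\<close>

lemma Teeth_P:
  assumes S: "S \<noteq> {}" and v: "v \<in> V" "D v = {}" and u: "u \<in> C S" "le v u"
    and u': "u' \<in> C S" "\<not> le v u'" and y: "y \<in> P v"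
  shows "le u' y" "le y u \<Longrightarrow> y \<in> C S"
proof -
  have y': "y \<in> V" "le v y" "D y \<noteq> {}" using y by (auto simp: P_def)
  have uV: "u \<in> V" "u' \<in> V" "D u = S" "D u' = S" using u u' C_D by auto
  have nyu': "\<not> le y u'" using y' u' le_trans by blast
  have low: "le u' y" if yu: "le y u"
  proof -
    have "D y \<subseteq> S" using D_mono[OF yu] uV by simp
    then obtain x where "x \<in> X" "le x y" "le x u'" using y' uV by (auto simp: D_def)
    then show ?thesis using forest[of x y u'] y' uV XV nyu' by blast
  qed
  have "\<not> le u u'" using u u' le_trans by blast
  then have u'u: "le u' u" using chain_C[of u u'] uV S by blast
  have "le u y \<or> le y u" using forest[of v u y] v uV u y' by blast
  then show "le u' y" using low u'u le_trans by blast
  show "y \<in> C S" if yu: "le y u"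
  proof -
    have "D y = S" using D_mono[OF yu] D_mono[OF low[OF yu]] uV by blast
    moreover have "y \<notin> X"
    proof
      assume "y \<in> X"
      then have "y \<in> D u'" using D_self \<open>D y = S\<close> uV by blast
      then show False using nyu' by (simp add: D_def)
    qed
    ultimately show ?thesis using y' by (simp add: C_def)
  qed
qed

text \<open>The marked ancestors of \<open>v\<close> form a chain, whose lowest class is the
  attachment point of \<open>v\<close>.\<close>

lemma P_min:
  assumes v: "v \<in> V" "P v \<noteq> {}"
  shows "\<exists>a\<in>P v. P v = {y \<in> V. le a y}"
proof -
  have PV: "P v \<subseteq> V" by (auto simp: P_def)
  obtain a where a: "a \<in> P v" "\<And>z. z \<in> P v \<Longrightarrow> le z a \<Longrightarrow> le a z"
    using ex_minimal[OF PV v(2)] by blast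
  have a': "a \<in> V" "le v a" "D a \<noteq> {}" using a by (auto simp: P_def)
  have "P v = {y \<in> V. le a y}"
  proof
    show "P v \<subseteq> {y \<in> V. le a y}"
    proof
      fix y assume y: "y \<in> P v"
      then have "y \<in> V" "le v y" by (auto simp: P_def)
      then have "le a y \<or> le y a" using forest[of v a y] v a' by blast
      then show "y \<in> {y \<in> V. le a y}" using a(2)[OF y] \<open>y \<in> V\<close> by blast
    qed
    show "{y \<in> V. le a y} \<subseteq> P v"
    proof
      fix y assume "y \<in> {y \<in> V. le a y}"
      then have y: "y \<in> V" "le a y" by auto
      have "D y \<noteq> {}" using D_mono[OF y(2)] a' by blast
      then show "y \<in> P v" using y a' le_trans unfolding P_def by blast
    qed
  qed
  then show ?thesis using a by blast
qed

lemma Teeth_min: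
  assumes S: "S \<noteq> {}" and v: "v \<in> Teeth S"
  shows "\<exists>a\<in>C S. P v = {y \<in> V. le a y} \<and> le v a"
proof -
  obtain u u' where u: "v \<in> V" "D v = {}" "u \<in> C S" "u' \<in> C S" "le v u" "\<not> le v u'"
    using v by (auto simp: Teeth_def)
  have "u \<in> P v" using u C_D[of u S] S by (auto simp: P_def)
  then obtain a where a: "a \<in> P v" "P v = {y \<in> V. le a y}" using P_min u by blast
  have "le a u" using \<open>u \<in> P v\<close> a by blast
  then have "a \<in> C S" using Teeth_P(2)[OF S u(1,2,3,5,4,6) a(1)] by blast
  moreover have "le v a" using a(1) by (simp add: P_def)
  ultimately show ?thesis using a by blast
qed

lemma Teeth_chain:
  assumes "S \<noteq> {}" "v \<in> Teeth S" "w \<in> Teeth S"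
  shows "P v \<subseteq> P w \<or> P w \<subseteq> P v"
proof -
  obtain a b where ab: "a \<in> C S" "P v = {y \<in> V. le a y}" "b \<in> C S" "P w = {y \<in> V. le b y}"
    using Teeth_min assms by meson
  then have "le a b \<or> le b a" using chain_C[of a b] C_D assms by auto
  then show ?thesis using ab le_trans by blast
qed

text \<open>Modules of at most \<open>2 * k + 1\<close> vertices contribute that much for each of
  the \<open>6 * k + 6\<close> attachment classes. Among the larger ones, \<open>v0\<close> lies in
  a highest one. All leaves of teeth attached there or lower are common neighbours of
  \<open>P v0\<close>; if there were \<open>2 * k + 3\<close> of them, the module rule would delete
  \<open>v0\<close>.\<close>

lemma Teeth_card:
  assumes S: "S \<noteq> {}"
  shows "card (Teeth S) \<le> (10 * k + 10) * (2 * k + 1)"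
proof -
  define small where "small = {v \<in> Teeth S. card (M (P v)) \<le> 2 * k + 1}"
  have TV: "Teeth S \<subseteq> V" by (auto simp: Teeth_def)
  have finT: "finite (Teeth S)" by (rule finite_subset[OF TV fin])
  have PM: "u \<in> M (P w)" if "u \<in> Teeth S" "P u = P w" for u w
    using that by (simp add: M_def Teeth_def)
  have finM: "finite (M Q)" for Q using fin by (simp add: M_def)
  have "card small \<le> card (P ` small) * (2 * k + 1)"
  proof (rule card_fibres_le)
    show "finite small" using finT by (simp add: small_def)
    fix w assume w: "w \<in> small"
    have "card {u \<in> small. P u = P w} \<le> card (M (P w))"
      by (rule card_mono[OF finM]) (use PM in \<open>auto simp: small_def\<close>)
    also have "\<dots> \<le> 2 * k + 1" using w by (simp add: small_def)
    finally show "card {u \<in> small. P u = P w} \<le> 2 * k + 1" .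
  qed
  moreover have "card (P ` small) \<le> card (Rep S)"
  proof -
    have finR: "finite (Rep S)" by (rule finite_subset[OF _ fin]) (auto simp: Rep_def C_def)
    have "P ` small \<subseteq> (\<lambda>d. {y \<in> V. le d y}) ` Rep S"
    proof
      fix Q assume "Q \<in> P ` small"
      then obtain v where "v \<in> Teeth S" "Q = P v" by (auto simp: small_def)
      then obtain a where a: "a \<in> C S" "Q = {y \<in> V. le a y}" using Teeth_min[OF S] by blast
      obtain d where d: "d \<in> Rep S" "le a d" "le d a" using Rep_ex[OF a(1)] by blast
      have "{y \<in> V. le a y} = {y \<in> V. le d y}" using d le_trans by blast
      then show "Q \<in> (\<lambda>d. {y \<in> V. le d y}) ` Rep S" using a d by blast
    qed
    then have "card (P ` small) \<le> card ((\<lambda>d. {y \<in> V. le d y}) ` Rep S)"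
      by (rule card_mono[rotated]) (use finR in simp)
    also have "\<dots> \<le> card (Rep S)" by (rule card_image_le[OF finR])
    finally show ?thesis .
  qed
  then have "card (P ` small) * (2 * k + 1) \<le> (6 * k + 6) * (2 * k + 1)"
    using Rep_card[OF S] by (intro mult_le_mono1) linarith
  ultimately have c_small: "card small \<le> (6 * k + 6) * (2 * k + 1)" by linarith
  define bad where "bad = Teeth S - small"
  show ?thesis
  proof (cases "bad = {}")
    case True
    then have "Teeth S \<subseteq> small" by (auto simp: bad_def)
    then have "card (Teeth S) \<le> card small" using finT by (intro card_mono) (auto simp: small_def)
    also have "\<dots> \<le> (6 * k + 6) * (2 * k + 1)" by (rule c_small)
    also have "\<dots> \<le> (10 * k + 10) * (2 * k + 1)" by (rule mult_le_mono1) simp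
    finally show ?thesis .
  next
    case False
    \<comment> \<open>Fewest marked ancestors means attached highest on the chain.\<close>
    obtain v0 where v0: "v0 \<in> bad" "\<And>v. v \<in> bad \<Longrightarrow> card (P v0) \<le> card (P v)"
      using ex_has_least_nat[of "\<lambda>v. v \<in> bad" _ "\<lambda>v. card (P v)"] False by blast
    have v0T: "v0 \<in> Teeth S" "2 * k + 1 < card (M (P v0))" using v0(1) by (auto simp: bad_def small_def)
    define W where "W = {v \<in> Teeth S. P v0 \<subseteq> P v}"
    have "bad \<subseteq> W"
    proof
      fix v assume v: "v \<in> bad"
      then have vT: "v \<in> Teeth S" by (simp add: bad_def)
      have finP: "finite (P v0)" using fin by (simp add: P_def)
      have "P v0 \<subseteq> P v"
        using Teeth_chain[OF S vT v0T(1)] v0(2)[OF v] card_seteq[OF finP, of "P v"] by blast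
      then show "v \<in> W" using vT by (simp add: W_def)
    qed
    then have "Teeth S \<subseteq> small \<union> W" by (auto simp: bad_def)
    then have "card (Teeth S) \<le> card (small \<union> W)"
      by (rule card_mono[rotated]) (use finT in \<open>simp add: small_def W_def\<close>)
    also have "\<dots> \<le> card small + card W" by (rule card_Un_le)
    finally have cT: "card (Teeth S) \<le> card small + card W" .
    have WX: "W \<subseteq> V - X"
    proof
      fix v assume "v \<in> W"
      then have "v \<in> V" "D v = {}" by (auto simp: W_def Teeth_def)
      then show "v \<in> V - X" by (rule unmarked_unaffected)
    qed
    have Wdown: "y \<in> W" if w: "w \<in> W" and y: "y \<in> V" "le y w" for w y
    proof -
      obtain u u' where u: "w \<in> V" "D w = {}" "u \<in> C S" "u' \<in> C S" "le w u" "\<not> le w u'"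
        using w by (auto simp: W_def Teeth_def)
      have Dy: "D y = {}" "P y = P w" using unmarked_down[OF u(1,2) y] by auto
      have "\<not> le y u'"
      proof
        assume "le y u'"
        then have "u' \<in> P y" using u C_D[of u' S] S by (auto simp: P_def)
        then show False using Dy u by (auto simp: P_def)
      qed
      moreover have "le y u" using y u le_trans by blast
      ultimately have "y \<in> Teeth S" using y u Dy by (auto simp: Teeth_def)
      then show ?thesis using w Dy by (simp add: W_def)
    qed
    have "\<exists>I\<subseteq>W. (\<forall>r\<in>I. \<forall>y\<in>V. le y r \<longrightarrow> le r y) \<and>
        (\<forall>r\<in>I. \<forall>s\<in>I. le r s \<longrightarrow> r = s) \<and> card W \<le> 2 * card I * (2 * k + 1)"
      by (rule leaves[OF WX]) (rule Wdown)
    then obtain I where I': "I \<subseteq> W \<and> (\<forall>r\<in>I. \<forall>y\<in>V. le y r \<longrightarrow> le r y) \<and>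
        (\<forall>r\<in>I. \<forall>s\<in>I. le r s \<longrightarrow> r = s) \<and> card W \<le> 2 * card I * (2 * k + 1)"
      by (elim exE) simp
    then have I: "I \<subseteq> W" "\<And>r y. r \<in> I \<Longrightarrow> y \<in> V \<Longrightarrow> le y r \<Longrightarrow> le r y"
      "\<And>r s. r \<in> I \<Longrightarrow> s \<in> I \<Longrightarrow> le r s \<Longrightarrow> r = s" "card W \<le> 2 * card I * (2 * k + 1)"
      by simp_all
    \<comment> \<open>\<open>w\<close> is a chain vertex below the attachment point of
      \<open>v0\<close>; the common neighbours of the two are exactly \<open>P v0\<close>.\<close>
    obtain u w where u: "v0 \<in> V" "D v0 = {}" "u \<in> C S" "w \<in> C S" "le v0 u" "\<not> le v0 w"
      using v0T(1) by (auto simp: Teeth_def)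
    have v0X: "v0 \<in> V - X" by (rule unmarked_unaffected[OF u(1,2)])
    have wX: "w \<in> V - X" "D w = S" using u C_D by auto
    obtain a where a: "a \<in> C S" "P v0 = {y \<in> V. le a y}" "le v0 a" using Teeth_min[OF S v0T(1)] by blast
    let ?N = "M (P v0)"
    have v0M: "v0 \<in> ?N" using u by (simp add: M_def)
    have K: "common A v0 w z \<longleftrightarrow> z \<in> P v0" if z: "z \<in> V" for z
    proof
      assume "common A v0 w z"
      then have c: "le v0 z \<or> le z v0" "le w z \<or> le z w"
        using unaffected'[OF v0X z] unaffected'[OF wX(1) z] by (auto simp: common_def)
      have "z \<notin> ?N"
      proof
        assume "z \<in> ?N"
        then have zN: "D z = {}" "P z = P v0" by (auto simp: M_def)
        have "\<not> le w z" using D_mono[of w z] zN wX S by blast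
        then have "w \<in> P z" using c wX S by (simp add: P_def)
        then have "w \<in> P v0" using zN by simp
        then show False using u by (simp add: P_def)
      qed
      then show "z \<in> P v0" using M_neighbours[OF v0M z c(1)] by blast
    next
      assume zP: "z \<in> P v0"
      then have "le w z" using Teeth_P(1)[OF S u(1,2,3,5,4,6)] by blast
      moreover have "le v0 z" using zP by (simp add: P_def)
      ultimately show "common A v0 w z"
        using unaffected'[OF v0X z] unaffected'[OF wX(1) z] by (simp add: common_def)
    qed
    have inmod: "in_module V A v0 w y" if "y \<in> ?N" for y
    proof (rule in_moduleI[OF K M_unaffected M_disjoint _ _ that])
      show "y \<in> ?N \<union> P v0" if "z \<in> ?N" "y \<in> V" "le z y \<or> le y z" for z y
        using M_neighbours[OF that] .
      show "le z y \<or> le y z" if "z \<in> ?N" "y \<in> P v0" for z y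
        using M_above[OF that] by blast
    qed
    have "card {y \<in> V. in_module V A v0 w y} \<le> 2 * k + 1 \<or> card I \<le> 2 * k + 2"
    proof (rule module_bound[where v = v0])
      have "\<not> le w v0" using D_mono[of w v0] wX u S by blast
      then show "\<not> A v0 w" using unaffected[OF v0X, of w] u wX by blast
      show "in_module V A v0 w v0" using inmod v0M by blast
      show "I \<subseteq> V" using I(1) WX by blast
      show "simplicial V A v0 w r" if r: "r \<in> I" for r
      proof (rule minimal_simplicial)
        have rW: "r \<in> W" using r I(1) by blast
        show rX: "r \<in> V - X" using rW WX by blast
        show "le r y" if "y \<in> V" "le y r" for y using I(2)[OF r that] .
        obtain t t' where t: "r \<in> V" "D r = {}" "t \<in> C S" "t' \<in> C S" "le r t" "\<not> le r t'"
          using rW by (auto simp: W_def Teeth_def)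
        have PP: "P v0 \<subseteq> P r" using rW by (simp add: W_def)
        show "full V A v0 w r" unfolding full_def
        proof (intro conjI ballI impI)
          show "\<not> common A v0 w r" using K[OF t(1)] t(2) by (simp add: P_def)
          fix z assume z: "z \<in> V" "common A v0 w z"
          then have "z \<in> P r" using K PP by blast
          then have "le r z" by (simp add: P_def)
          then show "A z r" using unaffected'[OF rX z(1)] by blast
        qed
        fix z y assume h: "z \<in> V" "le r z" "\<not> common A v0 w z"
        \<comment> \<open>A marked ancestor of the leaf outside \<open>P v0\<close> lies between the
          leaf and \<open>a\<close>, on the chain, where no vertex is affected.\<close>
        have "z \<notin> X"
        proof
          assume zX: "z \<in> X"
          then have "D z \<noteq> {}" using D_self by blast
          then have zP: "z \<in> P r" using h by (simp add: P_def)
          have zn: "\<not> le a z" using h K a by blast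
          have aP: "a \<in> P r" using PP a le_refl C_D[OF a(1)] by blast
          then have ra: "le r a" "a \<in> V" by (auto simp: P_def)
          then have "le z a" using forest[of r z a] t h zn by blast
          then have "z \<in> C S" using Teeth_P(2)[OF S t(1,2) a(1) ra(1) t(4,6) zP] by blast
          then show False using zX C_D by blast
        qed
        then show "z \<notin> X \<or> y \<notin> X" ..
      qed
      show "r = s" if "r \<in> I" "s \<in> I" "A r s" for r s
      proof -
        have "r \<in> V - X" "s \<in> V" using that(1,2) I(1) WX by blast+
        then have "le r s \<or> le s r" using unaffected[of r s] that(3) by blast
        then show ?thesis using I(3)[of r s] I(3)[of s r] that by blast
      qed
    qed (use v0X wX in auto)
    moreover have "card ?N \<le> card {y \<in> V. in_module V A v0 w y}"
    proof (rule card_mono)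
      show "finite {y \<in> V. in_module V A v0 w y}" using fin by simp
      show "?N \<subseteq> {y \<in> V. in_module V A v0 w y}" using inmod M_unaffected by blast
    qed
    ultimately have "card I \<le> 2 * k + 2" using v0T(2) by linarith
    then have "2 * card I * (2 * k + 1) \<le> (4 * k + 4) * (2 * k + 1)" by (intro mult_le_mono1) simp
    then have "card (Teeth S) \<le> (6 * k + 6) * (2 * k + 1) + (4 * k + 4) * (2 * k + 1)"
      using cT c_small I(4) by linarith
    also have "\<dots> = (10 * k + 10) * (2 * k + 1)" by (simp add: algebra_simps)
    finally show ?thesis .
  qed
qed

section \<open>The cubic count\<close>

lemma unmarked_same_P_card:
  assumes "W \<subseteq> V" "\<And>v. v \<in> W \<Longrightarrow> D v = {}" "\<And>v w. v \<in> W \<Longrightarrow> w \<in> W \<Longrightarrow> P v = P w"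
  shows "card W \<le> (4 * k + 6) * (2 * k + 1)"
proof (cases "W = {}")
  case False
  then obtain w where w: "w \<in> W" by blast
  have "W \<subseteq> M (P w)"
    using assms(1) assms(2) assms(3)[OF _ w] unfolding M_def by blast
  then have "card W \<le> card (M (P w))"
    by (rule card_mono[rotated]) (use fin in \<open>simp add: M_def\<close>)
  then show ?thesis using M_card[of "P w"] by linarith
qed simp

text \<open>An unmarked vertex with marked ancestors hangs at the lowest of them, \<open>a\<close>,
  and is a tooth of the chain of \<open>D a\<close> with two exceptions: \<open>a\<close> may be
  affected (\<open>L'\<close>), or in the lowest class of its chain (\<open>L\<close>), where no
  chain vertex below \<open>a\<close> is left to define \<open>K\<close>. In either case
  \<open>a\<close> is unique up to twins in the edited graph, so the set lies in a single module and
  \<open>M_card\<close> applies. \<open>M {}\<close> collects the unmarked vertices without marked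
  ancestors.\<close>

lemma card_V: "card V \<le> 240 * (k + 1) ^ 3"
proof -
  define L where "L S = {v \<in> V. D v = {} \<and> (\<exists>u\<in>C S. (\<forall>u'\<in>C S. le u u') \<and> P v = {y \<in> V. le u y})}" for S
  define L' where "L' S = {v \<in> V. D v = {} \<and> (\<exists>u\<in>X. D u = S \<and> P v = {y \<in> V. le u y})}" for S
  define G where "G S = C S \<union> Teeth S \<union> L S \<union> L' S" for S
  let ?m = "2 * k + 1"
  have cL: "card (L S) \<le> (4 * k + 6) * ?m" for S
  proof (rule unmarked_same_P_card)
    fix v w assume "v \<in> L S" "w \<in> L S"
    then obtain a b where ab: "a \<in> C S" "\<forall>u'\<in>C S. le a u'" "P v = {y \<in> V. le a y}"
      "b \<in> C S" "\<forall>u'\<in>C S. le b u'" "P w = {y \<in> V. le b y}" by (auto simp: L_def)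
    then have "le a b" "le b a" by auto
    then show "P v = P w" unfolding ab using le_trans by blast
  qed (auto simp: L_def)
  have cL': "card (L' S) \<le> (4 * k + 6) * ?m" for S
  proof (rule unmarked_same_P_card)
    fix v w assume "v \<in> L' S" "w \<in> L' S"
    then obtain a b where ab: "a \<in> X" "D a = S" "P v = {y \<in> V. le a y}"
      "b \<in> X" "D b = S" "P w = {y \<in> V. le b y}" by (auto simp: L'_def)
    \<comment> \<open>Two affected vertices with the same \<open>D\<close> lie below each other and
      thus have the same ancestors.\<close>
    have "a \<in> D b" "b \<in> D a" using ab D_self[of a] D_self[of b] by auto
    then have "le a b" "le b a" by (auto simp: D_def)
    then show "P v = P w" unfolding ab using le_trans by blast
  qed (auto simp: L'_def)
  have cG: "card (G S) \<le> (24 * k + 28) * ?m" if S: "S \<noteq> {}" for S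
  proof -
    have "card (G S) \<le> card (C S) + card (Teeth S) + card (L S) + card (L' S)"
      unfolding G_def using card_Un_le by (meson add_le_mono1 order_trans)
    also have "\<dots> \<le> (6 * k + 6) * ?m + (10 * k + 10) * ?m + (4 * k + 6) * ?m + (4 * k + 6) * ?m"
      by (intro add_mono C_card Teeth_card cL cL' S)
    also have "\<dots> = (24 * k + 28) * ?m" by (simp add: algebra_simps)
    finally show ?thesis .
  qed
  have "V \<subseteq> X \<union> (\<Union>S\<in>D ` V - {{}}. G S) \<union> M {}"
  proof
    fix v assume v: "v \<in> V"
    show "v \<in> X \<union> (\<Union>S\<in>D ` V - {{}}. G S) \<union> M {}"
    proof (cases "v \<in> X \<or> D v \<noteq> {} \<or> P v = {}")
      case True
      then consider "v \<in> X" | "v \<notin> X" "D v \<noteq> {}" | "D v = {}" "P v = {}" by blast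
      then show ?thesis
      proof cases
        case 2
        then have "v \<in> G (D v)" using v by (simp add: G_def C_def)
        then show ?thesis using v 2 by blast
      qed (use v in \<open>auto simp: M_def\<close>)
    next
      case False
      then have Dv: "D v = {}" by blast
      obtain a where a: "a \<in> P v" "P v = {y \<in> V. le a y}" using P_min[OF v] False by blast
      have a': "a \<in> V" "le v a" "D a \<noteq> {}" using a(1) by (auto simp: P_def)
      have "v \<in> G (D a)"
      proof (cases "a \<in> X")
        case True then show ?thesis using v Dv a by (auto simp: G_def L'_def)
      next
        case aX: False
        then have aC: "a \<in> C (D a)" using a' by (simp add: C_def)
        show ?thesis
        proof (cases "\<forall>u'\<in>C (D a). le a u'")
          case True then show ?thesis using v Dv a aC by (auto simp: G_def L_def)
        next
          case False
          then obtain u' where u': "u' \<in> C (D a)" "\<not> le a u'" by blast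
          have "\<not> le v u'"
          proof
            assume "le v u'"
            then have "u' \<in> P v" using C_D[OF u'(1)] a' by (auto simp: P_def)
            then show False using a u' by blast
          qed
          then have "v \<in> Teeth (D a)" using v Dv a' aC u' by (auto simp: Teeth_def)
          then show ?thesis by (simp add: G_def)
        qed
      qed
      then show ?thesis using a' by blast
    qed
  qed
  moreover have finG: "finite (\<Union>S\<in>D ` V - {{}}. G S)"
    by (rule finite_subset[OF _ fin]) (auto simp: G_def C_def Teeth_def L_def L'_def)
  moreover have finM: "finite (M {})" using fin by (simp add: M_def)
  ultimately have "card V \<le> card (X \<union> (\<Union>S\<in>D ` V - {{}}. G S) \<union> M {})"
    by (intro card_mono) (use finX in auto)
  also have "\<dots> \<le> card X + card (\<Union>S\<in>D ` V - {{}}. G S) + card (M {})"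
    using card_Un_le by (meson add_le_mono1 order_trans)
  also have "card (\<Union>S\<in>D ` V - {{}}. G S) \<le> (\<Sum>S\<in>D ` V - {{}}. card (G S))"
    by (rule card_UN_le) (use fin in simp)
  also have "\<dots> \<le> (\<Sum>S\<in>D ` V - {{}}. (24 * k + 28) * ?m)"
    by (rule sum_mono) (use cG in auto)
  also have "\<dots> = card (D ` V - {{}}) * ((24 * k + 28) * ?m)" by simp
  also have "\<dots> \<le> (4 * k) * ((24 * k + 28) * ?m)"
    by (rule mult_le_mono1[OF card_D])
  finally have "card V \<le> card X + (4 * k) * ((24 * k + 28) * ?m) + card (M {})" by simp
  also have "\<dots> \<le> 2 * k + (4 * k) * ((24 * k + 28) * ?m) + (4 * k + 6) * ?m"
    using card_X M_card[of "{}"] by linarith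
  \<comment> \<open>The leading coefficient is \<open>4 * 24 * 2 = 192\<close>; the rest of
    \<open>240\<close> is slack.\<close>
  also have "\<dots> \<le> 240 * (k + 1) ^ 3"
    by (simp add: power3_eq_cube algebra_simps)
  finally show ?thesis .
qed

end

theorem irreducible_card:
  assumes "rgraph V A" "\<And>v. v \<in> V \<Longrightarrow> \<not> deletable V A k v" "editable V A k"
  shows "card V \<le> 240 * (k + 1) ^ 3"
proof -
  obtain B where B: "rgraph V B" "nested V B" "card (diffs V A B) \<le> k"
    using assms(3) by (auto simp: editable_def)
  interpret irreducible_edition V A B k "affected V A B"
  proof
    show "card (affected V A B) \<le> 2 * k"
      by (rule card_affected[OF rgraphD(1)[OF assms(1)] B(3)])
  qed (use assms B in blast)+
  show ?thesis by (rule card_V)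
qed

section \<open>Instances and reflexive relations\<close>

definition radj :: "nat ugraph \<Rightarrow> nat \<Rightarrow> nat \<Rightarrow> bool" where
  "radj G u v \<longleftrightarrow> u = v \<or> {u, v} \<in> edges G"

lemma radj_commute: "radj G u v \<longleftrightarrow> radj G v u"
  by (auto simp: radj_def insert_commute)

lemma no_loop: "edges G \<subseteq> vertex_pairs V \<Longrightarrow> {u} \<notin> edges G"
  by (auto simp: vertex_pairs_def)

text \<open>Handles both forbidden graphs at once: the pair of \<open>0\<close> and
  \<open>3\<close>, which tells \<open>P4\<close> from \<open>C4\<close>, is left open.\<close>

lemma not_nested_if_isomorphic:
  assumes iso: "isomorphic (induced_subgraph H S) Q" and S: "S \<subseteq> verts H"
    and Q: "verts Q = {0, 1, 2, 3 :: nat}" "{0, 1} \<in> edges Q" "{1, 2} \<in> edges Q" "{2, 3} \<in> edges Q"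
      "{0, 2} \<notin> edges Q" "{1, 3} \<notin> edges Q"
  shows "\<not> nested (verts H) (radj H)"
proof
  assume nest: "nested (verts H) (radj H)"
  obtain f where f: "bij_betw f S {0, 1, 2, 3 :: nat}"
    and e: "\<And>u v. u \<in> S \<Longrightarrow> v \<in> S \<Longrightarrow> {u, v} \<in> edges H \<longleftrightarrow> {f u, f v} \<in> edges Q"
    using iso Q(1) by (auto simp: isomorphic_def induced_subgraph_def)
  have im: "f ` S = {0, 1, 2, 3}" using f by (simp add: bij_betw_def)
  obtain a where a: "a \<in> S" "f a = 0" using im by (metis imageE insertI1)
  obtain b where b: "b \<in> S" "f b = 1" using im by (metis imageE insertI1 insertI2)
  obtain c where c: "c \<in> S" "f c = 2" using im by (metis imageE insertI1 insertI2)
  obtain d where d: "d \<in> S" "f d = 3" using im by (metis imageE insertI1 insertI2)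
  have ne: "a \<noteq> c" "b \<noteq> d" using a b c d by auto
  have "radj H b c" "radj H a b" "\<not> radj H a c" "radj H d c" "\<not> radj H d b"
    using e[OF b(1) c(1)] e[OF a(1) b(1)] e[OF a(1) c(1)] e[OF c(1) d(1)] e[OF b(1) d(1)] a b c d Q ne
    by (auto simp: radj_def insert_commute)
  then show False using nested_private[OF nest, of b c a d] a b c d S by blast
qed

text \<open>Adjacent \<open>b\<close> and \<open>c\<close> with incomparable neighbourhoods have
  private neighbours \<open>a\<close> and \<open>d\<close>; their adjacency decides between
  \<open>C4\<close> and \<open>P4\<close>.\<close>

lemma contains_induced_if_not_nested:
  assumes pairs: "edges H \<subseteq> vertex_pairs (verts H)" and not: "\<not> nested (verts H) (radj H)"
  shows "contains_induced H P4 \<or> contains_induced H C4"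
proof -
  obtain b c a d where V: "a \<in> verts H" "b \<in> verts H" "c \<in> verts H" "d \<in> verts H"
    and r: "radj H b c" "radj H a b" "\<not> radj H a c" "radj H d c" "\<not> radj H d b"
    using not unfolding nested_def nle_def by blast
  have ne: "a \<noteq> b" "a \<noteq> c" "a \<noteq> d" "b \<noteq> c" "b \<noteq> d" "c \<noteq> d"
    using r radj_commute by (auto simp: radj_def)
  have ed: "{a, b} \<in> edges H" "{b, a} \<in> edges H" "{b, c} \<in> edges H" "{c, b} \<in> edges H"
    "{c, d} \<in> edges H" "{d, c} \<in> edges H" "{a, c} \<notin> edges H" "{c, a} \<notin> edges H"
    "{b, d} \<notin> edges H" "{d, b} \<notin> edges H"
    using r ne by (auto simp: radj_def insert_commute)
  define f :: "nat \<Rightarrow> nat" where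
    "f x = (if x = a then 0 else if x = b then 1 else if x = c then 2 else 3)" for x
  let ?S = "{a, b, c, d}"
  have fv: "f a = 0" "f b = 1" "f c = 2" "f d = 3" using ne by (auto simp: f_def)
  have bij: "bij_betw f ?S {0, 1, 2, 3}"
    unfolding bij_betw_def inj_on_def using fv by auto
  note loops = no_loop[OF pairs]
  have "isomorphic (induced_subgraph H ?S) P4 \<or> isomorphic (induced_subgraph H ?S) C4"
  proof (cases "{a, d} \<in> edges H")
    case True
    have da: "{d, a} \<in> edges H" using True by (simp add: insert_commute)
    have "isomorphic (induced_subgraph H ?S) C4"
      unfolding isomorphic_def induced_subgraph_def C4_def
      by (rule exI[of _ f]) (use bij fv ed True da loops in \<open>simp add: doubleton_eq_iff\<close>)
    then show ?thesis ..
  next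
    case False
    have da: "{d, a} \<notin> edges H" using False by (simp add: insert_commute)
    have "isomorphic (induced_subgraph H ?S) P4"
      unfolding isomorphic_def induced_subgraph_def P4_def
      by (rule exI[of _ f]) (use bij fv ed False da loops in \<open>simp add: doubleton_eq_iff\<close>)
    then show ?thesis ..
  qed
  moreover have "?S \<subseteq> verts H" using V by simp
  ultimately show ?thesis unfolding contains_induced_def by blast
qed

lemma trivially_perfect_iff_nested:
  assumes "edges H \<subseteq> vertex_pairs (verts H)"
  shows "trivially_perfect H \<longleftrightarrow> nested (verts H) (radj H)"
proof
  assume "trivially_perfect H"
  then show "nested (verts H) (radj H)"
    using contains_induced_if_not_nested[OF assms] by (auto simp: trivially_perfect_def)
next
  assume n: "nested (verts H) (radj H)"
  have "\<not> contains_induced H P4"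
    using n not_nested_if_isomorphic[of H _ P4]
    unfolding contains_induced_def by (auto simp: P4_def doubleton_eq_iff)
  moreover have "\<not> contains_induced H C4"
    using n not_nested_if_isomorphic[of H _ C4]
    unfolding contains_induced_def by (auto simp: C4_def doubleton_eq_iff)
  ultimately show "trivially_perfect H" by (simp add: trivially_perfect_def)
qed

lemma rgraph_radj: "finite (verts G) \<Longrightarrow> rgraph (verts G) (radj G)"
  using radj_commute by (auto simp: rgraph_def radj_def)

lemma edges_edit:
  assumes "edges G \<subseteq> vertex_pairs (verts G)" "F \<subseteq> vertex_pairs (verts G)"
  shows "edges (edit G F) \<subseteq> vertex_pairs (verts (edit G F))"
  using assms by (auto simp: edit_def)

text \<open>\<open>diffs\<close> itself serves as the edition: both relations are reflexive, so it
  contains no singletons and consists of genuine vertex pairs.\<close>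

theorem yes_instance_iff_editable:
  assumes G: "simple_graph G"
  shows "yes_instance G k \<longleftrightarrow> editable (verts G) (radj G) k"
proof
  have fin: "finite (verts G)" and pairs: "edges G \<subseteq> vertex_pairs (verts G)"
    using G by (auto simp: simple_graph_def)
  have vedit: "verts (edit G F) = verts G" for F by (simp add: edit_def)
  {
    assume "yes_instance G k"
    then obtain F where F: "F \<subseteq> vertex_pairs (verts G)" "card F \<le> k" "trivially_perfect (edit G F)"
      by (auto simp: yes_instance_def is_edition_def)
    have "nested (verts G) (radj (edit G F))"
      using trivially_perfect_iff_nested[OF edges_edit[OF pairs F(1)]] F(3) vedit by simp
    moreover have "rgraph (verts G) (radj (edit G F))"
      using rgraph_radj[of "edit G F"] fin vedit by simp
    moreover have "card (diffs (verts G) (radj G) (radj (edit G F))) \<le> k"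
    proof -
      have "diffs (verts G) (radj G) (radj (edit G F)) \<subseteq> F"
        by (auto simp: diffs_def radj_def edit_def)
      moreover have "finite F"
        by (rule finite_subset[of _ "Pow (verts G)"]) (use F(1) fin in \<open>auto simp: vertex_pairs_def\<close>)
      ultimately show ?thesis using F(2) card_mono by (meson order_trans)
    qed
    ultimately show "editable (verts G) (radj G) k" by (auto simp: editable_def)
  next
    assume "editable (verts G) (radj G) k"
    then obtain B where B: "rgraph (verts G) B" "nested (verts G) B"
      "card (diffs (verts G) (radj G) B) \<le> k" by (auto simp: editable_def)
    let ?F = "diffs (verts G) (radj G) B"
    have F: "?F \<subseteq> vertex_pairs (verts G)"
    proof
      fix e assume "e \<in> ?F"
      then obtain u v where uv: "u \<in> verts G" "v \<in> verts G" "e = {u, v}" "radj G u v \<noteq> B u v"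
        by (auto simp: diffs_def)
      then have "u \<noteq> v" using rgraphD(2)[OF B(1)] by (auto simp: radj_def)
      then show "e \<in> vertex_pairs (verts G)" using uv by (auto simp: vertex_pairs_def)
    qed
    have memF: "{u, v} \<in> ?F \<longleftrightarrow> radj G u v \<noteq> B u v" if "u \<in> verts G" "v \<in> verts G" for u v
    proof
      assume "{u, v} \<in> ?F"
      then obtain a b where "a \<in> verts G" "b \<in> verts G" "{u, v} = {a, b}" "radj G a b \<noteq> B a b"
        by (auto simp: diffs_def)
      then show "radj G u v \<noteq> B u v"
        using radj_commute[of G u v] rgraph_commute[OF B(1)] by (auto simp: doubleton_eq_iff)
    qed (use that in \<open>auto simp: diffs_def\<close>)
    have "radj (edit G ?F) u v \<longleftrightarrow> B u v" if "u \<in> verts G" "v \<in> verts G" for u v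
      using memF[OF that] rgraphD(2)[OF B(1)] that by (auto simp: radj_def edit_def)
    then have "nested (verts G) (radj (edit G ?F))"
      using B(2) unfolding nested_def nle_def by simp
    then have "trivially_perfect (edit G ?F)"
      using trivially_perfect_iff_nested[OF edges_edit[OF pairs F]] vedit by simp
    then show "yes_instance G k" using F B(3) by (auto simp: yes_instance_def is_edition_def)
  }
qed

section \<open>A first-order language with counting and its compilation\<close>

text \<open>Variables are de Bruijn levels: inside \<open>d\<close> quantifiers the free variables are
  \<open>0, \<dots>, d - 1\<close>, and a quantifier binds variable \<open>d\<close>. \<open>Count c e \<phi>\<close> says that at least
  \<open>c * k + e\<close> vertices satisfy \<open>\<phi>\<close>.\<close>

datatype fm = Adj nat nat | Less nat nat | Same nat nat | FNot fm | FAnd fm fm | Count nat nat fm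

primrec eval :: "adjacency \<Rightarrow> nat \<Rightarrow> nat \<Rightarrow> fm \<Rightarrow> nat list \<Rightarrow> bool" where
  "eval A n k (Adj i j) xs \<longleftrightarrow> A (xs ! i) (xs ! j)"
| "eval A n k (Less i j) xs \<longleftrightarrow> xs ! i < xs ! j"
| "eval A n k (Same i j) xs \<longleftrightarrow> xs ! i = xs ! j"
| "eval A n k (FNot \<phi>) xs \<longleftrightarrow> \<not> eval A n k \<phi> xs"
| "eval A n k (FAnd \<phi> \<psi>) xs \<longleftrightarrow> eval A n k \<phi> xs \<and> eval A n k \<psi> xs"
| "eval A n k (Count c e \<phi>) xs \<longleftrightarrow> c * k + e \<le> card {y \<in> {..<n}. eval A n k \<phi> (xs @ [y])}"

primrec scoped :: "fm \<Rightarrow> nat \<Rightarrow> bool" where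
  "scoped (Adj i j) d \<longleftrightarrow> i < d \<and> j < d"
| "scoped (Less i j) d \<longleftrightarrow> i < d \<and> j < d"
| "scoped (Same i j) d \<longleftrightarrow> i < d \<and> j < d"
| "scoped (FNot \<phi>) d \<longleftrightarrow> scoped \<phi> d"
| "scoped (FAnd \<phi> \<psi>) d \<longleftrightarrow> scoped \<phi> d \<and> scoped \<psi> d"
| "scoped (Count c e \<phi>) d \<longleftrightarrow> scoped \<phi> (Suc d)"

definition FEx :: "fm \<Rightarrow> fm" where "FEx \<phi> = Count 0 1 \<phi>"
definition FAll :: "fm \<Rightarrow> fm" where "FAll \<phi> = FNot (FEx (FNot \<phi>))"
definition FOr :: "fm \<Rightarrow> fm \<Rightarrow> fm" where "FOr \<phi> \<psi> = FNot (FAnd (FNot \<phi>) (FNot \<psi>))"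
definition FImp :: "fm \<Rightarrow> fm \<Rightarrow> fm" where "FImp \<phi> \<psi> = FNot (FAnd \<phi> (FNot \<psi>))"

lemma eval_Ex [simp]: "eval A n k (FEx \<phi>) xs \<longleftrightarrow> (\<exists>y\<in>{..<n}. eval A n k \<phi> (xs @ [y]))"
  by (auto simp: FEx_def Suc_le_eq card_gt_0_iff)

lemma eval_connectives [simp]:
  "eval A n k (FAll \<phi>) xs \<longleftrightarrow> (\<forall>y\<in>{..<n}. eval A n k \<phi> (xs @ [y]))"
  "eval A n k (FOr \<phi> \<psi>) xs \<longleftrightarrow> eval A n k \<phi> xs \<or> eval A n k \<psi> xs"
  "eval A n k (FImp \<phi> \<psi>) xs \<longleftrightarrow> (eval A n k \<phi> xs \<longrightarrow> eval A n k \<psi> xs)"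
  by (auto simp: FAll_def FOr_def FImp_def)

lemma scoped_connectives [simp]:
  "scoped (FEx \<phi>) d \<longleftrightarrow> scoped \<phi> (Suc d)"
  "scoped (FAll \<phi>) d \<longleftrightarrow> scoped \<phi> (Suc d)"
  "scoped (FOr \<phi> \<psi>) d \<longleftrightarrow> scoped \<phi> d \<and> scoped \<psi> d"
  "scoped (FImp \<phi> \<psi>) d \<longleftrightarrow> scoped \<phi> d \<and> scoped \<psi> d"
  by (auto simp: FEx_def FAll_def FOr_def FImp_def)

section \<open>Registers, loops and time bounds\<close>

text \<open>Unary names are distinct for distinct levels, and their first letter alone separates
  them from all fixed register names of the programs.\<close>

definition var :: "nat \<Rightarrow> vname" where "var i = replicate (Suc i) (CHR ''v'')"
definition cnt :: "nat \<Rightarrow> vname" where "cnt i = replicate (Suc i) (CHR ''c'')"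

lemma var_neq [simp]:
  "var i = var j \<longleftrightarrow> i = j" "cnt i = cnt j \<longleftrightarrow> i = j" "var i \<noteq> cnt j" "cnt j \<noteq> var i"
  by (auto simp: var_def cnt_def)

lemma var_neq_Cons [simp]:
  "c \<noteq> CHR ''v'' \<Longrightarrow> var i \<noteq> c # cs" "c \<noteq> CHR ''v'' \<Longrightarrow> c # cs \<noteq> var i"
  "c \<noteq> CHR ''c'' \<Longrightarrow> cnt i \<noteq> c # cs" "c \<noteq> CHR ''c'' \<Longrightarrow> c # cs \<noteq> cnt i"
  by (auto simp: var_def cnt_def)

lemma reg_set_reg [simp]: "reg (set_reg x v s) = (reg s)(x := v)" "arr (set_reg x v s) = arr s"
  by (simp_all add: set_reg_def)

lemma arr_set_arr [simp]: "reg (set_arr a i j v s) = reg s"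
  "arr (set_arr a i j v s) = (arr s)(a := (arr s a)(i := (arr s a i)(j := v)))"
  by (simp_all add: set_arr_def)

definition For :: "vname \<Rightarrow> aexp \<Rightarrow> com \<Rightarrow> com" where
  "For x b c = Seq (Assign x (Const 0)) (While (Lt (Var x) b) (Seq c (Assign x (Add (Var x) (Const 1)))))"

text \<open>Total correctness with a time budget; as programs are deterministic, the existential
  speaks about the only run.\<close>

definition runs :: "com \<Rightarrow> state \<Rightarrow> nat \<Rightarrow> (state \<Rightarrow> bool) \<Rightarrow> bool" where
  "runs c s T Q \<longleftrightarrow> (\<exists>t s'. exec c s t s' \<and> t \<le> T \<and> Q s')"

lemma runs_mono: "runs c s T Q \<Longrightarrow> T \<le> U \<Longrightarrow> (\<And>s'. Q s' \<Longrightarrow> R s') \<Longrightarrow> runs c s U R"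
  unfolding runs_def by (meson order_trans)

lemma runs_Skip: "Q s \<Longrightarrow> runs Skip s 1 Q"
  unfolding runs_def using exec_Skip by blast

lemma runs_Assign: "Q (set_reg x (aval a s) s) \<Longrightarrow> runs (Assign x a) s 1 Q"
  unfolding runs_def using exec_Assign by blast

lemma runs_Store: "Q (set_arr A (aval a s) (aval b s) (aval e s) s) \<Longrightarrow> runs (Store A a b e) s 1 Q"
  unfolding runs_def using exec_Store by blast

lemma runs_Seq:
  assumes "runs c s T R" "\<And>s'. R s' \<Longrightarrow> runs d s' U Q"
  shows "runs (Seq c d) s (T + U) Q"
  using assms unfolding runs_def by (meson add_mono exec_Seq)

lemma runs_Cond:
  assumes "bval b s \<Longrightarrow> runs c s T Q" "\<not> bval b s \<Longrightarrow> runs d s T Q"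
  shows "runs (Cond b c d) s (T + 1) Q"
proof (cases "bval b s")
  case True
  then obtain t s' where "exec c s t s'" "t \<le> T" "Q s'" using assms(1) by (auto simp: runs_def)
  then show ?thesis unfolding runs_def using exec_CondTrue[OF True] by (meson add_le_mono1)
next
  case False
  then obtain t s' where "exec d s t s'" "t \<le> T" "Q s'" using assms(2) by (auto simp: runs_def)
  then show ?thesis unfolding runs_def using exec_CondFalse[OF False] by (meson add_le_mono1)
qed

text \<open>The bound \<open>b\<close> is evaluated anew in every round, so \<open>ctrl\<close>
  demands that its value stay \<open>N\<close>. Each round pays for the body, the increment and the
  test; the final \<open>2\<close> pays for the initial assignment and the last test.\<close>

lemma runs_For:
  assumes init: "I 0 (set_reg x 0 s)"
    and step: "\<And>i s. i < N \<Longrightarrow> I i s \<Longrightarrow>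
      runs c s T (\<lambda>s'. reg s' x = i \<and> I (Suc i) (set_reg x (Suc i) s'))"
    and ctrl: "\<And>i s. I i s \<Longrightarrow> reg s x = i \<and> aval b s = N"
  shows "runs (For x b c) s (N * (T + 2) + 2) (I N)"
proof -
  let ?w = "While (Lt (Var x) b) (Seq c (Assign x (Add (Var x) (Const 1))))"
  have loop: "runs ?w s ((N - i) * (T + 2) + 1) (I N)" if "i \<le> N" "I i s" for i s
    using that
  proof (induction "N - i" arbitrary: i s)
    case 0
    then have [simp]: "i = N" by simp
    have "\<not> bval (Lt (Var x) b) s" using ctrl[OF 0(3)] by simp
    then have "exec ?w s 1 s" by (rule exec_WhileFalse)
    then show ?case using 0 unfolding runs_def by (intro exI[of _ 1] exI[of _ s]) simp
  next
    case (Suc m)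
    then have iN: "i < N" by simp
    have b: "bval (Lt (Var x) b) s" using ctrl[OF Suc(4)] iN by simp
    obtain t s' where t: "exec c s t s'" "t \<le> T" "reg s' x = i" "I (Suc i) (set_reg x (Suc i) s')"
      using step[OF iN Suc(4)] by (auto simp: runs_def)
    have "exec (Seq c (Assign x (Add (Var x) (Const 1)))) s (t + 1) (set_reg x (Suc i) s')"
      using exec_Seq[OF t(1) exec_Assign[of x "Add (Var x) (Const 1)"]] t(3) by simp
    moreover have "runs ?w (set_reg x (Suc i) s') ((N - Suc i) * (T + 2) + 1) (I N)"
      by (rule Suc(1)) (use Suc(2) iN t(4) in auto)
    then obtain u s'' where u: "exec ?w (set_reg x (Suc i) s') u s''"
      "u \<le> (N - Suc i) * (T + 2) + 1" "I N s''" by (auto simp: runs_def)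
    ultimately have "exec ?w s (t + 1 + u + 1) s''" using exec_WhileTrue[OF b] by blast
    moreover have "t + 1 + u + 1 \<le> (N - i) * (T + 2) + 1"
    proof -
      have "N - i = Suc (N - Suc i)" using iN by simp
      then have "(N - i) * (T + 2) = (N - Suc i) * (T + 2) + (T + 2)" by simp
      then show ?thesis using t(2) u(2) by linarith
    qed
    ultimately show ?case using u(3) unfolding runs_def by blast
  qed
  have "runs (For x b c) s (1 + ((N - 0) * (T + 2) + 1)) (I N)"
    unfolding For_def
  proof (rule runs_Seq)
    show "runs (Assign x (Const 0)) s 1 (I 0)" by (rule runs_Assign) (use init in simp)
    show "runs ?w s' ((N - 0) * (T + 2) + 1) (I N)" if "I 0 s'" for s'
      using loop[of 0 s'] that by simp
  qed
  then show ?thesis by (rule runs_mono) auto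
qed

section \<open>Compiling formulas\<close>

text \<open>A product unrolled into a sum, as the machine cannot multiply; \<open>c\<close> is fixed
  by the formula.\<close>

definition thr :: "nat \<Rightarrow> nat \<Rightarrow> aexp" where
  "thr c e = (Add (Var ''k'') ^^ c) (Const e)"

lemma aval_thr [simp]: "aval (thr c e) s = c * reg s ''k'' + e"
  unfolding thr_def by (induction c) auto

definition test :: "bexp \<Rightarrow> com" where
  "test b = Cond b (Assign ''res'' (Const 1)) (Assign ''res'' (Const 0))"

primrec compile :: "fm \<Rightarrow> nat \<Rightarrow> com" where
  "compile (Adj i j) d = test (Neg (Conj (Neg (Eq (Var (var i)) (Var (var j))))
     (Neg (Eq (Read ''adj'' (Var (var i)) (Var (var j))) (Const 1)))))"
| "compile (Less i j) d = test (Lt (Var (var i)) (Var (var j)))"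
| "compile (Same i j) d = test (Eq (Var (var i)) (Var (var j)))"
| "compile (FNot \<phi>) d = Seq (compile \<phi> d) (Assign ''res'' (Sub (Const 1) (Var ''res'')))"
| "compile (FAnd \<phi> \<psi>) d = Seq (compile \<phi> d) (Cond (Eq (Var ''res'') (Const 0)) Skip (compile \<psi> d))"
| "compile (Count c e \<phi>) d =
     Seq (Assign (cnt d) (Const 0))
    (Seq (For (var d) (Var ''n'')
           (Seq (compile \<phi> (Suc d)) (Assign (cnt d) (Add (Var (cnt d)) (Var ''res'')))))
         (test (Neg (Lt (Var (cnt d)) (thr c e)))))"

text \<open>Everything that code compiled at depth \<open>d\<close> may overwrite. Levels below
  \<open>d\<close> stay intact, so nested counters do not clash.\<close>

definition scratch :: "nat \<Rightarrow> vname set" where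
  "scratch d = insert ''res'' (var ` {d..} \<union> cnt ` {d..})"

lemma scratch_Suc: "scratch (Suc d) \<subseteq> scratch d"
  by (auto simp: scratch_def)

definition agree :: "nat \<Rightarrow> state \<Rightarrow> state \<Rightarrow> bool" where
  "agree d s s' \<longleftrightarrow> arr s' = arr s \<and> (\<forall>x. x \<notin> scratch d \<longrightarrow> reg s' x = reg s x)"

lemma agree_trans: "agree d s s' \<Longrightarrow> agree d s' s'' \<Longrightarrow> agree d s s''"
  by (simp add: agree_def)

lemma agree_Suc: "agree (Suc d) s s' \<Longrightarrow> agree d s s'"
  using scratch_Suc unfolding agree_def by blast

lemma agree_set_reg: "x \<in> scratch d \<Longrightarrow> agree d s (set_reg x v s)"
  by (auto simp: agree_def)

lemma scratch_mem [simp]: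
  "''res'' \<in> scratch d" "var i \<in> scratch d \<longleftrightarrow> d \<le> i" "cnt i \<in> scratch d \<longleftrightarrow> d \<le> i"
  by (auto simp: scratch_def)

lemma scratch_other [simp]: "c \<noteq> CHR ''v'' \<Longrightarrow> c \<noteq> CHR ''c'' \<Longrightarrow> c \<noteq> CHR ''r'' \<Longrightarrow> c # cs \<notin> scratch d"
  by (auto simp: scratch_def)

definition madj :: "state \<Rightarrow> nat \<Rightarrow> nat \<Rightarrow> bool" where
  "madj s i j \<longleftrightarrow> i = j \<or> arr s ''adj'' i j = 1"

text \<open>The exponent in the time bound \<open>(n + 10) ^ cost\<close>: a counting quantifier
  multiplies the time by about \<open>n\<close>, and the surplus in the base absorbs the constant
  overhead of every connective.\<close>

primrec cost :: "fm \<Rightarrow> nat" where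
  "cost (Adj i j) = 1"
| "cost (Less i j) = 1"
| "cost (Same i j) = 1"
| "cost (FNot \<phi>) = Suc (cost \<phi>)"
| "cost (FAnd \<phi> \<psi>) = Suc (cost \<phi> + cost \<psi>)"
| "cost (Count c e \<phi>) = Suc (cost \<phi>)"

lemma cost_pos: "0 < cost \<phi>"
  by (induction \<phi>) auto

definition holds :: "state \<Rightarrow> fm \<Rightarrow> nat list \<Rightarrow> bool" where
  "holds s = eval (madj s) (reg s ''n'') (reg s ''k'')"

lemma holds_agree: "agree d s s' \<Longrightarrow> holds s' = holds s"
  by (simp add: holds_def agree_def madj_def[abs_def])

definition computes :: "nat \<Rightarrow> state \<Rightarrow> bool \<Rightarrow> state \<Rightarrow> bool" where
  "computes d s b s' \<longleftrightarrow> agree d s s' \<and> reg s' ''res'' = of_bool b"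

lemma runs_test:
  "runs (test b) s 2 (computes d s (bval b s))"
proof -
  have "runs (test b) s (1 + 1) (computes d s (bval b s))"
    unfolding test_def
    by (rule runs_Cond; rule runs_Assign) (auto simp: computes_def agree_set_reg)
  then show ?thesis by (simp add: numeral_2_eq_2)
qed

lemma power_ge_base: "0 < m \<Longrightarrow> (n + 10 :: nat) \<le> (n + 10) ^ m"
  using power_increasing[of 1 m "n + 10"] by simp

theorem runs_compile:
  assumes "scoped \<phi> d" "length xs = d" "\<And>i. i < d \<Longrightarrow> reg s (var i) = xs ! i"
  shows "runs (compile \<phi> d) s ((reg s ''n'' + 10) ^ cost \<phi>) (computes d s (holds s \<phi> xs))"
  using assms
proof (induction \<phi> arbitrary: d xs s)
  case (Adj i j)
  then show ?case
    by (auto intro!: runs_mono[OF runs_test] simp: holds_def madj_def)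
next
  case (Less i j)
  then show ?case
    by (auto intro!: runs_mono[OF runs_test] simp: holds_def)
next
  case (Same i j)
  then show ?case
    by (auto intro!: runs_mono[OF runs_test] simp: holds_def)
next
  case (FNot \<phi>)
  let ?X = "reg s ''n'' + 10"
  have "runs (compile (FNot \<phi>) d) s (?X ^ cost \<phi> + 1) (computes d s (holds s (FNot \<phi>) xs))"
    unfolding compile.simps
  proof (rule runs_Seq[OF FNot.IH])
    fix s' assume s': "computes d s (holds s \<phi> xs) s'"
    show "runs (Assign ''res'' (Sub (Const 1) (Var ''res''))) s' 1 (computes d s (holds s (FNot \<phi>) xs))"
      by (rule runs_Assign)
        (use s' in \<open>auto simp: computes_def holds_def intro: agree_trans[OF _ agree_set_reg]\<close>)
  qed (use FNot.prems in auto)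
  moreover have "?X ^ cost \<phi> + 1 \<le> ?X ^ cost (FNot \<phi>)"
  proof -
    have "1 \<le> ?X ^ cost \<phi>" by simp
    then have "?X ^ cost \<phi> + 1 \<le> 2 * ?X ^ cost \<phi>" by linarith
    also have "\<dots> \<le> ?X * ?X ^ cost \<phi>" by (rule mult_le_mono1) simp
    finally show ?thesis by simp
  qed
  ultimately show ?case by (rule runs_mono) blast
next
  case (FAnd \<phi> \<psi>)
  let ?X = "reg s ''n'' + 10"
  have "runs (compile (FAnd \<phi> \<psi>) d) s (?X ^ cost \<phi> + (?X ^ cost \<psi> + 1)) (computes d s (holds s (FAnd \<phi> \<psi>) xs))"
    unfolding compile.simps
  proof (rule runs_Seq[OF FAnd.IH(1)])
    fix s' assume s': "computes d s (holds s \<phi> xs) s'"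
    then have ag: "agree d s s'" by (simp add: computes_def)
    show "runs (Cond (Eq (Var ''res'') (Const 0)) Skip (compile \<psi> d)) s' (?X ^ cost \<psi> + 1)
      (computes d s (holds s (FAnd \<phi> \<psi>) xs))"
    proof (rule runs_Cond)
      assume "bval (Eq (Var ''res'') (Const 0)) s'"
      then have f: "\<not> holds s \<phi> xs" using s' by (auto simp: computes_def)
      have "runs Skip s' 1 (computes d s (holds s (FAnd \<phi> \<psi>) xs))"
        by (rule runs_Skip) (use s' f in \<open>auto simp: computes_def holds_def\<close>)
      then show "runs Skip s' (?X ^ cost \<psi>) (computes d s (holds s (FAnd \<phi> \<psi>) xs))"
        by (rule runs_mono) auto
    next
      assume "\<not> bval (Eq (Var ''res'') (Const 0)) s'"
      then have f: "holds s \<phi> xs" using s' by (auto simp: computes_def)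
      have "reg s' ''n'' = reg s ''n''" using ag by (simp add: agree_def)
      moreover have "runs (compile \<psi> d) s' ((reg s' ''n'' + 10) ^ cost \<psi>)
          (computes d s' (holds s' \<psi> xs))"
        by (rule FAnd.IH(2)) (use FAnd.prems ag in \<open>auto simp: agree_def\<close>)
      ultimately show "runs (compile \<psi> d) s' (?X ^ cost \<psi>) (computes d s (holds s (FAnd \<phi> \<psi>) xs))"
        using f ag holds_agree[OF ag]
        by (elim runs_mono) (auto simp: computes_def holds_def intro: agree_trans)
    qed
  qed (use FAnd.prems in auto)
  moreover have "?X ^ cost \<phi> + (?X ^ cost \<psi> + 1) \<le> ?X ^ cost (FAnd \<phi> \<psi>)"
  proof -
    let ?a = "?X ^ cost \<phi>" and ?b = "?X ^ cost \<psi>"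
    have "1 \<le> ?a" "1 \<le> ?b" by auto
    then have "?a * 1 \<le> ?a * ?b" "1 * ?b \<le> ?a * ?b" by (auto intro: mult_le_mono)
    then have "?a + (?b + 1) \<le> 3 * (?a * ?b)" using \<open>1 \<le> ?a\<close> by linarith
    also have "\<dots> \<le> ?X * (?a * ?b)" by (rule mult_le_mono1) simp
    finally show ?thesis by (simp add: power_add)
  qed
  ultimately show ?case by (rule runs_mono) blast
next
  case (Count c e \<phi>)
  let ?n = "reg s ''n''"
  let ?X = "?n + 10"
  let ?T = "?X ^ cost \<phi>"
  define I where "I i s' \<longleftrightarrow> agree d s s' \<and> reg s' (var d) = i \<and>
    reg s' (cnt d) = card {y \<in> {..<i}. holds s \<phi> (xs @ [y])}" for i s'
  have "runs (compile (Count c e \<phi>) d) s (1 + ((?n * ((?T + 1) + 2) + 2) + 2))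
      (computes d s (holds s (Count c e \<phi>) xs))"
    unfolding compile.simps
  proof (rule runs_Seq, rule runs_Assign, rule refl, rule runs_Seq)
    fix s0 assume s0: "s0 = set_reg (cnt d) (aval (Const 0) s) s"
    show "runs (For (var d) (Var ''n'')
           (Seq (compile \<phi> (Suc d)) (Assign (cnt d) (Add (Var (cnt d)) (Var ''res''))))) s0
        (?n * ((?T + 1) + 2) + 2) (I ?n)"
    proof (rule runs_For)
      show "I 0 (set_reg (var d) 0 s0)"
        by (auto simp: I_def s0 agree_def)
      fix i s1 assume i: "i < ?n" and I: "I i s1"
      have ag: "agree d s s1" using I by (simp add: I_def)
      have n1: "reg s1 ''n'' = ?n" using ag by (simp add: agree_def)
      show "runs (Seq (compile \<phi> (Suc d)) (Assign (cnt d) (Add (Var (cnt d)) (Var ''res'')))) s1 (?T + 1)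
          (\<lambda>s'. reg s' (var d) = i \<and> I (Suc i) (set_reg (var d) (Suc i) s'))"
      proof (rule runs_Seq)
        show "runs (compile \<phi> (Suc d)) s1 ?T (computes (Suc d) s1 (holds s \<phi> (xs @ [i])))"
        proof -
          have "runs (compile \<phi> (Suc d)) s1 ((reg s1 ''n'' + 10) ^ cost \<phi>)
              (computes (Suc d) s1 (holds s1 \<phi> (xs @ [i])))"
          proof (rule Count.IH)
            show "reg s1 (var j) = (xs @ [i]) ! j" if "j < Suc d" for j
              using that I Count.prems by (auto simp: nth_append I_def agree_def less_Suc_eq)
          qed (use Count.prems in auto)
          then show ?thesis using n1 holds_agree[OF ag] by simp
        qed
        fix s2 assume s2: "computes (Suc d) s1 (holds s \<phi> (xs @ [i])) s2"
        have ag2: "agree d s s2" using agree_trans[OF ag agree_Suc] s2 by (simp add: computes_def)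
        have r2: "reg s2 (var d) = i" "reg s2 (cnt d) = reg s1 (cnt d)"
          using s2 I by (auto simp: computes_def agree_def I_def)
        have "{y \<in> {..<Suc i}. holds s \<phi> (xs @ [y])} =
          (if holds s \<phi> (xs @ [i]) then insert i {y \<in> {..<i}. holds s \<phi> (xs @ [y])}
           else {y \<in> {..<i}. holds s \<phi> (xs @ [y])})"
          by (auto simp: less_Suc_eq)
        then have c: "card {y \<in> {..<Suc i}. holds s \<phi> (xs @ [y])} =
          card {y \<in> {..<i}. holds s \<phi> (xs @ [y])} + of_bool (holds s \<phi> (xs @ [i]))"
          by simp
        show "runs (Assign (cnt d) (Add (Var (cnt d)) (Var ''res''))) s2 1
          (\<lambda>s'. reg s' (var d) = i \<and> I (Suc i) (set_reg (var d) (Suc i) s'))"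
        proof (rule runs_Assign, intro conjI)
          let ?s3 = "set_reg (cnt d) (aval (Add (Var (cnt d)) (Var ''res'')) s2) s2"
          show "reg ?s3 (var d) = i" using r2 by simp
          have "agree d s (set_reg (var d) (Suc i) ?s3)"
            using ag2 by (auto simp: agree_def)
          moreover have "reg s2 ''res'' = of_bool (holds s \<phi> (xs @ [i]))"
            using s2 by (simp add: computes_def)
          ultimately show "I (Suc i) (set_reg (var d) (Suc i) ?s3)"
            using r2 I c by (simp add: I_def)
        qed
      qed
    next
      fix i s1 assume "I i s1"
      then show "reg s1 (var d) = i \<and> aval (Var ''n'') s1 = ?n"
        by (simp add: I_def agree_def)
    qed
    fix s1 assume I: "I ?n s1"
    have b: "bval (Neg (Lt (Var (cnt d)) (thr c e))) s1 \<longleftrightarrow> holds s (Count c e \<phi>) xs"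
      using I by (auto simp: I_def holds_def agree_def not_less)
    show "runs (test (Neg (Lt (Var (cnt d)) (thr c e)))) s1 2 (computes d s (holds s (Count c e \<phi>) xs))"
      using runs_test[of "Neg (Lt (Var (cnt d)) (thr c e))" s1 d] I unfolding b
      by (elim runs_mono) (auto simp: computes_def I_def intro: agree_trans)
  qed
  \<comment> \<open>The overhead \<open>3 * n + 5\<close> is covered by \<open>10 * ?T\<close>,
    because \<open>n + 10\<close> is at most \<open>?T\<close>.\<close>
  moreover have "1 + ((?n * ((?T + 1) + 2) + 2) + 2) \<le> ?X ^ cost (Count c e \<phi>)"
  proof -
    have "?X \<le> ?T" using power_ge_base[OF cost_pos] .
    then have "?n * ?T + 3 * ?n + 5 \<le> ?n * ?T + 10 * ?T" by linarith
    also have "\<dots> = ?X ^ cost (Count c e \<phi>)" by (simp add: algebra_simps)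
    finally show ?thesis by (simp add: algebra_simps)
  qed
  ultimately show ?case by (rule runs_mono) blast
qed

section \<open>The deletion rules as formulas\<close>

text \<open>In this and the following formulas, \<open>d\<close> is the number of variables in scope
  and hence the level of the next bound variable; the other arguments are levels of
  variables.\<close>

definition nle_fm :: "nat \<Rightarrow> nat \<Rightarrow> nat \<Rightarrow> fm" where
  "nle_fm d u v = FAll (FImp (Adj d u) (Adj d v))"

definition twin_fm :: "nat \<Rightarrow> nat \<Rightarrow> nat \<Rightarrow> fm" where
  "twin_fm d u v = FAnd (nle_fm d u v) (nle_fm d v u)"

definition rule_twin_fm :: "nat \<Rightarrow> nat \<Rightarrow> fm" where
  "rule_twin_fm d v = Count 2 1 (FAnd (FNot (Same d v)) (twin_fm (Suc d) d v))"

definition common_fm :: "nat \<Rightarrow> nat \<Rightarrow> nat \<Rightarrow> fm" where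
  "common_fm x w z = FAnd (Adj z x) (Adj z w)"

definition full_fm :: "nat \<Rightarrow> nat \<Rightarrow> nat \<Rightarrow> nat \<Rightarrow> fm" where
  "full_fm d x w y = FAnd (FNot (common_fm x w y)) (FAll (FImp (common_fm x w d) (Adj d y)))"

definition comp_root_fm :: "nat \<Rightarrow> nat \<Rightarrow> nat \<Rightarrow> nat \<Rightarrow> fm" where
  "comp_root_fm d x w u = FAnd
     (FAll (FImp (FAnd (Adj d u) (FNot (common_fm x w d)))
        (FAnd (full_fm (Suc d) x w d)
          (FAll (FImp (FAnd (Adj (Suc d) d) (FNot (common_fm x w (Suc d)))) (Adj (Suc d) u))))))
     (FAll (FAll (FImp
        (FAnd (Adj d u) (FAnd (FNot (common_fm x w d)) (FAnd (Adj (Suc d) u)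
          (FAnd (FNot (common_fm x w (Suc d))) (Adj d (Suc d))))))
        (FOr (nle_fm (Suc (Suc d)) d (Suc d)) (nle_fm (Suc (Suc d)) (Suc d) d)))))"

definition in_module_fm :: "nat \<Rightarrow> nat \<Rightarrow> nat \<Rightarrow> nat \<Rightarrow> fm" where
  "in_module_fm d x w y = FAnd (FNot (common_fm x w y)) (FEx (FAnd (comp_root_fm (Suc d) x w d) (Adj y d)))"

definition simplicial_fm :: "nat \<Rightarrow> nat \<Rightarrow> nat \<Rightarrow> nat \<Rightarrow> fm" where
  "simplicial_fm d x w r = FAnd (full_fm d x w r)
     (FAll (FAll (FImp (FAnd (full_fm (Suc (Suc d)) x w d) (FAnd (full_fm (Suc (Suc d)) x w (Suc d))
        (FAnd (Adj d r) (Adj (Suc d) r)))) (Adj d (Suc d)))))"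

definition first_simplicial_fm :: "nat \<Rightarrow> nat \<Rightarrow> nat \<Rightarrow> nat \<Rightarrow> fm" where
  "first_simplicial_fm d x w r = FAnd (simplicial_fm d x w r)
     (FAll (FImp (FAnd (Less d r) (Adj d r)) (FNot (simplicial_fm (Suc d) x w d))))"

definition rule_module_fm :: "nat \<Rightarrow> nat \<Rightarrow> fm" where
  "rule_module_fm d v = FEx (FEx (FAnd (FNot (Adj d (Suc d))) (FAnd (in_module_fm (Suc (Suc d)) d (Suc d) v)
     (FAnd (Count 2 2 (in_module_fm (Suc (Suc (Suc d))) d (Suc d) (Suc (Suc d))))
          (Count 2 3 (first_simplicial_fm (Suc (Suc (Suc d))) d (Suc d) (Suc (Suc d))))))))"

definition tooth_fm :: "nat \<Rightarrow> nat \<Rightarrow> nat \<Rightarrow> fm" where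
  "tooth_fm p q r = FAnd (Adj r p) (FNot (Adj r q))"

definition shaft_fm :: "nat \<Rightarrow> nat \<Rightarrow> nat \<Rightarrow> nat \<Rightarrow> fm" where
  "shaft_fm d p q c = FAnd (nle_fm d q c) (FAnd (nle_fm d c p) (FEx (FAnd (tooth_fm p q d) (FNot (Adj d c)))))"

definition comb_fm :: "nat \<Rightarrow> nat \<Rightarrow> nat \<Rightarrow> fm" where
  "comb_fm d p q = FAnd (nle_fm d q p) (FAnd
     (FAll (FAll (FImp (FAnd (shaft_fm (Suc (Suc d)) p q d) (shaft_fm (Suc (Suc d)) p q (Suc d)))
        (FOr (nle_fm (Suc (Suc d)) d (Suc d)) (nle_fm (Suc (Suc d)) (Suc d) d))))) (FAnd
     (FAll (FImp (FAnd (Adj d q) (FNot (shaft_fm (Suc d) p q d)))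
        (FOr (FAll (FImp (tooth_fm p q (Suc d)) (Adj (Suc d) d)))
            (FAll (FImp (tooth_fm p q (Suc d)) (FNot (Adj (Suc d) d))))))) (FAnd
     (FAll (FImp (tooth_fm p q d) (nle_fm (Suc d) d p)))
     (FAll (FAll (FImp (FAnd (tooth_fm p q d) (FAnd (tooth_fm p q (Suc d)) (Adj d (Suc d))))
        (FAnd (FOr (nle_fm (Suc (Suc d)) d (Suc d)) (nle_fm (Suc (Suc d)) (Suc d) d))
          (FAll (FImp (shaft_fm (Suc (Suc (Suc d))) p q (Suc (Suc d)))
            (FImp (Adj d (Suc (Suc d))) (Adj (Suc d) (Suc (Suc d)))))))))))))"

definition first_twin_fm :: "nat \<Rightarrow> nat \<Rightarrow> fm" where
  "first_twin_fm d c = FAll (FImp (Less d c) (FNot (twin_fm (Suc d) d c)))"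

definition rule_comb_fm :: "nat \<Rightarrow> nat \<Rightarrow> fm" where
  "rule_comb_fm d v = FEx (FEx (FAnd (comb_fm (Suc (Suc d)) d (Suc d)) (FAnd (shaft_fm (Suc (Suc d)) d (Suc d) v) (FAnd
     (Count 4 1 (FAnd (shaft_fm (Suc (Suc (Suc d))) d (Suc d) (Suc (Suc d)))
       (FAnd (first_twin_fm (Suc (Suc (Suc d))) (Suc (Suc d)))
       (FAnd (nle_fm (Suc (Suc (Suc d))) v (Suc (Suc d))) (FNot (nle_fm (Suc (Suc (Suc d))) (Suc (Suc d)) v))))))
     (Count 2 1 (FAnd (shaft_fm (Suc (Suc (Suc d))) d (Suc d) (Suc (Suc d)))
       (FAnd (first_twin_fm (Suc (Suc (Suc d))) (Suc (Suc d)))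
       (FAnd (nle_fm (Suc (Suc (Suc d))) (Suc (Suc d)) v) (FNot (nle_fm (Suc (Suc (Suc d))) v (Suc (Suc d))))))))))))"

definition deletable_fm :: fm where
  "deletable_fm = FOr (rule_twin_fm 1 0) (FOr (rule_module_fm 1 0) (rule_comb_fm 1 0))"

context
  fixes A :: adjacency and n k d :: nat and xs :: "nat list"
  assumes len: "length xs = d"
begin

lemma eval_nle_fm:
  "u < d \<Longrightarrow> v < d \<Longrightarrow> eval A n k (nle_fm d u v) xs \<longleftrightarrow> nle {..<n} A (xs ! u) (xs ! v)"
  by (simp add: nle_fm_def nle_def nth_append len)

lemma eval_common_fm:
  "eval A n k (common_fm x w z) xs \<longleftrightarrow> common A (xs ! x) (xs ! w) (xs ! z)"
  by (simp add: common_fm_def common_def)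

lemma eval_tooth_fm:
  "eval A n k (tooth_fm p q r) xs \<longleftrightarrow> tooth A (xs ! p) (xs ! q) (xs ! r)"
  by (simp add: tooth_fm_def tooth_def)

end

lemma eval_twin_fm:
  "length xs = d \<Longrightarrow> u < d \<Longrightarrow> v < d \<Longrightarrow>
   eval A n k (twin_fm d u v) xs \<longleftrightarrow> twin {..<n} A (xs ! u) (xs ! v)"
  by (simp add: twin_fm_def twin_def eval_nle_fm)

lemma eval_rule_twin_fm:
  "length xs = d \<Longrightarrow> v < d \<Longrightarrow>
   eval A n k (rule_twin_fm d v) xs \<longleftrightarrow> rule_twin {..<n} A k (xs ! v)"
  by (simp add: rule_twin_fm_def rule_twin_def eval_twin_fm nth_append)

lemma eval_full_fm:
  "length xs = d \<Longrightarrow> x < d \<Longrightarrow> w < d \<Longrightarrow> y < d \<Longrightarrow>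
   eval A n k (full_fm d x w y) xs \<longleftrightarrow> full {..<n} A (xs ! x) (xs ! w) (xs ! y)"
  by (simp add: full_fm_def full_def eval_common_fm nth_append)

lemma eval_comp_root_fm:
  "length xs = d \<Longrightarrow> x < d \<Longrightarrow> w < d \<Longrightarrow> u < d \<Longrightarrow>
   eval A n k (comp_root_fm d x w u) xs \<longleftrightarrow> comp_root {..<n} A (xs ! x) (xs ! w) (xs ! u)"
  by (simp add: comp_root_fm_def comp_root_def eval_common_fm eval_full_fm eval_nle_fm nth_append)

lemma eval_in_module_fm:
  "length xs = d \<Longrightarrow> x < d \<Longrightarrow> w < d \<Longrightarrow> y < d \<Longrightarrow>
   eval A n k (in_module_fm d x w y) xs \<longleftrightarrow> in_module {..<n} A (xs ! x) (xs ! w) (xs ! y)"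
  by (simp add: in_module_fm_def in_module_def eval_common_fm eval_comp_root_fm nth_append)

lemma eval_simplicial_fm:
  "length xs = d \<Longrightarrow> x < d \<Longrightarrow> w < d \<Longrightarrow> r < d \<Longrightarrow>
   eval A n k (simplicial_fm d x w r) xs \<longleftrightarrow> simplicial {..<n} A (xs ! x) (xs ! w) (xs ! r)"
  by (simp add: simplicial_fm_def simplicial_def eval_full_fm nth_append)

lemma eval_first_simplicial_fm:
  "length xs = d \<Longrightarrow> x < d \<Longrightarrow> w < d \<Longrightarrow> r < d \<Longrightarrow>
   eval A n k (first_simplicial_fm d x w r) xs \<longleftrightarrow> first_simplicial {..<n} A (xs ! x) (xs ! w) (xs ! r)"
  by (simp add: first_simplicial_fm_def first_simplicial_def eval_simplicial_fm nth_append)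

lemma eval_rule_module_fm:
  "length xs = d \<Longrightarrow> v < d \<Longrightarrow>
   eval A n k (rule_module_fm d v) xs \<longleftrightarrow> rule_module {..<n} A k (xs ! v)"
  by (simp add: rule_module_fm_def rule_module_def eval_in_module_fm eval_first_simplicial_fm nth_append)

lemma eval_shaft_fm:
  "length xs = d \<Longrightarrow> p < d \<Longrightarrow> q < d \<Longrightarrow> c < d \<Longrightarrow>
   eval A n k (shaft_fm d p q c) xs \<longleftrightarrow> shaft {..<n} A (xs ! p) (xs ! q) (xs ! c)"
  by (simp add: shaft_fm_def shaft_def eval_nle_fm eval_tooth_fm nth_append)

lemma eval_comb_fm:
  "length xs = d \<Longrightarrow> p < d \<Longrightarrow> q < d \<Longrightarrow>
   eval A n k (comb_fm d p q) xs \<longleftrightarrow> comb {..<n} A (xs ! p) (xs ! q)"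
  by (simp add: comb_fm_def comb_def eval_nle_fm eval_tooth_fm eval_shaft_fm nth_append)

lemma eval_first_twin_fm:
  "length xs = d \<Longrightarrow> c < d \<Longrightarrow>
   eval A n k (first_twin_fm d c) xs \<longleftrightarrow> first_twin {..<n} A (xs ! c)"
  by (simp add: first_twin_fm_def first_twin_def eval_twin_fm nth_append)

lemma eval_rule_comb_fm:
  "length xs = d \<Longrightarrow> v < d \<Longrightarrow>
   eval A n k (rule_comb_fm d v) xs \<longleftrightarrow> rule_comb {..<n} A k (xs ! v)"
  by (simp add: rule_comb_fm_def rule_comb_def eval_comb_fm eval_shaft_fm eval_first_twin_fm
      eval_nle_fm nth_append)

lemma eval_deletable_fm: "eval A n k deletable_fm [v] \<longleftrightarrow> deletable {..<n} A k v"
  by (simp add: deletable_fm_def deletable_def eval_rule_twin_fm eval_rule_module_fm eval_rule_comb_fm)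

lemma scoped_deletable_fm: "scoped deletable_fm 1"
  by (simp add: deletable_fm_def rule_twin_fm_def rule_module_fm_def rule_comb_fm_def twin_fm_def
      nle_fm_def in_module_fm_def common_fm_def comp_root_fm_def full_fm_def first_simplicial_fm_def
      simplicial_fm_def comb_fm_def shaft_fm_def tooth_fm_def first_twin_fm_def)

section \<open>The kernelization program\<close>

text \<open>The diagonal is kept at zero for the output format, while \<open>madj\<close> makes
  adjacency reflexive by itself.\<close>

definition valid :: "state \<Rightarrow> bool" where
  "valid s \<longleftrightarrow> (\<forall>i<reg s ''n''. \<forall>j<reg s ''n''. arr s ''adj'' i j \<le> 1 \<and>
     arr s ''adj'' i j = arr s ''adj'' j i \<and> arr s ''adj'' i i = 0)"

definition solvable :: "state \<Rightarrow> bool" where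
  "solvable s \<longleftrightarrow> editable {..<reg s ''n''} (madj s) (reg s ''k'')"

definition removable :: "state \<Rightarrow> nat \<Rightarrow> bool" where
  "removable s v \<longleftrightarrow> deletable {..<reg s ''n''} (madj s) (reg s ''k'') v"

definition reduced :: "state \<Rightarrow> bool" where
  "reduced s \<longleftrightarrow> (\<forall>v<reg s ''n''. \<not> removable s v)"

lemma rgraph_madj: "valid s \<Longrightarrow> rgraph {..<reg s ''n''} (madj s)"
  by (auto simp: rgraph_def madj_def valid_def)

section \<open>Finding and deleting one vertex\<close>

text \<open>There is no jump out of a loop, so the flag \<open>f\<close> turns the remaining rounds
  into no-ops. The loop counter is the register of the free variable of \<open>deletable_fm\<close>;
  compilation at depth \<open>1\<close> preserves it.\<close>

definition find_vertex :: com where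
  "find_vertex = Seq (Assign ''f'' (Const 0))
     (For (var 0) (Var ''n'')
       (Cond (Eq (Var ''f'') (Const 0))
         (Seq (compile deletable_fm 1)
           (Cond (Eq (Var ''res'') (Const 1))
             (Seq (Assign ''f'' (Const 1)) (Assign ''u'' (Var (var 0))))
             Skip))
         Skip))"

definition find_time :: "nat \<Rightarrow> nat" where
  "find_time n = 1 + (n * (((n + 10) ^ cost deletable_fm + (2 + 1) + 1) + 2) + 2)"

lemma runs_find_vertex:
  "runs find_vertex s (find_time (reg s ''n''))
     (\<lambda>s'. arr s' = arr s \<and> (\<forall>x. x \<notin> scratch 0 \<union> {''f'', ''u''} \<longrightarrow> reg s' x = reg s x) \<and>
        (reg s' ''f'' = 0 \<and> reduced s \<or>
         reg s' ''f'' = 1 \<and> reg s' ''u'' < reg s ''n'' \<and> removable s (reg s' ''u'')))"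
proof -
  let ?n = "reg s ''n''"
  let ?T = "(?n + 10) ^ cost deletable_fm"
  define I where "I i s' \<longleftrightarrow> arr s' = arr s \<and>
      (\<forall>x. x \<notin> scratch 0 \<union> {''f'', ''u''} \<longrightarrow> reg s' x = reg s x) \<and> reg s' (var 0) = i \<and>
      (reg s' ''f'' = 0 \<and> (\<forall>v<i. \<not> removable s v) \<or>
       reg s' ''f'' = 1 \<and> reg s' ''u'' < ?n \<and> removable s (reg s' ''u''))" for i :: nat and s' :: state
  let ?R = "\<lambda>i s'. reg s' (var 0) = i \<and> I (Suc i) (set_reg (var 0) (Suc i) s')"
  let ?mark = "Seq (Assign ''f'' (Const 1)) (Assign ''u'' (Var (var 0)))"
  let ?search = "Seq (compile deletable_fm 1) (Cond (Eq (Var ''res'') (Const 1)) ?mark Skip)"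
  have "runs find_vertex s (find_time ?n) (I ?n)"
    unfolding find_vertex_def find_time_def
  proof (rule runs_Seq, rule runs_Assign, rule refl, rule runs_For)
    fix s0 assume s0: "s0 = set_reg ''f'' (aval (Const 0) s) s"
    show "I 0 (set_reg (var 0) 0 s0)" by (auto simp: I_def s0)
    fix i s1 assume i: "i < ?n" and I: "I i s1"
    have eqs: "arr s1 = arr s" "\<And>x. x \<notin> scratch 0 \<union> {''f'', ''u''} \<Longrightarrow> reg s1 x = reg s x"
      using I unfolding I_def by blast+
    have n1: "reg s1 ''n'' = ?n" "reg s1 ''k'' = reg s ''k''" "madj s1 = madj s"
      using eqs(2)[of "''n''"] eqs(2)[of "''k''"] by (simp_all add: madj_def[abs_def] eqs(1))
    have upd: "I (Suc i) (set_reg (var 0) (Suc i) s3)"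
      if s3: "arr s3 = arr s" "\<And>x. x \<notin> scratch 0 \<union> {''f'', ''u''} \<Longrightarrow> reg s3 x = reg s x"
        "reg s3 ''f'' = 0 \<and> (\<forall>v<Suc i. \<not> removable s v) \<or>
         reg s3 ''f'' = 1 \<and> reg s3 ''u'' < ?n \<and> removable s (reg s3 ''u'')" for s3
      unfolding I_def
    proof (intro conjI allI impI)
      fix x assume x: "x \<notin> scratch 0 \<union> {''f'', ''u''}"
      then have "x \<noteq> var 0" by auto
      then show "reg (set_reg (var 0) (Suc i) s3) x = reg s x" using s3(2)[OF x] by simp
    qed (use s3(1,3) in simp_all)
    show "runs (Cond (Eq (Var ''f'') (Const 0)) ?search Skip) s1 (?T + (2 + 1) + 1)
       (?R i)"
    proof (rule runs_Cond)
      assume "bval (Eq (Var ''f'') (Const 0)) s1"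
      then have f: "reg s1 ''f'' = 0" "\<forall>v<i. \<not> removable s v" using I by (auto simp: I_def)
      have h: "holds s1 deletable_fm [i] \<longleftrightarrow> removable s i"
        by (simp add: holds_def n1 eval_deletable_fm removable_def)
      show "runs ?search s1 (?T + (2 + 1))
         (?R i)"
      proof (rule runs_Seq)
        have "runs (compile deletable_fm 1) s1 ((reg s1 ''n'' + 10) ^ cost deletable_fm)
            (computes 1 s1 (holds s1 deletable_fm [i]))"
          by (rule runs_compile[OF scoped_deletable_fm]) (use I in \<open>auto simp: I_def\<close>)
        then show "runs (compile deletable_fm 1) s1 ?T (computes 1 s1 (removable s i))"
          by (simp add: h n1)
        fix s2 assume s2: "computes 1 s1 (removable s i) s2"
        then have ag: "arr s2 = arr s" "reg s2 (var 0) = i" "reg s2 ''f'' = 0"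
          "\<And>x. x \<notin> scratch 0 \<union> {''f'', ''u''} \<Longrightarrow> reg s2 x = reg s x"
          using I f scratch_Suc[of 0] by (auto simp: computes_def agree_def I_def)
        have res: "reg s2 ''res'' = of_bool (removable s i)" using s2 by (simp add: computes_def)
        show "runs (Cond (Eq (Var ''res'') (Const 1)) ?mark Skip) s2 (2 + 1)
           (?R i)"
        proof (rule runs_Cond)
          assume "bval (Eq (Var ''res'') (Const 1)) s2"
          then have r: "removable s i" using res by (cases "removable s i") simp_all
          have "runs ?mark s2 (1 + 1)
              (?R i)"
          proof (rule runs_Seq, rule runs_Assign, rule refl, rule runs_Assign, rule conjI)
            let ?s3 = "set_reg ''f'' (aval (Const 1) s2) s2"
            let ?s4 = "set_reg ''u'' (aval (Var (var 0)) ?s3) ?s3"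
            fix s3 assume s3: "s3 = ?s3"
            show "reg (set_reg ''u'' (aval (Var (var 0)) s3) s3) (var 0) = i" using ag(2) s3 by simp
            have "I (Suc i) (set_reg (var 0) (Suc i) ?s4)"
            proof (rule upd)
              fix x assume x: "x \<notin> scratch 0 \<union> {''f'', ''u''}"
              then have "x \<noteq> ''f''" "x \<noteq> ''u''" by auto
              then show "reg ?s4 x = reg s x" using ag(4)[OF x] by simp
            qed (use ag(1,2) r i in simp_all)
            then show "I (Suc i) (set_reg (var 0) (Suc i) (set_reg ''u'' (aval (Var (var 0)) s3) s3))"
              using s3 by simp
          qed
          then show "runs ?mark s2 2
              (?R i)"
            by (simp add: numeral_2_eq_2)
        next
          assume "\<not> bval (Eq (Var ''res'') (Const 1)) s2"
          then have r: "\<not> removable s i" using res by (cases "removable s i") simp_all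
          have "runs Skip s2 1 (?R i)"
            by (intro runs_Skip conjI ag(2) upd ag(1,4)) (use ag(3) r f in \<open>auto simp: less_Suc_eq\<close>)
          then show "runs Skip s2 2 (?R i)"
            by (rule runs_mono) auto
        qed
      qed
    next
      assume "\<not> bval (Eq (Var ''f'') (Const 0)) s1"
      then have "reg s1 ''f'' = 1 \<and> reg s1 ''u'' < ?n \<and> removable s (reg s1 ''u'')" "reg s1 (var 0) = i"
        using I unfolding I_def by auto
      then have "runs Skip s1 1 (?R i)"
        by (intro runs_Skip conjI upd eqs) auto
      then show "runs Skip s1 (?T + (2 + 1)) (?R i)"
        by (rule runs_mono) auto
    qed
  next
    fix i s1 assume "I i s1"
    then show "reg s1 (var 0) = i \<and> aval (Var ''n'') s1 = ?n" by (simp add: I_def)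
  qed
  then show ?thesis by (rule runs_mono) (auto simp: I_def reduced_def)
qed

text \<open>The last vertex takes the place of the deleted vertex.\<close>

definition delete_vertex :: com where
  "delete_vertex =
     Seq (For ''i'' (Var ''n'')
           (Store ''adj'' (Var ''u'') (Var ''i'') (Read ''adj'' (Sub (Var ''n'') (Const 1)) (Var ''i''))))
    (Seq (For ''i'' (Var ''n'')
           (Store ''adj'' (Var ''i'') (Var ''u'') (Read ''adj'' (Var ''i'') (Sub (Var ''n'') (Const 1)))))
         (Assign ''n'' (Sub (Var ''n'') (Const 1))))"

definition delete_time :: "nat \<Rightarrow> nat" where
  "delete_time n = (n * (1 + 2) + 2) + ((n * (1 + 2) + 2) + 1)"

lemma runs_delete_vertex:
  fixes s
  defines "n \<equiv> reg s ''n''" and "u \<equiv> reg s ''u''"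
  defines "\<sigma> \<equiv> \<lambda>i. if i = u then n - 1 else i"
  shows "runs delete_vertex s (delete_time n)
     (\<lambda>s'. reg s' = (reg s)(''i'' := n, ''n'' := n - 1) \<and>
        (\<forall>i<n. \<forall>j<n. arr s' ''adj'' i j = arr s ''adj'' (\<sigma> i) (\<sigma> j)))"
proof -
  let ?M = "arr s ''adj''"
  \<comment> \<open>\<open>M1 m\<close> and \<open>M2 m\<close> are the matrix after
    \<open>m\<close> rounds of the row copy and of the column copy. The second pass reads the
    updated rows, so the diagonal entry at \<open>u\<close> becomes the one at
    \<open>n - 1\<close>.\<close>
  define M1 where "M1 m r c = (if r = u \<and> c < m then ?M (n - 1) c else ?M r c)" for m r c
  define M2 where "M2 m r c = (if c = u \<and> r < m then M1 n r (n - 1) else M1 n r c)" for m r c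
  define I1 where "I1 m s' \<longleftrightarrow> reg s' = (reg s)(''i'' := m) \<and> arr s' ''adj'' = M1 m" for m :: nat and s' :: state
  define I2 where "I2 m s' \<longleftrightarrow> reg s' = (reg s)(''i'' := m) \<and> arr s' ''adj'' = M2 m" for m :: nat and s' :: state
  show ?thesis unfolding delete_vertex_def delete_time_def
  proof (rule runs_Seq)
    show "runs (For ''i'' (Var ''n'')
           (Store ''adj'' (Var ''u'') (Var ''i'') (Read ''adj'' (Sub (Var ''n'') (Const 1)) (Var ''i''))))
          s (n * (1 + 2) + 2) (I1 n)"
    proof (rule runs_For)
      have "?M = M1 0" by (intro ext) (simp add: M1_def)
      then show "I1 0 (set_reg ''i'' 0 s)" by (simp add: I1_def)
      fix i s1 assume "i < n" and I: "I1 i s1"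
      have "(M1 i)(u := (M1 i u)(i := M1 i (n - 1) i)) = M1 (Suc i)"
        by (intro ext) (auto simp: M1_def)
      then show "runs (Store ''adj'' (Var ''u'') (Var ''i'') (Read ''adj'' (Sub (Var ''n'') (Const 1)) (Var ''i''))) s1 1
         (\<lambda>s'. reg s' ''i'' = i \<and> I1 (Suc i) (set_reg ''i'' (Suc i) s'))"
        using I by (intro runs_Store) (auto simp: I1_def n_def[symmetric] u_def[symmetric])
    next
      fix i s1 assume "I1 i s1"
      then show "reg s1 ''i'' = i \<and> aval (Var ''n'') s1 = n" by (simp add: I1_def n_def)
    qed
    fix s1 assume s1: "I1 n s1"
    show "runs (Seq (For ''i'' (Var ''n'')
           (Store ''adj'' (Var ''i'') (Var ''u'') (Read ''adj'' (Var ''i'') (Sub (Var ''n'') (Const 1)))))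
         (Assign ''n'' (Sub (Var ''n'') (Const 1)))) s1 ((n * (1 + 2) + 2) + 1)
        (\<lambda>s'. reg s' = (reg s)(''i'' := n, ''n'' := n - 1) \<and>
          (\<forall>i<n. \<forall>j<n. arr s' ''adj'' i j = arr s ''adj'' (\<sigma> i) (\<sigma> j)))"
    proof (rule runs_Seq)
      show "runs (For ''i'' (Var ''n'')
           (Store ''adj'' (Var ''i'') (Var ''u'') (Read ''adj'' (Var ''i'') (Sub (Var ''n'') (Const 1)))))
          s1 (n * (1 + 2) + 2) (I2 n)"
      proof (rule runs_For)
        have "M1 n = M2 0" by (intro ext) (simp add: M2_def)
        then show "I2 0 (set_reg ''i'' 0 s1)" using s1 by (simp add: I1_def I2_def)
        fix i s2 assume "i < n" and I: "I2 i s2"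
        have "(M2 i)(i := (M2 i i)(u := M2 i i (n - 1))) = M2 (Suc i)"
          by (intro ext) (auto simp: M2_def)
        then show "runs (Store ''adj'' (Var ''i'') (Var ''u'') (Read ''adj'' (Var ''i'') (Sub (Var ''n'') (Const 1)))) s2 1
           (\<lambda>s'. reg s' ''i'' = i \<and> I2 (Suc i) (set_reg ''i'' (Suc i) s'))"
          using I by (intro runs_Store) (auto simp: I2_def n_def[symmetric] u_def[symmetric])
      next
        fix i s2 assume "I2 i s2"
        then show "reg s2 ''i'' = i \<and> aval (Var ''n'') s2 = n" by (simp add: I2_def n_def)
      qed
      fix s2 assume s2: "I2 n s2"
      have "M2 n i j = ?M (\<sigma> i) (\<sigma> j)" if "i < n" "j < n" for i j
        using that by (auto simp: M2_def M1_def \<sigma>_def)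
      then show "runs (Assign ''n'' (Sub (Var ''n'') (Const 1))) s2 1
          (\<lambda>s'. reg s' = (reg s)(''i'' := n, ''n'' := n - 1) \<and>
          (\<forall>i<n. \<forall>j<n. arr s' ''adj'' i j = arr s ''adj'' (\<sigma> i) (\<sigma> j)))"
        using s2 by (intro runs_Assign) (auto simp: I2_def n_def)
    qed
  qed
qed

definition reduce_step :: com where
  "reduce_step = Seq find_vertex (Cond (Eq (Var ''f'') (Const 1)) delete_vertex Skip)"

definition step_time :: "nat \<Rightarrow> nat" where
  "step_time n = find_time n + (delete_time n + 1)"

lemma runs_reduce_step:
  assumes val: "valid s"
  shows "runs reduce_step s (step_time (reg s ''n''))
     (\<lambda>s'. valid s' \<and> (solvable s' \<longleftrightarrow> solvable s) \<and>
        (\<forall>x\<in>{''k'', ''m'', ''j''}. reg s' x = reg s x) \<and>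
        (reduced s' \<and> reg s' ''n'' = reg s ''n'' \<or> \<not> reduced s \<and> Suc (reg s' ''n'') = reg s ''n''))"
  unfolding reduce_step_def step_time_def
proof (rule runs_Seq[OF runs_find_vertex])
  let ?n = "reg s ''n''"
  let ?Q = "\<lambda>s'. valid s' \<and> (solvable s' \<longleftrightarrow> solvable s) \<and>
        (\<forall>x\<in>{''k'', ''m'', ''j''}. reg s' x = reg s x) \<and>
        (reduced s' \<and> reg s' ''n'' = ?n \<or> \<not> reduced s \<and> Suc (reg s' ''n'') = ?n)"
  fix s1 :: state assume s1: "arr s1 = arr s \<and> (\<forall>x. x \<notin> scratch 0 \<union> {''f'', ''u''} \<longrightarrow> reg s1 x = reg s x) \<and>
        (reg s1 ''f'' = 0 \<and> reduced s \<or>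
         reg s1 ''f'' = 1 \<and> reg s1 ''u'' < ?n \<and> removable s (reg s1 ''u''))"
  have r1: "reg s1 ''n'' = ?n" "\<forall>x\<in>{''k'', ''m'', ''j''}. reg s1 x = reg s x" "arr s1 = arr s"
    using s1 by auto
  have m1: "madj s1 = madj s" using r1 by (simp add: madj_def[abs_def])
  show "runs (Cond (Eq (Var ''f'') (Const 1)) delete_vertex Skip) s1 (delete_time ?n + 1) ?Q"
  proof (rule runs_Cond)
    assume "bval (Eq (Var ''f'') (Const 1)) s1"
    then have u: "reg s1 ''u'' < ?n" "removable s (reg s1 ''u'')" using s1 by auto
    define v where "v = reg s1 ''u''"
    define \<sigma> where "\<sigma> i = (if i = v then ?n - 1 else i)" for i
    have "runs delete_vertex s1 (delete_time ?n)
       (\<lambda>s'. reg s' = (reg s1)(''i'' := ?n, ''n'' := ?n - 1) \<and>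
        (\<forall>i<?n. \<forall>j<?n. arr s' ''adj'' i j = arr s ''adj'' (\<sigma> i) (\<sigma> j)))"
      using runs_delete_vertex[of s1] unfolding r1 v_def[symmetric] \<sigma>_def .
    then show "runs delete_vertex s1 (delete_time ?n) ?Q"
    proof (rule runs_mono[OF _ order_refl])
      fix s' :: state assume s': "reg s' = (reg s1)(''i'' := ?n, ''n'' := ?n - 1) \<and>
        (\<forall>i<?n. \<forall>j<?n. arr s' ''adj'' i j = arr s ''adj'' (\<sigma> i) (\<sigma> j))"
      then have n': "reg s' ''n'' = ?n - 1" "reg s' ''k'' = reg s ''k''" using r1 by auto
      have a': "arr s' ''adj'' i j = arr s ''adj'' (\<sigma> i) (\<sigma> j)" if "i < ?n - 1" "j < ?n - 1" for i j
        using s' that by simp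
      have \<sigma>n: "\<sigma> i < ?n" if "i < ?n - 1" for i using that by (auto simp: \<sigma>_def)
      have val': "valid s'"
        unfolding valid_def n'
      proof (intro allI impI)
        fix i j assume ij: "i < ?n - 1" "j < ?n - 1"
        show "arr s' ''adj'' i j \<le> 1 \<and> arr s' ''adj'' i j = arr s' ''adj'' j i \<and> arr s' ''adj'' i i = 0"
          using val[unfolded valid_def, rule_format, OF \<sigma>n[OF ij(1)] \<sigma>n[OF ij(2)]]
          by (simp add: a'[OF ij] a'[OF ij(2,1)] a'[OF ij(1,1)])
      qed
      \<comment> \<open>This includes the case that \<open>v\<close> is the last index, where
        \<sigma> is the identity on the smaller range.\<close>
      have bij: "bij_betw \<sigma> {..<?n - 1} ({..<?n} - {v})"
      proof (rule bij_betw_imageI)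
        show "inj_on \<sigma> {..<?n - 1}" by (auto simp: inj_on_def \<sigma>_def split: if_splits)
        show "\<sigma> ` {..<?n - 1} = {..<?n} - {v}"
        proof
          show "\<sigma> ` {..<?n - 1} \<subseteq> {..<?n} - {v}" using u(1) by (auto simp: \<sigma>_def v_def)
          show "{..<?n} - {v} \<subseteq> \<sigma> ` {..<?n - 1}"
          proof
            fix w assume w: "w \<in> {..<?n} - {v}"
            show "w \<in> \<sigma> ` {..<?n - 1}"
            proof (cases "w = ?n - 1")
              case True
              then have "v < ?n - 1" using w u(1) by (auto simp: v_def)
              then show ?thesis using True by (intro image_eqI[of _ _ v]) (auto simp: \<sigma>_def)
            next
              case False
              then show ?thesis using w by (intro image_eqI[of _ _ w]) (auto simp: \<sigma>_def)
            qed
          qed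
        qed
      qed
      have mm: "madj s' i j \<longleftrightarrow> madj s (\<sigma> i) (\<sigma> j)" if "i \<in> {..<?n - 1}" "j \<in> {..<?n - 1}" for i j
      proof -
        have "\<sigma> i = \<sigma> j \<longleftrightarrow> i = j"
          using bij that by (metis bij_betw_def inj_on_def)
        then show ?thesis using a' that by (simp add: madj_def)
      qed
      have "solvable s' \<longleftrightarrow> editable ({..<?n} - {v}) (madj s) (reg s ''k'')"
        unfolding solvable_def n' by (rule editable_cong_bij[OF bij]) (simp, rule mm)
      also have "\<dots> \<longleftrightarrow> solvable s"
        unfolding solvable_def
        by (rule deletable_safe[OF rgraph_madj[OF val]]) (use u in \<open>auto simp: v_def removable_def\<close>)
      finally have "solvable s' \<longleftrightarrow> solvable s" .
      moreover note val'
      moreover have "\<forall>x\<in>{''k'', ''m'', ''j''}. reg s' x = reg s x" using s' r1 by auto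
      moreover have "\<not> reduced s \<and> Suc (reg s' ''n'') = ?n"
        using n' u by (auto simp: reduced_def)
      ultimately show "?Q s'" by blast
    qed
  next
    assume "\<not> bval (Eq (Var ''f'') (Const 1)) s1"
    then have red: "reduced s" using s1 by auto
    have "valid s1" using val r1 by (simp add: valid_def)
    moreover have "solvable s1 \<longleftrightarrow> solvable s" using r1 m1 by (simp add: solvable_def)
    moreover have "reduced s1" using red r1 m1 by (simp add: reduced_def removable_def)
    ultimately have "runs Skip s1 1 ?Q" using r1 by (intro runs_Skip) auto
    then show "runs Skip s1 (delete_time ?n) ?Q"
      by (rule runs_mono) (auto simp: delete_time_def)
  qed
qed

section \<open>Exhaustive reduction\<close>

text \<open>\<open>m\<close> keeps the initial number of vertices, since \<open>n\<close> shrinks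
  inside the loop whose bound has to stay constant.\<close>

definition reduce :: com where
  "reduce = Seq (Assign ''m'' (Var ''n'')) (For ''j'' (Var ''m'') reduce_step)"

lemma step_time_mono: "n \<le> n' \<Longrightarrow> step_time n \<le> step_time n'"
  unfolding step_time_def find_time_def delete_time_def
  by (intro add_mono mult_le_mono power_mono order_refl) auto

lemma runs_reduce:
  assumes val: "valid s"
  shows "runs reduce s (1 + (reg s ''n'' * (step_time (reg s ''n'') + 2) + 2))
     (\<lambda>s'. valid s' \<and> (solvable s' \<longleftrightarrow> solvable s) \<and> reduced s' \<and> reg s' ''k'' = reg s ''k'')"
proof -
  let ?n = "reg s ''n''"
  \<comment> \<open>A round deletes a vertex unless the graph is already reduced. If all
    \<open>?n\<close> rounds delete, no vertices remain, and the empty graph is reduced.\<close>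
  define I where "I i s' \<longleftrightarrow> valid s' \<and> (solvable s' \<longleftrightarrow> solvable s) \<and> reg s' ''k'' = reg s ''k'' \<and>
    reg s' ''m'' = ?n \<and> reg s' ''j'' = i \<and> reg s' ''n'' \<le> ?n \<and> (reduced s' \<or> reg s' ''n'' + i \<le> ?n)" for i s'
  have upd: "valid (set_reg x c s') = valid s'" "solvable (set_reg x c s') = solvable s'"
    "reduced (set_reg x c s') = reduced s'" if "x \<notin> {''n'', ''k''}" for x c s'
    using that by (auto simp: valid_def solvable_def reduced_def removable_def madj_def[abs_def])
  have "runs reduce s (1 + (?n * (step_time ?n + 2) + 2)) (I ?n)"
    unfolding reduce_def
  proof (rule runs_Seq, rule runs_Assign, rule refl, rule runs_For)
    fix s0 assume s0: "s0 = set_reg ''m'' (aval (Var ''n'') s) s"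
    show "I 0 (set_reg ''j'' 0 s0)" using val by (simp add: I_def s0 upd)
    fix i s1 assume i: "i < ?n" and I: "I i s1"
    have "runs reduce_step s1 (step_time (reg s1 ''n''))
     (\<lambda>s'. valid s' \<and> (solvable s' \<longleftrightarrow> solvable s1) \<and>
        (\<forall>x\<in>{''k'', ''m'', ''j''}. reg s' x = reg s1 x) \<and>
        (reduced s' \<and> reg s' ''n'' = reg s1 ''n'' \<or> \<not> reduced s1 \<and> Suc (reg s' ''n'') = reg s1 ''n''))"
      by (rule runs_reduce_step) (use I in \<open>simp add: I_def\<close>)
    moreover have "step_time (reg s1 ''n'') \<le> step_time ?n"
      by (rule step_time_mono) (use I in \<open>simp add: I_def\<close>)
    ultimately show "runs reduce_step s1 (step_time ?n)
        (\<lambda>s'. reg s' ''j'' = i \<and> I (Suc i) (set_reg ''j'' (Suc i) s'))"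
      using I by (elim runs_mono) (auto simp: I_def upd)
  next
    fix i s1 assume "I i s1"
    then show "reg s1 ''j'' = i \<and> aval (Var ''m'') s1 = ?n" by (simp add: I_def)
  qed
  then show ?thesis by (rule runs_mono) (auto simp: I_def reduced_def)
qed

section \<open>Computing the size bound without multiplication\<close>

text \<open>Nested loops replace multiplication: running a program that adds \<open>w k\<close> to
  \<open>b\<close> for \<open>k + 1\<close> rounds adds \<open>(k + 1) * w k\<close>.
  \<open>X\<close> lists the other registers that may change.\<close>

definition adds :: "com \<Rightarrow> vname set \<Rightarrow> (nat \<Rightarrow> nat) \<Rightarrow> (nat \<Rightarrow> nat) \<Rightarrow> bool" where
  "adds c X w T \<longleftrightarrow> (\<forall>s. runs c s (T (reg s ''k'')) (\<lambda>s'. arr s' = arr s \<and>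
     reg s' ''b'' = reg s ''b'' + w (reg s ''k'') \<and> (\<forall>x. x \<notin> insert ''b'' X \<longrightarrow> reg s' x = reg s x)))"

lemma adds_For:
  assumes c: "adds c X w T" and x: "x \<notin> X" "x \<noteq> ''b''" "x \<noteq> ''k''" "''k'' \<notin> X" "''b'' \<notin> X"
  shows "adds (For x (Add (Var ''k'') (Const 1)) c) (insert x X)
    (\<lambda>k. (k + 1) * w k) (\<lambda>k. (k + 1) * (T k + 2) + 2)"
  unfolding adds_def
proof
  fix s :: state
  let ?k = "reg s ''k''"
  define I where "I i s' \<longleftrightarrow> arr s' = arr s \<and> reg s' ''b'' = reg s ''b'' + i * w ?k \<and> reg s' x = i \<and>
    (\<forall>y. y \<notin> insert ''b'' (insert x X) \<longrightarrow> reg s' y = reg s y)" for i :: nat and s' :: state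
  have "runs (For x (Add (Var ''k'') (Const 1)) c) s ((?k + 1) * (T ?k + 2) + 2) (I (?k + 1))"
  proof (rule runs_For)
    show "I 0 (set_reg x 0 s)" using x by (simp add: I_def)
    fix i s1 assume I: "I i s1"
    have k1: "reg s1 ''k'' = ?k" using I x unfolding I_def by auto
    have "runs c s1 (T (reg s1 ''k'')) (\<lambda>s'. arr s' = arr s1 \<and>
      reg s' ''b'' = reg s1 ''b'' + w (reg s1 ''k'') \<and> (\<forall>y. y \<notin> insert ''b'' X \<longrightarrow> reg s' y = reg s1 y))"
      using c unfolding adds_def by blast
    then show "runs c s1 (T ?k) (\<lambda>s'. reg s' x = i \<and> I (Suc i) (set_reg x (Suc i) s'))"
      unfolding k1
    proof (rule runs_mono[OF _ order_refl])
      fix s2 :: state assume s2: "arr s2 = arr s1 \<and> reg s2 ''b'' = reg s1 ''b'' + w ?k \<and>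
        (\<forall>y. y \<notin> insert ''b'' X \<longrightarrow> reg s2 y = reg s1 y)"
      then have "reg s2 x = i" using I x unfolding I_def by auto
      moreover have "I (Suc i) (set_reg x (Suc i) s2)" unfolding I_def
      proof (intro conjI allI impI)
        show "arr (set_reg x (Suc i) s2) = arr s" using s2 I by (simp add: I_def)
        show "reg (set_reg x (Suc i) s2) ''b'' = reg s ''b'' + Suc i * w ?k"
          using s2 I x by (simp add: I_def)
        fix y assume y: "y \<notin> insert ''b'' (insert x X)"
        then have "reg s2 y = reg s1 y" using s2 by auto
        also have "\<dots> = reg s y" using I y unfolding I_def by blast
        finally show "reg (set_reg x (Suc i) s2) y = reg s y" using y by simp
      qed simp
      ultimately show "reg s2 x = i \<and> I (Suc i) (set_reg x (Suc i) s2)" by blast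
    qed
  next
    fix i s1 assume I: "I i s1"
    then show "reg s1 x = i \<and> aval (Add (Var ''k'') (Const 1)) s1 = ?k + 1"
      using x unfolding I_def by auto
  qed
  then show "runs (For x (Add (Var ''k'') (Const 1)) c) s ((?k + 1) * (T ?k + 2) + 2)
    (\<lambda>s'. arr s' = arr s \<and> reg s' ''b'' = reg s ''b'' + (?k + 1) * w ?k \<and>
      (\<forall>y. y \<notin> insert ''b'' (insert x X) \<longrightarrow> reg s' y = reg s y))"
    by (rule runs_mono) (auto simp: I_def)
qed

definition size_bound :: com where
  "size_bound = Seq (Assign ''b'' (Const 0))
     (For ''x'' (Add (Var ''k'') (Const 1)) (For ''y'' (Add (Var ''k'') (Const 1))
       (For ''z'' (Add (Var ''k'') (Const 1)) (Assign ''b'' (Add (Var ''b'') (Const 240))))))"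

definition bound_time :: "nat \<Rightarrow> nat" where
  "bound_time k = 1 + ((k + 1) * (((k + 1) * (((k + 1) * (1 + 2) + 2) + 2) + 2) + 2) + 2)"

lemma runs_size_bound:
  "runs size_bound s (bound_time (reg s ''k'')) (\<lambda>s'. arr s' = arr s \<and>
     reg s' ''b'' = 240 * (reg s ''k'' + 1) ^ 3 \<and> reg s' ''n'' = reg s ''n'' \<and> reg s' ''k'' = reg s ''k'')"
  unfolding size_bound_def bound_time_def
proof (rule runs_Seq, rule runs_Assign, rule refl)
  fix s0 assume s0: "s0 = set_reg ''b'' (aval (Const 0) s) s"
  let ?k1 = "Add (Var ''k'') (Const 1)"
  let ?c = "For ''x'' ?k1 (For ''y'' ?k1 (For ''z'' ?k1 (Assign ''b'' (Add (Var ''b'') (Const 240)))))"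
  let ?T = "\<lambda>k :: nat. (k + 1) * (((k + 1) * (((k + 1) * (1 + 2) + 2) + 2) + 2) + 2) + 2"
  let ?w = "\<lambda>k :: nat. (k + 1) * ((k + 1) * ((k + 1) * 240))"
  have "adds (Assign ''b'' (Add (Var ''b'') (Const 240))) {} (\<lambda>_. 240) (\<lambda>_. 1)"
    unfolding adds_def by (intro allI runs_Assign) simp
  then have "adds ?c
     {''x'', ''y'', ''z''} ?w ?T"
    by (intro adds_For) simp_all
  then have r: "runs ?c s0
     (?T (reg s0 ''k''))
     (\<lambda>s'. arr s' = arr s0 \<and> reg s' ''b'' = reg s0 ''b'' + ?w (reg s0 ''k'') \<and>
       (\<forall>x. x \<notin> {''b'', ''x'', ''y'', ''z''} \<longrightarrow> reg s' x = reg s0 x))"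
    unfolding adds_def by blast
  have k0: "reg s0 ''k'' = reg s ''k''" by (simp add: s0)
  show "runs ?c s0
     (?T (reg s ''k''))
     (\<lambda>s'. arr s' = arr s \<and> reg s' ''b'' = 240 * (reg s ''k'' + 1) ^ 3 \<and>
        reg s' ''n'' = reg s ''n'' \<and> reg s' ''k'' = reg s ''k'')"
  proof (rule runs_mono[OF r])
    show "?T (reg s0 ''k'')
      \<le> ?T (reg s ''k'')"
      by (simp only: k0)
    fix s' :: state assume s': "arr s' = arr s0 \<and> reg s' ''b'' = reg s0 ''b'' + ?w (reg s0 ''k'') \<and>
       (\<forall>x. x \<notin> {''b'', ''x'', ''y'', ''z''} \<longrightarrow> reg s' x = reg s0 x)"
    have "?w (reg s0 ''k'') = 240 * (reg s ''k'' + 1) ^ 3"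
      by (simp only: k0 power3_eq_cube mult.assoc mult.commute[of _ 240])
    then show "arr s' = arr s \<and> reg s' ''b'' = 240 * (reg s ''k'' + 1) ^ 3 \<and>
        reg s' ''n'' = reg s ''n'' \<and> reg s' ''k'' = reg s ''k''"
      using s' by (auto simp: s0)
  qed
qed

section \<open>A constant no-instance\<close>

primrec write_adj :: "(nat \<Rightarrow> nat \<Rightarrow> nat) \<Rightarrow> (nat \<times> nat) list \<Rightarrow> com" where
  "write_adj g [] = Skip"
| "write_adj g (e # es) = Seq (Store ''adj'' (Const (fst e)) (Const (snd e)) (Const (g (fst e) (snd e)))) (write_adj g es)"

lemma runs_write_adj:
  "runs (write_adj g es) s (length es + 1) (\<lambda>s'. reg s' = reg s \<and>
     (\<forall>i j. arr s' ''adj'' i j = (if (i, j) \<in> set es then g i j else arr s ''adj'' i j)))"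
proof (induction es arbitrary: s)
  case Nil
  then show ?case using runs_Skip[of _ s] by simp
next
  case (Cons e es)
  let ?s1 = "set_arr ''adj'' (fst e) (snd e) (g (fst e) (snd e)) s"
  let ?Q = "\<lambda>s'. reg s' = reg s \<and>
     (\<forall>i j. arr s' ''adj'' i j = (if (i, j) \<in> set (e # es) then g i j else arr s ''adj'' i j))"
  have "runs (write_adj g (e # es)) s (1 + (length es + 1)) ?Q"
    unfolding write_adj.simps
  proof (rule runs_Seq, rule runs_Store, rule refl)
    fix s1 assume "s1 = set_arr ''adj'' (aval (Const (fst e)) s) (aval (Const (snd e)) s)
      (aval (Const (g (fst e) (snd e))) s) s"
    then have s1: "s1 = ?s1" by simp
    show "runs (write_adj g es) s1 (length es + 1) ?Q"
      using Cons.IH[of s1] by (rule runs_mono) (auto simp: s1 prod_eq_iff)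
  qed
  then show ?case by (rule runs_mono) auto
qed

text \<open>The cycle \<open>C4\<close>, in which indices of different parity are adjacent; with
  budget \<open>0\<close> it cannot be repaired.\<close>

definition no_instance :: com where
  "no_instance = Seq (Assign ''n'' (Const 4)) (Seq (Assign ''k'' (Const 0))
     (write_adj (\<lambda>i j. (i + j) mod 2) (List.product [0..<4] [0..<4])))"

lemma runs_no_instance:
  "runs no_instance s 19 (\<lambda>s'. reg s' ''n'' = 4 \<and> reg s' ''k'' = 0 \<and>
     (\<forall>i<4. \<forall>j<4. arr s' ''adj'' i j = (i + j) mod 2))"
proof -
  let ?Q = "\<lambda>s'. reg s' ''n'' = 4 \<and> reg s' ''k'' = 0 \<and>
     (\<forall>i<4. \<forall>j<4. arr s' ''adj'' i j = (i + j) mod 2)"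
  let ?l = "List.product [0..<4] [0..<4]"
  have "runs no_instance s (1 + (1 + (length ?l + 1))) ?Q"
    unfolding no_instance_def
  proof (rule runs_Seq, rule runs_Assign, rule refl, rule runs_Seq, rule runs_Assign, rule refl)
    fix s0 s1 assume s0: "s0 = set_reg ''n'' (aval (Const 4) s) s"
      and s1: "s1 = set_reg ''k'' (aval (Const 0) s0) s0"
    show "runs (write_adj (\<lambda>i j. (i + j) mod 2) ?l) s1 (length ?l + 1) ?Q"
      by (rule runs_mono[OF runs_write_adj]) (auto simp: s0 s1)
  qed
  then show ?thesis by (rule runs_mono) auto
qed

lemma C4_not_solvable:
  assumes "reg s ''n'' = 4" "reg s ''k'' = 0" "\<forall>i<4. \<forall>j<4. arr s ''adj'' i j = (i + j) mod 2"
  shows "valid s" "\<not> solvable s"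
proof -
  show "valid s" unfolding valid_def assms(1)
    using assms(3) by (auto simp: add.commute)
  show "\<not> solvable s"
  proof
    assume "solvable s"
    then obtain B where B: "nested {..<4} B" "card (diffs {..<4} (madj s) B) \<le> 0"
      unfolding solvable_def editable_def assms by blast
    have "finite (diffs {..<4} (madj s) B)" by (rule finite_diffs) simp
    then have "diffs {..<4} (madj s) B = {}" using B(2) by simp
    then have eq: "B i j \<longleftrightarrow> madj s i j" if "i < 4" "j < 4" for i j
      using that unfolding diffs_def by blast
    have "B 0 1" "B 3 0" "\<not> B 3 1" "B 2 1" "\<not> B 2 0"
      using assms(3) by (auto simp: eq madj_def)
    then show False using nested_private[OF B(1), of 0 1 3 2] by simp
  qed
qed

section \<open>The kernelization and its running time\<close>

definition kernelize :: com where
  "kernelize = Seq reduce (Seq size_bound (Cond (Lt (Var ''b'') (Var ''n'')) no_instance Skip))"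

definition kernel_time :: "nat \<Rightarrow> nat \<Rightarrow> nat" where
  "kernel_time n k = (1 + (n * (step_time n + 2) + 2)) + (bound_time k + (19 + 1))"

text \<open>By \<open>irreducible_card\<close>, too many vertices after the reduction certify a
  no-instance; otherwise the reduced graph is the kernel. The budget is kept or set to
  \<open>0\<close>, so it never grows.\<close>

lemma runs_kernelize:
  assumes val: "valid s"
  shows "runs kernelize s (kernel_time (reg s ''n'') (reg s ''k''))
     (\<lambda>s'. valid s' \<and> (solvable s' \<longleftrightarrow> solvable s) \<and> reg s' ''k'' \<le> reg s ''k'' \<and>
        reg s' ''n'' \<le> 240 * (reg s ''k'' + 1) ^ 3 + 4)"
  unfolding kernelize_def kernel_time_def
proof (rule runs_Seq[OF runs_reduce[OF val]])
  let ?Q = "\<lambda>s'. valid s' \<and> (solvable s' \<longleftrightarrow> solvable s) \<and> reg s' ''k'' \<le> reg s ''k'' \<and>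
        reg s' ''n'' \<le> 240 * (reg s ''k'' + 1) ^ 3 + 4"
  fix s1 assume s1: "valid s1 \<and> (solvable s1 \<longleftrightarrow> solvable s) \<and> reduced s1 \<and> reg s1 ''k'' = reg s ''k''"
  then have k1: "reg s1 ''k'' = reg s ''k''" by blast
  show "runs (Seq size_bound (Cond (Lt (Var ''b'') (Var ''n'')) no_instance Skip)) s1
     (bound_time (reg s ''k'') + (19 + 1)) ?Q"
  proof (rule runs_Seq[OF runs_size_bound[of s1, unfolded k1]])
    fix s2 :: state assume s2: "arr s2 = arr s1 \<and> reg s2 ''b'' = 240 * (reg s ''k'' + 1) ^ 3 \<and>
      reg s2 ''n'' = reg s1 ''n'' \<and> reg s2 ''k'' = reg s ''k''"
    have m: "madj s2 = madj s1" using s2 by (simp add: madj_def[abs_def])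
    show "runs (Cond (Lt (Var ''b'') (Var ''n'')) no_instance Skip) s2 (19 + 1) ?Q"
    proof (rule runs_Cond)
      assume "bval (Lt (Var ''b'') (Var ''n'')) s2"
      then have big: "240 * (reg s ''k'' + 1) ^ 3 < reg s1 ''n''" using s2 by simp
      have "\<not> solvable s1"
      proof
        assume "solvable s1"
        then have "card {..<reg s1 ''n''} \<le> 240 * (reg s1 ''k'' + 1) ^ 3"
          using s1 rgraph_madj[of s1]
          by (intro irreducible_card) (auto simp: solvable_def reduced_def removable_def)
        then show False using big k1 by simp
      qed
      then have "\<not> solvable s" using s1 by blast
      then show "runs no_instance s2 19 ?Q"
        by (intro runs_mono[OF runs_no_instance order_refl]) (auto dest: C4_not_solvable)
    next
      assume nb: "\<not> bval (Lt (Var ''b'') (Var ''n'')) s2"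
      have "valid s2" using s1 s2 by (simp add: valid_def)
      moreover have "solvable s2 \<longleftrightarrow> solvable s1" using s2 k1 m by (simp add: solvable_def)
      ultimately have "runs Skip s2 1 ?Q" using s1 s2 nb by (intro runs_Skip) auto
      then show "runs Skip s2 19 ?Q" by (rule runs_mono) auto
    qed
  qed
qed

text \<open>In the exponent, one factor stands for the candidates tried by
  \<open>find_vertex\<close> and one for the rounds of \<open>reduce\<close>; the third makes room
  for the cubic time of \<open>size_bound\<close>. The constant \<open>2000\<close> is
  generous.\<close>

lemma kernel_time_poly:
  "kernel_time n k \<le> 2000 * (10 + (n + k)) ^ (cost deletable_fm + 3)"
proof -
  define X where "X = 10 + (n + k)"
  define Y where "Y = X ^ cost deletable_fm"
  have "(n + 10) ^ cost deletable_fm \<le> Y"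
    unfolding Y_def by (rule power_mono) (auto simp: X_def)
  moreover have "1 \<le> Y" by (simp add: Y_def X_def)
  moreover have nX: "n \<le> X" "k + 1 \<le> X" "1 \<le> X" by (auto simp: X_def)
  ultimately have f: "find_time n \<le> 1 + (X * ((Y + (2 + 1) + 1) + 2) + 2)"
    unfolding find_time_def by (intro add_mono mult_le_mono) auto
  have XY: "1 \<le> X * Y" "X \<le> X * Y" using nX \<open>1 \<le> Y\<close> by auto
  have "find_time n \<le> X * Y + 6 * X + 3" using f by (simp add: algebra_simps)
  then have "find_time n \<le> 10 * (X * Y)" using XY by linarith
  moreover have "delete_time n \<le> 6 * X + 5" using nX by (simp add: delete_time_def)
  then have "delete_time n \<le> 11 * (X * Y)" using XY by linarith
  ultimately have st: "step_time n + 2 \<le> 24 * (X * Y)" using XY unfolding step_time_def by linarith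
  have "n * (step_time n + 2) \<le> X * (24 * (X * Y))" by (rule mult_le_mono[OF nX(1) st])
  also have "\<dots> \<le> X * (X * (24 * (X * Y)))" using nX(3) by simp
  finally have t1: "n * (step_time n + 2) \<le> 24 * (X * X * X * Y)" by (simp add: algebra_simps)
  have q: "X * X * X \<ge> X * X" "X * X \<ge> X" using nX(3) by auto
  have "bound_time k \<le> 1 + (X * ((X * ((X * (1 + 2) + 2) + 2) + 2) + 2) + 2)"
    unfolding bound_time_def using nX(2) by (intro add_mono mult_le_mono) auto
  also have "\<dots> = 3 * (X * X * X) + 4 * (X * X) + 4 * X + 3" by (simp add: algebra_simps)
  also have "\<dots> \<le> 14 * (X * X * X)" using q nX(3) by linarith
  finally have t2: "bound_time k \<le> 14 * (X * X * X)" .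
  have Z: "X * X * X \<le> X * X * X * Y" using \<open>1 \<le> Y\<close> by simp
  have "kernel_time n k \<le> 3 + 24 * (X * X * X * Y) + 14 * (X * X * X * Y) + 20"
    unfolding kernel_time_def using t1 t2 Z by linarith
  also have "\<dots> \<le> 2000 * (X * X * X * Y)" using Z q nX(3) by linarith
  also have "X * X * X * Y = X ^ (cost deletable_fm + 3)"
    by (simp add: Y_def power_add power3_eq_cube algebra_simps)
  finally show ?thesis by (simp add: X_def)
qed

section \<open>Machine states as instances\<close>

lemma valid_input_state:
  assumes "simple_graph G" "enumerates vs G"
  shows "valid (input_state vs G k)"
proof -
  have "edges G \<subseteq> vertex_pairs (verts G)" using assms(1) by (simp add: simple_graph_def)
  then show ?thesis using no_loop[of G "verts G"]
    by (auto simp: valid_def input_state_def insert_commute)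
qed

lemma solvable_input_state:
  assumes G: "simple_graph G" and vs: "enumerates vs G"
  shows "solvable (input_state vs G k) \<longleftrightarrow> yes_instance G k"
proof -
  let ?s = "input_state vs G k"
  have n: "reg ?s ''n'' = length vs" "reg ?s ''k'' = k" by (auto simp: input_state_def)
  have d: "distinct vs" "set vs = verts G" using vs by (auto simp: enumerates_def)
  have bij: "bij_betw ((!) vs) {..<length vs} (verts G)"
    using bij_betw_nth[OF d(1) refl d(2)[symmetric]] .
  have "editable {..<length vs} (madj ?s) k \<longleftrightarrow> editable (verts G) (radj G) k"
  proof (rule editable_cong_bij[OF bij])
    fix i j assume "i \<in> {..<length vs}" "j \<in> {..<length vs}"
    then show "madj ?s i j \<longleftrightarrow> radj G (vs ! i) (vs ! j)"
      using d(1) by (auto simp: madj_def radj_def input_state_def nth_eq_iff_index_eq)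
  qed simp
  then show ?thesis using yes_instance_iff_editable[OF G] n by (simp add: solvable_def)
qed

lemma output_of_valid:
  assumes val: "valid s"
  shows "\<exists>G. output_instance s G (reg s ''k'') \<and> (yes_instance G (reg s ''k'') \<longleftrightarrow> solvable s) \<and>
    card (verts G) = reg s ''n''"
proof -
  let ?n = "reg s ''n''" and ?M = "arr s ''adj''"
  define G where "G = UGraph {..<?n} {e. \<exists>i<?n. \<exists>j<?n. e = {i, j} \<and> ?M i j = 1}"
  have M: "?M i j \<le> 1" "?M i j = ?M j i" "?M i i = 0" if "i < ?n" "j < ?n" for i j
    using val that unfolding valid_def by blast+
  have e: "{i, j} \<in> edges G \<longleftrightarrow> ?M i j = 1" if "i < ?n" "j < ?n" for i j
    using that M(2) unfolding G_def by (auto simp: doubleton_eq_iff)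
  have G: "simple_graph G"
  proof -
    have "card {i, j} = 2" if "i < ?n" "j < ?n" "?M i j = 1" for i j
    proof -
      have "i \<noteq> j" using M(3)[OF that(1,2)] that(3) by auto
      then show ?thesis by simp
    qed
    then show ?thesis by (auto simp: simple_graph_def G_def vertex_pairs_def)
  qed
  have "output_instance s G (reg s ''k'')"
    unfolding output_instance_def
  proof (intro conjI exI[of _ "[0..<?n]"])
    show "enumerates [0..<?n] G" by (auto simp: enumerates_def G_def)
    show "\<forall>i<length [0..<?n]. \<forall>j<length [0..<?n].
        ?M i j = (if {[0..<?n] ! i, [0..<?n] ! j} \<in> edges G then 1 else 0)"
    proof (intro allI impI)
      fix i j assume "i < length [0..<?n]" "j < length [0..<?n]"
      then have ij: "i < ?n" "j < ?n" by auto
      then show "?M i j = (if {[0..<?n] ! i, [0..<?n] ! j} \<in> edges G then 1 else 0)"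
        using e[OF ij] M(1)[OF ij] by auto
    qed
  qed (use G in auto)
  moreover have "yes_instance G (reg s ''k'') \<longleftrightarrow> solvable s"
  proof -
    have "editable (verts G) (radj G) (reg s ''k'') \<longleftrightarrow> editable {..<?n} (madj s) (reg s ''k'')"
    proof (rule editable_cong_bij[where f = "\<lambda>x. x"])
      show "bij_betw (\<lambda>x. x) (verts G) {..<?n}" by (simp add: G_def bij_betw_def)
      show "radj G u v \<longleftrightarrow> madj s u v" if "u \<in> verts G" "v \<in> verts G" for u v
        using e[of u v] that by (simp add: G_def radj_def madj_def)
    qed (simp add: G_def)
    then show ?thesis using yes_instance_iff_editable[OF G] by (simp add: solvable_def)
  qed
  moreover have "card (verts G) = ?n" by (simp add: G_def)
  ultimately show ?thesis by blast
qed

lemma computable_id: "computable (\<lambda>k. k)"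
  unfolding computable_def
proof (intro exI allI conjI)
  fix x
  show "exec (Assign ''y'' (Var ''x'')) (set_reg ''x'' x blank) 1
    (set_reg ''y'' (aval (Var ''x'') (set_reg ''x'' x blank)) (set_reg ''x'' x blank))"
    by (rule exec_Assign)
qed simp

lemma cubic_bound: "(\<lambda>k. real (240 * (k + 1) ^ 3 + 4)) \<in> O(\<lambda>k. real k ^ 3)"
\<comment> \<open>\<open>1924 = 240 * 8 + 4\<close>, since \<open>k + 1\<close> is at most
  \<open>2 * k\<close> from \<open>k = 1\<close> on.\<close>
proof (rule bigoI[where c = 1924])
  show "\<forall>\<^sub>F k in sequentially. norm (real (240 * (k + 1) ^ 3 + 4)) \<le> 1924 * norm (real k ^ 3)"
    using eventually_ge_at_top[of 1]
  proof eventually_elim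
    case (elim k)
    have "(k + 1) ^ 3 \<le> (2 * k) ^ 3" by (rule power_mono) (use elim in auto)
    moreover have "1 \<le> k ^ 3" using elim by simp
    ultimately have "240 * (k + 1) ^ 3 + 4 \<le> 1924 * k ^ 3" by (simp add: power_mult_distrib)
    then have "real (240 * (k + 1) ^ 3 + 4) \<le> real (1924 * k ^ 3)" by (rule of_nat_mono)
    then show ?case by simp
  qed
qed

theorem theorem20:
  "\<exists>(P :: com) (p :: nat poly) (f :: nat \<Rightarrow> nat) (g :: nat \<Rightarrow> nat).
     (\<lambda>k. real (f k)) \<in> O(\<lambda>k. real k ^ 3) \<and>
     computable g \<and>
     (\<forall>(G :: nat ugraph) (vs :: nat list) (k :: nat).
        simple_graph G \<and> enumerates vs G \<longrightarrow>
        (\<exists>t s (G' :: nat ugraph) k'.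
           exec P (input_state vs G k) t s \<and>
           t \<le> poly p (card (verts G) + k) \<and>
           output_instance s G' k' \<and>
           (yes_instance G' k' \<longleftrightarrow> yes_instance G k) \<and>
           card (verts G') \<le> f k \<and>
           k' \<le> g k))"
proof -
  let ?e = "cost deletable_fm + 3"
  let ?p = "smult 2000 ([:10, 1:] ^ ?e) :: nat poly"
  let ?f = "\<lambda>k :: nat. 240 * (k + 1) ^ 3 + 4"
  have "\<exists>t s G' k'. exec kernelize (input_state vs G k) t s \<and> t \<le> poly ?p (card (verts G) + k) \<and>
      output_instance s G' k' \<and> (yes_instance G' k' \<longleftrightarrow> yes_instance G k) \<and>
      card (verts G') \<le> ?f k \<and> k' \<le> k"
    if G: "simple_graph G" and vs: "enumerates vs G" for G vs k
  proof -
    let ?s = "input_state vs G k"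
    have n: "reg ?s ''n'' = length vs" "reg ?s ''k'' = k" by (auto simp: input_state_def)
    have len: "length vs = card (verts G)" using vs by (metis distinct_card enumerates_def)
    from runs_kernelize[OF valid_input_state[OF G vs, of k]]
    obtain t s where ex: "exec kernelize ?s t s" and t: "t \<le> kernel_time (card (verts G)) k"
      and s: "valid s" "solvable s \<longleftrightarrow> solvable ?s" "reg s ''k'' \<le> k" "reg s ''n'' \<le> ?f k"
      unfolding runs_def n len by blast
    obtain G' where G': "output_instance s G' (reg s ''k'')"
      "yes_instance G' (reg s ''k'') \<longleftrightarrow> solvable s" "card (verts G') = reg s ''n''"
      using output_of_valid[OF s(1)] by blast
    have "t \<le> poly ?p (card (verts G) + k)"
      using t kernel_time_poly[of "card (verts G)" k] by simp
    moreover have "yes_instance G' (reg s ''k'') \<longleftrightarrow> yes_instance G k"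
      using G'(2) s(2) solvable_input_state[OF G vs] by simp
    moreover have "card (verts G') \<le> ?f k" using G'(3) s(4) by simp
    ultimately show ?thesis using ex G'(1) s(3) by blast
  qed
  then show ?thesis
    by (intro exI[of _ kernelize] exI[of _ ?p] exI[of _ ?f] exI[of _ "\<lambda>k. k"] conjI
        cubic_bound computable_id) blast
qed

end
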